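(* Let $X$ be a simplicial complex of type $S=\{s_1,\dots,s_n\}$ which is $\widetilde C$-like and locally determined. Let $Y\subset X$ be a connected, locally determined, locally convex subcomplex. Then $Y$ itself is $\widetilde C$-like. Moreover, if $y_1,y_2$ are vertices of $Y$ with $y_2$ extremal and $\omega\subset X$ is a local normal form path (in $X$) from $y_1$ to $y_2$, then $\omega\subset Y$.
   Context: Let $S=\{s_1<s_2<\cdots<s_n\}$ be a finite totally ordered set. A simplicial complex $X$ is of type $S$ if all its maximal simplices have dimension $n-1$ and its vertices carry a type function with values in $\{\hat s_1,\dots,\hat s_n\}$ such that adjacent vertices have different types. Order types by $\hat s_1<\cdots<\hat s_n$ and define on the vertex set $V$: $x<y$ iff $x,y$ are adjacent and $\mathrm{Type}(x)<\mathrm{Type}(y)$. A poset is bowtie free if whenever $x_i<y_j$ for all $i,j\in\{1,2\}$ there is $z$ with $x_i\le z\le y_j$ for all $i,j$. It is upward (downward) flag if any three pairwise upper (lower) bounded elements have a common upper (lower) bound. $X$ is $\widetilde C$-like if it is simply connected, $<$ is a partial order on $V$, and for every $x\in V$ the poset $V_{\ge x}$ is bowtie free and upward flag and the poset $V_{\le x}$ is bowtie free and downward flag. A vertex is extremal if it is of type $\hat s_1$ or $\hat s_n$. $X$ is locally determined if for every pair of vertices $x<y$ there is an extremal vertex $y'$ with $x<y'$ and $y',y$ not comparable, and there is an extremal vertex $x'$ with $x'<y$ and $x',x$ not comparable. For a vertex $x$, $\mathrm{lk}^-(x,X)$ (resp. $\mathrm{lk}^+(x,X)$) is the full subcomplex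 of the link of $x$ spanned by the vertices $<x$ (resp. $>x$), with the induced order. An up-down path is an edge path $x_1\ldots x_k$ such that for each $2\le i\le k-1$: $x_{i-1}<x_i$ implies $x_i>x_{i+1}$, and $x_{i-1}>x_i$ implies $x_i<x_{i+1}$. It is tight if $x_{i-1}<x_i>x_{i+1}$ implies $x_i$ is the join of $x_{i-1},x_{i+1}$, and $x_{i-1}>x_i<x_{i+1}$ implies $x_i$ is the meet of $x_{i-1},x_{i+1}$ (join = least upper bound, meet = greatest lower bound, in the poset under consideration). An up-down path $x_1\ldots x_k$ is a local normal form path from $x_1$ to $x_k$ if for each $2\le i\le k-1$: (1) if $x_{i-1}<x_i>x_{i+1}$, there do not exist vertices $a_1=x_{i-1},a_2,a_3,a_4=x_{i+1}$ in $\mathrm{lk}^-(x_i,X)$ with $a_1\le a_2\ge a_3\le a_4$; (2) if $x_{i-1}>x_i<x_{i+1}$, there do not exist vertices $a_1=x_{i-1},a_2,a_3,a_4=x_{i+1}$ in $\mathrm{lk}^+(x_i,X)$ with $a_1\ge a_2\le a_3\ge a_4$. A full subcomplex $Y\subset X$ is locally convex if: (1) $Y$ is also a simplicial complex of type $S$ (with the restricted type function); (2) for every vertex $y\in Y$, any tight up-down edge path of length $2$ in $\mathrm{lk}^+(y,X)$ with endpoints in $\mathrm{lk}^+(y,Y)$ is contained in $\mathrm{lk}^+(y,Y)$, and likewise with $+$ replaced by $-$; (3) for every vertex $y\in Y$, any tight up-down edge path $a_1<a_2>a_3<a_4$ in $\mathrm{lk}^-(y,X)$ with $a_1,a_4\in\mathrm{lk}^-(y,Y)$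 is contained in $\mathrm{lk}^-(y,Y)$, and any tight up-down edge path $a_1>a_2<a_3>a_4$ in $\mathrm{lk}^+(y,X)$ with $a_1,a_4\in\mathrm{lk}^+(y,Y)$ is contained in $\mathrm{lk}^+(y,Y)$.
   Formalization: X is additionally assumed to be a flag complex (pairwise adjacent vertices span a simplex); without this the claim fails, since deleting triangles and tetrahedra along a closed curve in Y can keep X simply connected while Y is not. *)

theory Defs
  imports "HOL-Analysis.Analysis"
begin

section \<open>Abstract simplicial complexes\<close>

text \<open>Complexes may be infinite, so the library's (finite, embedded) \<open>simplicial_complex\<close> does not
  apply. A complex is the set of its nonempty simplices.\<close>

definition abs_complex :: "'v set set \<Rightarrow> bool" where
  "abs_complex X \<longleftrightarrow>
     (\<forall>\<sigma>\<in>X. finite \<sigma> \<and> \<sigma> \<noteq> {} \<and> (\<forall>\<rho>. \<rho> \<subseteq> \<sigma> \<and> \<rho> \<noteq> {} \<longrightarrow> \<rho> \<in> X))"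

definition vertices :: "'v set set \<Rightarrow> 'v set" where
  "vertices X = {v. {v} \<in> X}"

definition adjacent :: "'v set set \<Rightarrow> 'v \<Rightarrow> 'v \<Rightarrow> bool" where
  "adjacent X u v \<longleftrightarrow> u \<noteq> v \<and> {u, v} \<in> X"

definition full_subcomplex :: "'v set set \<Rightarrow> 'v set \<Rightarrow> 'v set set" where
  "full_subcomplex X W = {\<sigma> \<in> X. \<sigma> \<subseteq> W}"

definition link :: "'v set set \<Rightarrow> 'v \<Rightarrow> 'v set set" where
  "link X x = {\<sigma> \<in> X. x \<notin> \<sigma> \<and> insert x \<sigma> \<in> X}"

text \<open>The conditions on complexes below concern the order on the vertices and simple connectivity.
  They do not imply flagness: the interior of a simplex of dimension at least 3 can be deleted
  without affecting either.\<close>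

definition flag_complex :: "'v set set \<Rightarrow> bool" where
  "flag_complex X \<longleftrightarrow>
     (\<forall>\<sigma>. finite \<sigma> \<and> \<sigma> \<noteq> {} \<and> \<sigma> \<subseteq> vertices X
          \<and> (\<forall>u\<in>\<sigma>. \<forall>v\<in>\<sigma>. u \<noteq> v \<longrightarrow> adjacent X u v) \<longrightarrow> \<sigma> \<in> X)"


section \<open>Geometric realization and simple connectivity\<close>

text \<open>Points are given by barycentric coordinates.\<close>

definition closed_simplex :: "'v set \<Rightarrow> ('v \<Rightarrow> real) set" where
  "closed_simplex \<sigma> =
     {f. (\<forall>v. 0 \<le> f v) \<and> (\<forall>v. v \<notin> \<sigma> \<longrightarrow> f v = 0) \<and> (\<Sum>v\<in>\<sigma>. f v) = 1}"

text \<open>The weak (coherent) topology. A single closed simplex carries the subspace topology of the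
  product topology, which is its Euclidean topology, since only finitely many coordinates are
  nonzero there.\<close>

definition realization :: "'v set set \<Rightarrow> ('v \<Rightarrow> real) topology" where
  "realization X = topology (\<lambda>U. U \<subseteq> (\<Union>\<sigma>\<in>X. closed_simplex \<sigma>) \<and>
     (\<forall>\<sigma>\<in>X. openin (top_of_set (closed_simplex \<sigma>)) (U \<inter> closed_simplex \<sigma>)))"

lemma openin_realization:
  "openin (realization X) U \<longleftrightarrow> U \<subseteq> (\<Union>\<sigma>\<in>X. closed_simplex \<sigma>) \<and>
     (\<forall>\<sigma>\<in>X. openin (top_of_set (closed_simplex \<sigma>)) (U \<inter> closed_simplex \<sigma>))"
proof -
  have "istopology (\<lambda>U. U \<subseteq> (\<Union>\<sigma>\<in>X. closed_simplex \<sigma>) \<and>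
     (\<forall>\<sigma>\<in>X. openin (top_of_set (closed_simplex \<sigma>)) (U \<inter> closed_simplex \<sigma>)))"
    (is "istopology ?L")
    unfolding istopology_def
  proof (intro conjI allI impI)
    fix S T assume "?L S" "?L T"
    then show "S \<inter> T \<subseteq> (\<Union>\<sigma>\<in>X. closed_simplex \<sigma>)" by blast
    show "\<forall>\<sigma>\<in>X. openin (top_of_set (closed_simplex \<sigma>)) (S \<inter> T \<inter> closed_simplex \<sigma>)"
    proof
      fix \<sigma> assume "\<sigma> \<in> X"
      with \<open>?L S\<close> \<open>?L T\<close>
      have "openin (top_of_set (closed_simplex \<sigma>)) (S \<inter> closed_simplex \<sigma>)"
        and "openin (top_of_set (closed_simplex \<sigma>)) (T \<inter> closed_simplex \<sigma>)" by blast+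
      from openin_Int[OF this]
      have "openin (top_of_set (closed_simplex \<sigma>))
          ((S \<inter> closed_simplex \<sigma>) \<inter> (T \<inter> closed_simplex \<sigma>))" .
      moreover have "(S \<inter> closed_simplex \<sigma>) \<inter> (T \<inter> closed_simplex \<sigma>) =
          S \<inter> T \<inter> closed_simplex \<sigma>" by blast
      ultimately show "openin (top_of_set (closed_simplex \<sigma>)) (S \<inter> T \<inter> closed_simplex \<sigma>)"
        by (simp only:)
    qed
  next
    fix \<K> assume K: "\<forall>K\<in>\<K>. ?L K"
    then show "\<Union>\<K> \<subseteq> (\<Union>\<sigma>\<in>X. closed_simplex \<sigma>)" by blast
    show "\<forall>\<sigma>\<in>X. openin (top_of_set (closed_simplex \<sigma>)) (\<Union>\<K> \<inter> closed_simplex \<sigma>)"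
    proof
      fix \<sigma> assume "\<sigma> \<in> X"
      with K have "openin (top_of_set (closed_simplex \<sigma>)) (K \<inter> closed_simplex \<sigma>)" if "K \<in> \<K>" for K
        using that by blast
      then have "openin (top_of_set (closed_simplex \<sigma>)) (\<Union>((\<lambda>K. K \<inter> closed_simplex \<sigma>) ` \<K>))"
        by (intro openin_Union) (erule imageE, simp only:)
      moreover have "\<Union>((\<lambda>K. K \<inter> closed_simplex \<sigma>) ` \<K>) = \<Union>\<K> \<inter> closed_simplex \<sigma>" by blast
      ultimately show "openin (top_of_set (closed_simplex \<sigma>)) (\<Union>\<K> \<inter> closed_simplex \<sigma>)"
        by (simp only:)
    qed
  qed
  then show ?thesis
    unfolding realization_def by (subst topology_inverse') simp_all
qed

definition simply_connected_space :: "'a topology \<Rightarrow> bool" where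
  "simply_connected_space T \<longleftrightarrow> path_connected_space T \<and>
     (\<forall>p. pathin T p \<and> p 1 = p 0 \<longrightarrow>
        homotopic_with (\<lambda>h. h 0 = p 0 \<and> h 1 = p 0) (top_of_set {0..1}) T p (\<lambda>_. p 0))"


section \<open>Posets\<close>

text \<open>A poset is given by its carrier \<open>P\<close> and a reflexive order \<open>le\<close>, which is used only on
  \<open>P\<close>.\<close>

definition bowtie_free :: "'v set \<Rightarrow> ('v \<Rightarrow> 'v \<Rightarrow> bool) \<Rightarrow> bool" where
  "bowtie_free P le \<longleftrightarrow>
     (\<forall>x1\<in>P. \<forall>x2\<in>P. \<forall>y1\<in>P. \<forall>y2\<in>P.
        (\<forall>x\<in>{x1, x2}. \<forall>y\<in>{y1, y2}. le x y \<and> x \<noteq> y) \<longrightarrow>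
        (\<exists>z\<in>P. \<forall>x\<in>{x1, x2}. \<forall>y\<in>{y1, y2}. le x z \<and> le z y))"

definition bounded_above_in :: "'v set \<Rightarrow> ('v \<Rightarrow> 'v \<Rightarrow> bool) \<Rightarrow> 'v set \<Rightarrow> bool" where
  "bounded_above_in P le A \<longleftrightarrow> (\<exists>u\<in>P. \<forall>a\<in>A. le a u)"

definition bounded_below_in :: "'v set \<Rightarrow> ('v \<Rightarrow> 'v \<Rightarrow> bool) \<Rightarrow> 'v set \<Rightarrow> bool" where
  "bounded_below_in P le A \<longleftrightarrow> (\<exists>u\<in>P. \<forall>a\<in>A. le u a)"

definition upward_flag :: "'v set \<Rightarrow> ('v \<Rightarrow> 'v \<Rightarrow> bool) \<Rightarrow> bool" where
  "upward_flag P le \<longleftrightarrow>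
     (\<forall>a\<in>P. \<forall>b\<in>P. \<forall>c\<in>P.
        bounded_above_in P le {a, b} \<and> bounded_above_in P le {b, c} \<and> bounded_above_in P le {a, c}
        \<longrightarrow> bounded_above_in P le {a, b, c})"

definition downward_flag :: "'v set \<Rightarrow> ('v \<Rightarrow> 'v \<Rightarrow> bool) \<Rightarrow> bool" where
  "downward_flag P le \<longleftrightarrow>
     (\<forall>a\<in>P. \<forall>b\<in>P. \<forall>c\<in>P.
        bounded_below_in P le {a, b} \<and> bounded_below_in P le {b, c} \<and> bounded_below_in P le {a, c}
        \<longrightarrow> bounded_below_in P le {a, b, c})"

definition is_join :: "'v set \<Rightarrow> ('v \<Rightarrow> 'v \<Rightarrow> bool) \<Rightarrow> 'v \<Rightarrow> 'v \<Rightarrow> 'v \<Rightarrow> bool" where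
  "is_join P le z x y \<longleftrightarrow>
     z \<in> P \<and> le x z \<and> le y z \<and> (\<forall>u\<in>P. le x u \<and> le y u \<longrightarrow> le z u)"

definition is_meet :: "'v set \<Rightarrow> ('v \<Rightarrow> 'v \<Rightarrow> bool) \<Rightarrow> 'v \<Rightarrow> 'v \<Rightarrow> 'v \<Rightarrow> bool" where
  "is_meet P le z x y \<longleftrightarrow>
     z \<in> P \<and> le z x \<and> le z y \<and> (\<forall>u\<in>P. le u x \<and> le u y \<longrightarrow> le u z)"


section \<open>Complexes of type S\<close>

text \<open>Types are the elements of \<open>S\<close> themselves. All vertices of a simplex have
  different types, so every simplex lies in a maximal one.\<close>

definition complex_of_type :: "'s::linorder set \<Rightarrow> ('v \<Rightarrow> 's) \<Rightarrow> 'v set set \<Rightarrow> bool" where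
  "complex_of_type S \<tau> X \<longleftrightarrow>
     finite S \<and> abs_complex X \<and>
     (\<forall>\<sigma>\<in>X. (\<forall>\<rho>\<in>X. \<sigma> \<subseteq> \<rho> \<longrightarrow> \<rho> = \<sigma>) \<longrightarrow> card \<sigma> = card S) \<and>
     \<tau> ` vertices X \<subseteq> S \<and>
     (\<forall>u v. adjacent X u v \<longrightarrow> \<tau> u \<noteq> \<tau> v)"

definition vless :: "('v \<Rightarrow> 's::linorder) \<Rightarrow> 'v set set \<Rightarrow> 'v \<Rightarrow> 'v \<Rightarrow> bool" where
  "vless \<tau> X x y \<longleftrightarrow> adjacent X x y \<and> \<tau> x < \<tau> y"

definition vle :: "('v \<Rightarrow> 's::linorder) \<Rightarrow> 'v set set \<Rightarrow> 'v \<Rightarrow> 'v \<Rightarrow> bool" where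
  "vle \<tau> X x y \<longleftrightarrow> x = y \<or> vless \<tau> X x y"

definition C_tilde_like :: "('v \<Rightarrow> 's::linorder) \<Rightarrow> 'v set set \<Rightarrow> bool" where
  "C_tilde_like \<tau> X \<longleftrightarrow>
     simply_connected_space (realization X) \<and>
     partial_order_on (vertices X) {(x, y). x \<in> vertices X \<and> y \<in> vertices X \<and> vle \<tau> X x y} \<and>
     (\<forall>x\<in>vertices X.
        bowtie_free {y \<in> vertices X. vle \<tau> X x y} (vle \<tau> X) \<and>
        upward_flag {y \<in> vertices X. vle \<tau> X x y} (vle \<tau> X) \<and>
        bowtie_free {y \<in> vertices X. vle \<tau> X y x} (vle \<tau> X) \<and>
        downward_flag {y \<in> vertices X. vle \<tau> X y x} (vle \<tau> X))"

definition extremal :: "'s::linorder set \<Rightarrow> ('v \<Rightarrow> 's) \<Rightarrow> 'v \<Rightarrow> bool" where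
  "extremal S \<tau> x \<longleftrightarrow> \<tau> x = Min S \<or> \<tau> x = Max S"

definition locally_determined ::
    "'s::linorder set \<Rightarrow> ('v \<Rightarrow> 's) \<Rightarrow> 'v set set \<Rightarrow> bool" where
  "locally_determined S \<tau> X \<longleftrightarrow>
     (\<forall>x\<in>vertices X. \<forall>y\<in>vertices X. vless \<tau> X x y \<longrightarrow>
        (\<exists>y'\<in>vertices X. extremal S \<tau> y' \<and> vless \<tau> X x y' \<and>
            \<not> vle \<tau> X y' y \<and> \<not> vle \<tau> X y y') \<and>
        (\<exists>x'\<in>vertices X. extremal S \<tau> x' \<and> vless \<tau> X x' y \<and>
            \<not> vle \<tau> X x' x \<and> \<not> vle \<tau> X x x'))"

definition lk_minus :: "('v \<Rightarrow> 's::linorder) \<Rightarrow> 'v set set \<Rightarrow> 'v \<Rightarrow> 'v set set" where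
  "lk_minus \<tau> X x = full_subcomplex (link X x) {v. vless \<tau> X v x}"

definition lk_plus :: "('v \<Rightarrow> 's::linorder) \<Rightarrow> 'v set set \<Rightarrow> 'v \<Rightarrow> 'v set set" where
  "lk_plus \<tau> X x = full_subcomplex (link X x) {v. vless \<tau> X x v}"


section \<open>Edge paths\<close>

text \<open>Paths are lists of vertices. An edge path in \<open>K\<close> has its vertices and its edges in
  \<open>K\<close>, so the predicate also expresses that a path is contained in a subcomplex.\<close>

definition edge_path :: "'v set set \<Rightarrow> 'v list \<Rightarrow> bool" where
  "edge_path K p \<longleftrightarrow> p \<noteq> [] \<and> set p \<subseteq> vertices K \<and> successively (adjacent K) p"

text \<open>The complex \<open>K\<close> is the one in which the path lives, for instance a link in \<open>X\<close>; its
  vertices carry the order induced from \<open>X\<close>.\<close>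

definition updown_path ::
    "('v \<Rightarrow> 's::linorder) \<Rightarrow> 'v set set \<Rightarrow> 'v set set \<Rightarrow> 'v list \<Rightarrow> bool" where
  "updown_path \<tau> X K p \<longleftrightarrow> edge_path K p \<and>
     (\<forall>i. 0 < i \<and> i + 1 < length p \<longrightarrow>
        (vless \<tau> X (p ! (i - 1)) (p ! i) \<longrightarrow> vless \<tau> X (p ! (i + 1)) (p ! i)) \<and>
        (vless \<tau> X (p ! i) (p ! (i - 1)) \<longrightarrow> vless \<tau> X (p ! i) (p ! (i + 1))))"

definition tight_updown_path ::
    "('v \<Rightarrow> 's::linorder) \<Rightarrow> 'v set set \<Rightarrow> 'v set set \<Rightarrow> 'v list \<Rightarrow> bool" where
  "tight_updown_path \<tau> X K p \<longleftrightarrow> updown_path \<tau> X K p \<and>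
     (\<forall>i. 0 < i \<and> i + 1 < length p \<longrightarrow>
        (vless \<tau> X (p ! (i - 1)) (p ! i) \<and> vless \<tau> X (p ! (i + 1)) (p ! i) \<longrightarrow>
           is_join (vertices K) (vle \<tau> X) (p ! i) (p ! (i - 1)) (p ! (i + 1))) \<and>
        (vless \<tau> X (p ! i) (p ! (i - 1)) \<and> vless \<tau> X (p ! i) (p ! (i + 1)) \<longrightarrow>
           is_meet (vertices K) (vle \<tau> X) (p ! i) (p ! (i - 1)) (p ! (i + 1))))"

definition local_normal_form_path ::
    "('v \<Rightarrow> 's::linorder) \<Rightarrow> 'v set set \<Rightarrow> 'v \<Rightarrow> 'v \<Rightarrow> 'v list \<Rightarrow> bool" where
  "local_normal_form_path \<tau> X x y p \<longleftrightarrow>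
     updown_path \<tau> X X p \<and> hd p = x \<and> last p = y \<and>
     (\<forall>i. 0 < i \<and> i + 1 < length p \<longrightarrow>
        (vless \<tau> X (p ! (i - 1)) (p ! i) \<and> vless \<tau> X (p ! (i + 1)) (p ! i) \<longrightarrow>
           \<not> (\<exists>a1 a2 a3 a4. {a1, a2, a3, a4} \<subseteq> vertices (lk_minus \<tau> X (p ! i)) \<and>
                a1 = p ! (i - 1) \<and> a4 = p ! (i + 1) \<and>
                vle \<tau> X a1 a2 \<and> vle \<tau> X a3 a2 \<and> vle \<tau> X a3 a4)) \<and>
        (vless \<tau> X (p ! i) (p ! (i - 1)) \<and> vless \<tau> X (p ! i) (p ! (i + 1)) \<longrightarrow>
           \<not> (\<exists>a1 a2 a3 a4. {a1, a2, a3, a4} \<subseteq> vertices (lk_plus \<tau> X (p ! i)) \<and>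
                a1 = p ! (i - 1) \<and> a4 = p ! (i + 1) \<and>
                vle \<tau> X a2 a1 \<and> vle \<tau> X a2 a3 \<and> vle \<tau> X a4 a3)))"


section \<open>Local convexity\<close>

definition locally_convex ::
    "'s::linorder set \<Rightarrow> ('v \<Rightarrow> 's) \<Rightarrow> 'v set set \<Rightarrow> 'v set set \<Rightarrow> bool" where
  "locally_convex S \<tau> X Y \<longleftrightarrow>
     Y = full_subcomplex X (vertices Y) \<and>
     complex_of_type S \<tau> Y \<and>
     (\<forall>y\<in>vertices Y. \<forall>(LX, LY)\<in>{(lk_plus \<tau> X y, lk_plus \<tau> Y y), (lk_minus \<tau> X y, lk_minus \<tau> Y y)}.
        \<forall>a1 a2 a3. tight_updown_path \<tau> X LX [a1, a2, a3] \<and> a1 \<in> vertices LY \<and> a3 \<in> vertices LY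
          \<longrightarrow> edge_path LY [a1, a2, a3]) \<and>
     (\<forall>y\<in>vertices Y. \<forall>a1 a2 a3 a4.
        (tight_updown_path \<tau> X (lk_minus \<tau> X y) [a1, a2, a3, a4] \<and>
           vless \<tau> X a1 a2 \<and> vless \<tau> X a3 a2 \<and> vless \<tau> X a3 a4 \<and>
           a1 \<in> vertices (lk_minus \<tau> Y y) \<and> a4 \<in> vertices (lk_minus \<tau> Y y)
           \<longrightarrow> edge_path (lk_minus \<tau> Y y) [a1, a2, a3, a4]) \<and>
        (tight_updown_path \<tau> X (lk_plus \<tau> X y) [a1, a2, a3, a4] \<and>
           vless \<tau> X a2 a1 \<and> vless \<tau> X a2 a3 \<and> vless \<tau> X a4 a3 \<and>
           a1 \<in> vertices (lk_plus \<tau> Y y) \<and> a4 \<in> vertices (lk_plus \<tau> Y y)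
           \<longrightarrow> edge_path (lk_plus \<tau> Y y) [a1, a2, a3, a4]))"

end

theory Submission
  imports Defs
begin

text \<open>Fix an extremal vertex \<open>y\<close> of a \<open>C\<close>-tilde-like complex. The local normal form paths ending at \<open>y\<close>
  form a covering of the complex, with projection to the initial vertex: along an edge, a normal form
  is transported by modifying it with joins, meets and the flag condition, in exactly one way. If the
  complex is simply connected, the covering is trivial, so that normal form paths to \<open>y\<close> are
  determined by their initial vertex. Local convexity makes normal form paths of \<open>Y\<close> normal in \<open>X\<close>.
  Since \<open>Y\<close> is connected, each of its vertices starts a normal form path in \<open>Y\<close>, and by uniqueness in
  \<open>X\<close> there is no other. Sending each vertex of \<open>Y\<close> to the next vertex of its normal form then
  dismantles \<open>Y\<close> to the single vertex \<open>y\<close>, hence \<open>Y\<close> is simply connected.\<close>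

subsection \<open>The geometric realization\<close>

text \<open>Bowtie freeness is imposed only above or below a vertex, so joins and meets exist only
  for pairs that are bounded on both sides. An edge at the head of a normal form provides one bound;
  whether the other exists decides if the path loses, keeps or gains a vertex during transport.
  Extremality of \<open>y\<close> fixes the direction of the last edge, so the parity of the length
  tells whether the head is a local minimum or a local maximum. Up and down moves are dual, and most
  arguments are carried out for one order and then applied to its converse. The order sees only the
  edges of a complex, while simple connectivity belongs to the realization with its weak topology.
  The passage in both directions rests on open stars and compactness: small pieces of paths and
  homotopies lie in the star of a vertex, and a compact set has only finitely many supports, which
  makes straight line homotopies continuous. Flagness turns pairwise comparable vertices back into
  simplices.\<close>

definition supp :: "('v \<Rightarrow> real) \<Rightarrow> 'v set" where
  "supp f = {v. f v \<noteq> 0}"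

lemma abs_complexD:
  assumes "abs_complex K" "\<sigma> \<in> K"
  shows "finite \<sigma>" "\<sigma> \<noteq> {}" "\<rho> \<subseteq> \<sigma> \<Longrightarrow> \<rho> \<noteq> {} \<Longrightarrow> \<rho> \<in> K"
  using assms unfolding abs_complex_def by blast+

lemma topspace_realization: "topspace (realization K) = (\<Union>\<sigma>\<in>K. closed_simplex \<sigma>)"
proof -
  have "openin (realization K) (\<Union>\<sigma>\<in>K. closed_simplex \<sigma>)"
    unfolding openin_realization
  proof (intro conjI ballI)
    fix \<sigma> assume "\<sigma> \<in> K"
    then have "(\<Union>\<sigma>\<in>K. closed_simplex \<sigma>) \<inter> closed_simplex \<sigma> = closed_simplex \<sigma>" by blast
    then show "openin (top_of_set (closed_simplex \<sigma>)) ((\<Union>\<sigma>\<in>K. closed_simplex \<sigma>) \<inter> closed_simplex \<sigma>)"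
      by (metis openin_subtopology_self)
  qed simp
  then show ?thesis
    by (metis openin_realization openin_subset openin_topspace subset_antisym)
qed

lemma supp_closed_simplex:
  assumes "f \<in> closed_simplex \<sigma>"
  shows "supp f \<subseteq> \<sigma>" "supp f \<noteq> {}"
proof -
  show "supp f \<subseteq> \<sigma>" using assms by (auto simp: supp_def closed_simplex_def)
  have "(\<Sum>v\<in>\<sigma>. f v) = 0" if "supp f = {}" using that by (auto simp: supp_def)
  then show "supp f \<noteq> {}" using assms by (auto simp: closed_simplex_def)
qed

lemma in_closed_simplex_supp:
  assumes "f \<in> closed_simplex \<sigma>" "finite \<sigma>"
  shows "f \<in> closed_simplex (supp f)"
proof -
  have "(\<Sum>v\<in>\<sigma>. f v) = (\<Sum>v\<in>supp f. f v)"
    using assms supp_closed_simplex[OF assms(1)] by (intro sum.mono_neutral_right) (auto simp: supp_def)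
  then show ?thesis using assms by (auto simp: closed_simplex_def supp_def)
qed

lemma supp_in_complex:
  assumes "abs_complex K" "f \<in> topspace (realization K)"
  shows "supp f \<in> K" "f \<in> closed_simplex (supp f)"
proof -
  obtain \<sigma> where \<sigma>: "\<sigma> \<in> K" "f \<in> closed_simplex \<sigma>" using assms(2) by (auto simp: topspace_realization)
  show "supp f \<in> K"
    using abs_complexD(3)[OF assms(1) \<sigma>(1)] supp_closed_simplex[OF \<sigma>(2)] by simp
  show "f \<in> closed_simplex (supp f)"
    using \<sigma> abs_complexD(1)[OF assms(1)] by (intro in_closed_simplex_supp)
qed

lemma closed_singleton_fun: "closed {f :: 'v \<Rightarrow> real}"
proof -
  have "{f} = (\<Inter>v. {g. g v = f v})" by auto
  moreover have "closed {g :: 'v \<Rightarrow> real. g v = f v}" for v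
    by (intro closed_Collect_eq continuous_on_product_coordinates continuous_on_const)
  ultimately show ?thesis by (simp add: closed_INT)
qed

lemma closed_closed_simplex:
  assumes "finite \<sigma>"
  shows "closed (closed_simplex \<sigma>)"
proof -
  have "closed_simplex \<sigma> = (\<Inter>v. {f. 0 \<le> f v}) \<inter> (\<Inter>v\<in>-\<sigma>. {f. f v = 0}) \<inter> {f. (\<Sum>v\<in>\<sigma>. f v) = 1}"
    by (auto simp: closed_simplex_def)
  moreover have "closed {f::'a\<Rightarrow>real. 0 \<le> f v}" for v
    by (intro closed_Collect_le continuous_on_product_coordinates continuous_on_const)
  moreover have "closed {f::'a\<Rightarrow>real. f v = 0}" for v
    by (intro closed_Collect_eq continuous_on_product_coordinates continuous_on_const)
  moreover have "closed {f::'a\<Rightarrow>real. (\<Sum>v\<in>\<sigma>. f v) = 1}"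
    by (intro closed_Collect_eq continuous_on_sum continuous_on_product_coordinates continuous_on_const)
  ultimately show ?thesis by (auto intro!: closed_INT closed_Int)
qed

text \<open>A closed simplex on finitely many vertices is closed in the product topology. Relative
  closedness in it is therefore plain closedness, and the weak topology can be handled through
  closed sets of functions.\<close>

lemma closedin_realization_iff:
  assumes "abs_complex K"
  shows "closedin (realization K) C \<longleftrightarrow>
     C \<subseteq> topspace (realization K) \<and> (\<forall>\<sigma>\<in>K. closed (C \<inter> closed_simplex \<sigma>))"
proof -
  have "openin (top_of_set (closed_simplex \<sigma>)) ((topspace (realization K) - C) \<inter> closed_simplex \<sigma>)
      \<longleftrightarrow> closed (C \<inter> closed_simplex \<sigma>)" if "\<sigma> \<in> K" for \<sigma>
  proof -
    have fin: "finite \<sigma>" using abs_complexD(1)[OF assms that] .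
    have sub: "closed_simplex \<sigma> \<subseteq> topspace (realization K)"
      using that by (auto simp: topspace_realization)
    have "(topspace (realization K) - C) \<inter> closed_simplex \<sigma> = closed_simplex \<sigma> - C \<inter> closed_simplex \<sigma>"
      using sub by blast
    then have "openin (top_of_set (closed_simplex \<sigma>)) ((topspace (realization K) - C) \<inter> closed_simplex \<sigma>)
      \<longleftrightarrow> closedin (top_of_set (closed_simplex \<sigma>)) (C \<inter> closed_simplex \<sigma>)"
      by (metis Int_lower2 closedin_def topspace_euclidean_subtopology)
    also have "\<dots> \<longleftrightarrow> closed (C \<inter> closed_simplex \<sigma>)"
      by (metis Int_lower2 closed_closed_simplex[OF fin] closedin_closed_eq)
    finally show ?thesis .
  qed
  then show ?thesis
    unfolding closedin_def openin_realization
    by (auto simp: topspace_realization)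
qed

lemma continuous_map_realization_coordinate:
  "continuous_map (realization K) euclideanreal (\<lambda>f. f v)"
  unfolding continuous_map_def
proof (intro conjI allI impI)
  fix W :: "real set" assume "openin euclideanreal W"
  then have "open ((\<lambda>f. f v) -` W :: ('a \<Rightarrow> real) set)"
    by (auto intro!: open_vimage continuous_on_product_coordinates)
  then have "openin (top_of_set (closed_simplex \<sigma>)) (closed_simplex \<sigma> \<inter> (\<lambda>f. f v) -` W)" for \<sigma>
    by (rule openin_open_Int)
  moreover have "{f \<in> topspace (realization K). f v \<in> W} \<inter> closed_simplex \<sigma>
      = closed_simplex \<sigma> \<inter> (\<lambda>f. f v) -` W" if "\<sigma> \<in> K" for \<sigma>
    using that by (auto simp: topspace_realization)
  ultimately show "openin (realization K) {f \<in> topspace (realization K). f v \<in> W}"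
    unfolding openin_realization by (auto simp: topspace_realization)
qed auto

definition open_star :: "'v set set \<Rightarrow> 'v \<Rightarrow> ('v \<Rightarrow> real) set" where
  "open_star K v = {f \<in> topspace (realization K). f v > 0}"

lemma openin_open_star: "openin (realization K) (open_star K v)"
proof -
  have "openin (realization K) {f \<in> topspace (realization K). f v \<in> {0<..}}"
    by (rule openin_continuous_map_preimage[OF continuous_map_realization_coordinate]) simp
  then show ?thesis by (simp add: open_star_def)
qed

text \<open>The vertices in question lie in the support of \<open>f\<close>, which is a simplex.
  Through this fact topological nearness becomes combinatorial adjacency.\<close>

lemma open_star_common_simplex:
  assumes "abs_complex K" "f \<in> topspace (realization K)" "A \<noteq> {}" "\<And>v. v \<in> A \<Longrightarrow> f \<in> open_star K v"
  shows "A \<in> K"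
proof -
  have "A \<subseteq> supp f" using assms(4) by (force simp: open_star_def supp_def)
  then show ?thesis using abs_complexD(3)[OF assms(1) supp_in_complex(1)[OF assms(1,2)]] assms(3) by blast
qed

lemma in_some_open_star:
  assumes "abs_complex K" "f \<in> topspace (realization K)"
  shows "\<exists>v\<in>vertices K. f \<in> open_star K v"
proof -
  have s: "supp f \<in> K" "f \<in> closed_simplex (supp f)" using supp_in_complex[OF assms] by auto
  then obtain v where v: "v \<in> supp f" using abs_complexD(2)[OF assms(1)] by blast
  moreover have "{v} \<in> K" using abs_complexD(3)[OF assms(1) s(1), of "{v}"] v by blast
  moreover have "f v \<ge> 0" using s(2) by (simp add: closed_simplex_def)
  ultimately show ?thesis using assms(2)
    by (auto simp: open_star_def vertices_def supp_def less_le)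
qed

text \<open>Continuity of the coordinates only gives continuity for the product topology, which may
  be coarser than the weak one. As \<open>F\<close> is finite, the preimage of a closed set is a
  finite union of closed sets.\<close>

lemma continuous_map_into_realization:
  assumes K: "abs_complex K" and F: "finite F" "F \<subseteq> K"
    and coord: "\<And>v. continuous_map T euclideanreal (\<lambda>t. f t v)"
    and into: "\<And>t. t \<in> topspace T \<Longrightarrow> \<exists>\<sigma>\<in>F. f t \<in> closed_simplex \<sigma>"
  shows "continuous_map T (realization K) f"
  unfolding continuous_map_closedin
proof (intro conjI allI impI)
  show "f \<in> topspace T \<rightarrow> topspace (realization K)"
    using into F by (fastforce simp: topspace_realization)
next
  fix C assume C: "closedin (realization K) C"
  have "continuous_map T (product_topology (\<lambda>_. euclideanreal) UNIV) f"
    by (simp add: continuous_map_componentwise_UNIV coord)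
  then have cf: "continuous_map T euclidean f"
    by (simp add: euclidean_product_topology)
  have "closedin T {t \<in> topspace T. f t \<in> C \<inter> closed_simplex \<sigma>}" if "\<sigma> \<in> F" for \<sigma>
  proof (rule closedin_continuous_map_preimage[OF cf])
    show "closedin euclidean (C \<inter> closed_simplex \<sigma>)"
      using C that F closedin_realization_iff[OF K] by auto
  qed
  then have "closedin T (\<Union>\<sigma>\<in>F. {t \<in> topspace T. f t \<in> C \<inter> closed_simplex \<sigma>})"
    using F(1) by (intro closedin_Union) auto
  moreover have "(\<Union>\<sigma>\<in>F. {t \<in> topspace T. f t \<in> C \<inter> closed_simplex \<sigma>}) = {t \<in> topspace T. f t \<in> C}"
    using into by auto
  ultimately show "closedin T {t \<in> topspace T. f t \<in> C}" by simp
qed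

text \<open>Points with pairwise distinct supports form a closed discrete set, since each closed simplex
  contains only finitely many of them.\<close>

lemma finite_supports_compactin:
  assumes K: "abs_complex K" and C: "compactin (realization K) C"
  shows "finite (supp ` C)"
proof (rule ccontr)
  assume inf: "infinite (supp ` C)"
  \<comment> \<open>One point of \<open>C\<close> for each support that occurs.\<close>
  define D where "D = (inv_into C supp) ` (supp ` C)"
  have DC: "D \<subseteq> C" by (auto simp: D_def intro: inv_into_into)
  have injD: "inj_on supp D" unfolding D_def by (auto simp: inj_on_def f_inv_into_f)
  have "inj_on (inv_into C supp) (supp ` C)" by (rule inj_on_inv_into) simp
  then have infD: "infinite D" unfolding D_def using inf finite_imageD by blast
  have CT: "C \<subseteq> topspace (realization K)" using C by (rule compactin_subset_topspace)
  have closed_sub: "closedin (realization K) E" if "E \<subseteq> D" for E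
    unfolding closedin_realization_iff[OF K]
  proof (intro conjI ballI)
    show "E \<subseteq> topspace (realization K)" using that DC CT by blast
    fix \<sigma> assume "\<sigma> \<in> K"
    then have fin: "finite \<sigma>" using abs_complexD(1)[OF K] by simp
    have "supp ` (E \<inter> closed_simplex \<sigma>) \<subseteq> Pow \<sigma>" using supp_closed_simplex(1) by blast
    then have "finite (supp ` (E \<inter> closed_simplex \<sigma>))" using fin finite_subset by auto
    moreover have "inj_on supp (E \<inter> closed_simplex \<sigma>)" using injD that by (meson inj_on_subset inf_le1 order_trans)
    ultimately have "finite (E \<inter> closed_simplex \<sigma>)" using finite_imageD by blast
    then have "closed (\<Union>f\<in>E \<inter> closed_simplex \<sigma>. {f})" by (intro closed_UN ballI closed_singleton_fun)
    then show "closed (E \<inter> closed_simplex \<sigma>)" by simp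
  qed
  obtain x where x: "x \<in> realization K derived_set_of D"
    using compactin_imp_Bolzano_Weierstrass[OF C, of D] infD DC by blast
  \<comment> \<open>\<open>D - {x}\<close> is closed, so its complement is a neighbourhood of
    \<open>x\<close> that misses every other point of \<open>D\<close>, against accumulation at
    \<open>x\<close>.\<close>
  have "openin (realization K) (topspace (realization K) - (D - {x}))"
    using closed_sub[of "D - {x}"] by (auto simp: closedin_def)
  moreover have "x \<in> topspace (realization K)" using x by (simp add: in_derived_set_of)
  ultimately have "\<exists>y. y \<noteq> x \<and> y \<in> D \<and> y \<in> topspace (realization K) - (D - {x})"
    using x unfolding in_derived_set_of by (metis (no_types, lifting) Diff_iff insertI1)
  then show False by auto
qed

subsection \<open>Simple connectivity of dismantlable complexes\<close>

lemma continuous_map_unit_square: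
  assumes H: "continuous_map (prod_topology (top_of_set {0..1}) (top_of_set {0..1})) T H"
    and "continuous_on ({0..1} \<times> {0..1}) \<alpha>" "continuous_on ({0..1} \<times> {0..1}) \<beta>"
    and "\<And>p. p \<in> {0..1} \<times> {0..1} \<Longrightarrow> \<alpha> p \<in> {0..1::real}" "\<And>p. p \<in> {0..1} \<times> {0..1} \<Longrightarrow> \<beta> p \<in> {0..1::real}"
  shows "continuous_map (prod_topology (top_of_set {0..1::real}) (top_of_set {0..1::real})) T (\<lambda>p. H (\<alpha> p, \<beta> p))"
proof -
  have "continuous_map (top_of_set ({0..1} \<times> {0..1})) (top_of_set ({0..1} \<times> {0..1})) (\<lambda>p. (\<alpha> p, \<beta> p))"
    using assms by (auto intro!: continuous_on_Pair)
  then have "continuous_map (top_of_set ({0..1} \<times> {0..1})) T (H \<circ> (\<lambda>p. (\<alpha> p, \<beta> p)))"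
    using H by (intro continuous_map_compose) auto
  then show ?thesis by (simp add: o_def)
qed

text \<open>The base point travels along \<open>\<lambda>s. H (s, 0)\<close> during the free homotopy \<open>H\<close>; conjugating by this
  path gives \<open>H (\<tau> t, 0)\<close>, which runs along it and back.\<close>

lemma free_null_homotopic_imp_based:
  assumes "homotopic_with (\<lambda>h. h 0 = h 1) (top_of_set {0..1::real}) T g (\<lambda>_. c)"
  shows "homotopic_with (\<lambda>h. h 0 = g 0 \<and> h 1 = g 0) (top_of_set {0..1}) T g (\<lambda>_. g 0)"
proof -
  let ?I = "top_of_set {0..1::real}"
  let ?P = "\<lambda>h. h 0 = g 0 \<and> h 1 = g 0"
  obtain H where H: "continuous_map (prod_topology ?I ?I) T H"
    and H0: "\<And>t. H (0, t) = g t" and H1: "\<And>t. H (1, t) = c"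
    and Hs: "\<And>s. s \<in> {0..1} \<Longrightarrow> H (s, 0) = H (s, 1)"
    using assms unfolding homotopic_with_def by auto
  have g01: "g 0 = g 1" using Hs[of 0] by (simp add: H0)
  \<comment> \<open>In the outer thirds \<open>\<beta>\<close> is constantly 0 and 1, while
    \<open>\<alpha> 1\<close> climbs to 1 and later descends. In the middle third
    \<open>\<alpha> 1\<close> rests at 1 and \<open>\<beta>\<close> moves from 0 to 1.\<close>
  define \<beta> where "\<beta> t = max 0 (min 1 (3 * t - 1))" for t :: real
  define \<alpha> where "\<alpha> s t = max 0 (min s (min (3 * t) (3 - 3 * t)))" for s t :: real
  have b: "\<beta> t \<in> {0..1}" for t by (auto simp: \<beta>_def)
  have a: "\<alpha> s t \<in> {0..1}" if "s \<in> {0..1}" for s t using that by (auto simp: \<alpha>_def)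
  have "homotopic_with ?P ?I T g (\<lambda>t. H (0, \<beta> t))"
    unfolding homotopic_with_def
  proof (intro exI conjI allI ballI)
    show "continuous_map (prod_topology ?I ?I) T (\<lambda>p. H (0, (1 - fst p) * snd p + fst p * \<beta> (snd p)))"
    proof (rule continuous_map_unit_square[OF H])
      fix p :: "real \<times> real" assume p: "p \<in> {0..1} \<times> {0..1}"
      then show "(1 - fst p) * snd p + fst p * \<beta> (snd p) \<in> {0..1}"
        using b[of "snd p"] convex_bound_le[of "snd p" 1 "\<beta> (snd p)" "1 - fst p" "fst p"] by auto
    qed (auto simp: \<beta>_def intro!: continuous_intros)
  qed (auto simp: H0 g01 \<beta>_def)
  moreover have "homotopic_with ?P ?I T (\<lambda>t. H (0, \<beta> t)) (\<lambda>t. H (\<alpha> 1 t, \<beta> t))"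
    unfolding homotopic_with_def
  proof (intro exI conjI allI ballI)
    show "continuous_map (prod_topology ?I ?I) T (\<lambda>p. H (\<alpha> (fst p) (snd p), \<beta> (snd p)))"
    proof (rule continuous_map_unit_square[OF H])
      show "continuous_on ({0..1} \<times> {0..1}) (\<lambda>p. \<alpha> (fst p) (snd p))"
        unfolding \<alpha>_def by (intro continuous_intros)
      show "continuous_on ({0..1} \<times> {0..1}) (\<lambda>p. \<beta> (snd p))"
        unfolding \<beta>_def by (intro continuous_intros)
    qed (use a b in auto)
  qed (auto simp: H0 g01 \<beta>_def \<alpha>_def)
  \<comment> \<open>In the outer thirds \<open>\<beta> t\<close> is an end point, and
    \<open>H\<close> agrees on both ends; in the middle third the homotopy has reached the constant
    \<open>c\<close>.\<close>
  moreover have "H (\<alpha> 1 t, \<beta> t) = H (\<alpha> 1 t, 0)" for t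
  proof -
    consider "\<beta> t = 0" | "\<beta> t = 1" | "1/3 < t" "t < 2/3" unfolding \<beta>_def by linarith
    then show ?thesis
    proof cases
      case 2 then show ?thesis using Hs a[of 1 t] by simp
    next
      case 3
      then have "\<alpha> 1 t = 1" by (simp add: \<alpha>_def)
      then show ?thesis by (simp add: H1)
    qed simp
  qed
  moreover have "homotopic_with ?P ?I T (\<lambda>t. H (\<alpha> 1 t, 0)) (\<lambda>t. g 0)"
    unfolding homotopic_with_def
  proof (intro exI conjI allI ballI)
    show "continuous_map (prod_topology ?I ?I) T (\<lambda>p. H ((1 - fst p) * \<alpha> 1 (snd p), 0))"
    proof (rule continuous_map_unit_square[OF H])
      show "continuous_on ({0..1} \<times> {0..1}) (\<lambda>p. (1 - fst p) * \<alpha> 1 (snd p))"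
        unfolding \<alpha>_def by (intro continuous_intros)
      fix p :: "real \<times> real" assume p: "p \<in> {0..1} \<times> {0..1}"
      then show "(1 - fst p) * \<alpha> 1 (snd p) \<in> {0..1}"
        using a[of 1 "snd p"] by (auto intro!: mult_le_one)
    qed auto
  qed (auto simp: H0 g01 \<alpha>_def)
  ultimately have "homotopic_with ?P ?I T g (\<lambda>t. H (\<alpha> 1 t, 0))"
    "homotopic_with ?P ?I T (\<lambda>t. H (\<alpha> 1 t, 0)) (\<lambda>t. g 0)"
    using homotopic_with_trans[of ?P ?I T g] by simp_all
  then show ?thesis by (rule homotopic_with_trans)
qed

section \<open>Piecewise linear paths and simplicial approximation of loops\<close>

definition tent :: "real \<Rightarrow> real" where
  "tent s = max 0 (1 - \<bar>s\<bar>)"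

text \<open>The polygon through \<open>v 0\<close>, ..., \<open>v N\<close> at the times
  \<open>i / N\<close>, as a sum of hat functions: each coordinate is visibly continuous, and
  coinciding vertices simply add their weights.\<close>

definition pl_path :: "nat \<Rightarrow> (nat \<Rightarrow> 'v) \<Rightarrow> real \<Rightarrow> 'v \<Rightarrow> real" where
  "pl_path N v t w = (\<Sum>i\<le>N. tent (N * t - i) * of_bool (v i = w))"

lemma unit_interval_segment:
  fixes t :: real and N :: nat
  assumes "t \<in> {0..1}" "N > 0"
  obtains k where "k < N" "real k \<le> N * t" "N * t \<le> real (Suc k)"
proof (cases "t = 1")
  case True
  \<comment> \<open>The floor of \<open>N * t\<close> is \<open>N\<close> here, one beyond the last
    segment.\<close>
  then show ?thesis using that[of "N - 1"] assms by (simp add: of_nat_diff)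
next
  case False
  let ?k = "nat \<lfloor>N * t\<rfloor>"
  have "N * t < N" using False assms by simp
  moreover have "0 \<le> N * t" using assms by simp
  ultimately show ?thesis using that[of ?k] by linarith
qed

lemma tent_nonneg: "tent s \<ge> 0"
  by (simp add: tent_def)

lemma tent_pos_segment:
  assumes "real k \<le> s" "s \<le> real (Suc k)" "tent (s - real i) > 0"
  shows "i = k \<or> i = Suc k"
proof -
  have "\<bar>s - real i\<bar> < 1" using assms(3) by (auto simp: tent_def)
  then have "real i < real (k + 2)" "real k < real (i + 1)" using assms by linarith+
  then show ?thesis by (metis Suc_eq_plus1 add_2_eq_Suc' less_Suc_eq of_nat_less_iff not_less_eq)
qed

lemma sum_tent:
  fixes t :: real and N :: nat
  assumes "t \<in> {0..1}" "N > 0"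
  shows "(\<Sum>i\<le>N. tent (N * t - i)) = 1"
proof -
  obtain k where k: "k < N" "real k \<le> N * t" "N * t \<le> real (Suc k)"
    using unit_interval_segment[OF assms] .
  have "tent (N * t - i) = 0" if "i \<noteq> k" "i \<noteq> Suc k" for i
    using tent_pos_segment[OF k(2,3), of i] that tent_nonneg[of "N * t - i"] by fastforce
  then have "(\<Sum>i\<le>N. tent (N * t - i)) = (\<Sum>i\<in>{k, Suc k}. tent (N * t - i))"
    using k(1) by (intro sum.mono_neutral_right) auto
  also have "\<dots> = 1" using k by (simp add: tent_def)
  finally show ?thesis .
qed

text \<open>Any simplex containing the vertices of positive weight will do. In the approximation of
  a path \<open>g\<close> it is the support of \<open>g t\<close> instead of an edge of the
  polygon.\<close>

lemma pl_path_in_simplex: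
  assumes t: "t \<in> {0..1}" "N > 0" and fin: "finite \<sigma>"
    and \<sigma>: "\<And>i. i \<le> N \<Longrightarrow> tent (N * t - i) > 0 \<Longrightarrow> v i \<in> \<sigma>"
  shows "pl_path N v t \<in> closed_simplex \<sigma>"
proof -
  have tz: "tent s \<noteq> 0 \<longleftrightarrow> tent s > 0" for s using tent_nonneg[of s] by auto
  have "(\<Sum>w\<in>\<sigma>. pl_path N v t w) = (\<Sum>i\<le>N. \<Sum>w\<in>\<sigma>. tent (N * t - i) * of_bool (v i = w))"
    unfolding pl_path_def by (rule sum.swap)
  also have "\<dots> = (\<Sum>i\<le>N. tent (N * t - i))"
  proof (rule sum.cong)
    fix i assume "i \<in> {..N}"
    show "(\<Sum>w\<in>\<sigma>. tent (N * t - i) * of_bool (v i = w)) = tent (N * t - i)"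
    proof (cases "tent (N * t - i) = 0")
      case False
      then have "v i \<in> \<sigma>" using \<sigma>[of i] tz \<open>i \<in> {..N}\<close> by auto
      have "(\<Sum>w\<in>\<sigma>. tent (N * t - i) * of_bool (v i = w)) = (\<Sum>w\<in>\<sigma>. if v i = w then tent (N * t - i) else 0)"
        by (rule sum.cong) auto
      also have "\<dots> = tent (N * t - i)" using \<open>v i \<in> \<sigma>\<close> fin by simp
      finally show ?thesis .
    qed simp
  qed simp
  also have "\<dots> = 1" using sum_tent[OF t] .
  finally have "(\<Sum>w\<in>\<sigma>. pl_path N v t w) = 1" .
  moreover have "pl_path N v t w \<ge> 0" for w
    unfolding pl_path_def by (intro sum_nonneg) (auto simp: tent_def)
  moreover have "pl_path N v t w = 0" if "w \<notin> \<sigma>" for w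
    unfolding pl_path_def using \<sigma> that tz by (intro sum.neutral) fastforce
  ultimately show ?thesis by (simp add: closed_simplex_def)
qed

lemma pl_path_in_segment:
  fixes t :: real
  assumes "t \<in> {0..1}" "N > 0" "real k \<le> N * t" "N * t \<le> real (Suc k)"
    and "finite \<sigma>" "v k \<in> \<sigma>" "v (Suc k) \<in> \<sigma>"
  shows "pl_path N v t \<in> closed_simplex \<sigma>"
  using assms tent_pos_segment[OF assms(3,4)] by (intro pl_path_in_simplex) auto

lemma tent_of_nat: "tent (real j - real i) = of_bool (i = j)"
proof (cases "i = j")
  case False
  then have "\<bar>real j - real i\<bar> \<ge> 1" by linarith
  then show ?thesis using False by (simp add: tent_def)
qed (simp add: tent_def)

lemma pl_path_vertex:
  assumes "j \<le> N" "N > 0"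
  shows "pl_path N v (real j / real N) = (\<lambda>w. of_bool (v j = w))"
proof
  fix w
  have "pl_path N v (real j / real N) w = (\<Sum>i\<le>N. if i = j then of_bool (v j = w) else 0)"
    unfolding pl_path_def using assms(2) by (intro sum.cong) (auto simp: tent_of_nat)
  also have "\<dots> = of_bool (v j = w)" using assms(1) by simp
  finally show "pl_path N v (real j / real N) w = of_bool (v j = w)" .
qed

lemma pl_path_ends:
  assumes "N > 0"
  shows "pl_path N v 0 = (\<lambda>w. of_bool (v 0 = w))" "pl_path N v 1 = (\<lambda>w. of_bool (v N = w))"
  using pl_path_vertex[of 0 N v] pl_path_vertex[of N N v] assms by simp_all

lemma continuous_pl_path:
  assumes K: "abs_complex K" and N: "N > 0" and v: "\<And>k. k < N \<Longrightarrow> {v k, v (Suc k)} \<in> K"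
  shows "continuous_map (top_of_set {0..1}) (realization K) (pl_path N v)"
proof (rule continuous_map_into_realization[OF K])
  show "finite ((\<lambda>k. {v k, v (Suc k)}) ` {..<N})" by simp
  show "(\<lambda>k. {v k, v (Suc k)}) ` {..<N} \<subseteq> K" using v by auto
  show "continuous_map (top_of_set {0..1}) euclideanreal (\<lambda>t. pl_path N v t w)" for w
    unfolding pl_path_def tent_def continuous_map_iff_continuous by (intro continuous_intros)
  fix t :: real assume "t \<in> topspace (top_of_set {0..1})"
  then have t: "t \<in> {0..1}" by simp
  then obtain k where k: "k < N" "real k \<le> N * t" "N * t \<le> real (Suc k)"
    using unit_interval_segment[OF t N] by blast
  then show "\<exists>\<sigma>\<in>(\<lambda>k. {v k, v (Suc k)}) ` {..<N}. pl_path N v t \<in> closed_simplex \<sigma>"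
    using pl_path_in_segment[OF t N k(2,3), of "{v k, v (Suc k)}" v] by auto
qed

lemma closed_simplex_convex:
  assumes "f \<in> closed_simplex \<sigma>" "g \<in> closed_simplex \<sigma>" "s \<in> {0..1}"
  shows "(\<lambda>w. (1 - s) * f w + s * g w) \<in> closed_simplex \<sigma>"
proof -
  have "(\<Sum>w\<in>\<sigma>. (1 - s) * f w + s * g w) = (1 - s) * (\<Sum>w\<in>\<sigma>. f w) + s * (\<Sum>w\<in>\<sigma>. g w)"
    by (simp add: sum.distrib sum_distrib_left)
  then show ?thesis using assms by (simp add: closed_simplex_def)
qed

text \<open>At each time both loops lie in a common simplex, which is convex; finiteness of
  \<open>F\<close> yields continuity in the weak topology. The condition \<open>h 0 = h 1\<close>
  makes this a homotopy of free loops.\<close>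

lemma homotopic_straight_line:
  assumes K: "abs_complex K" and F: "finite F" "F \<subseteq> K"
    and f: "continuous_map (top_of_set {0..1::real}) (realization K) f" "f 0 = f 1"
    and g: "continuous_map (top_of_set {0..1::real}) (realization K) g" "g 0 = g 1"
    and near: "\<And>t. t \<in> {0..1} \<Longrightarrow> \<exists>\<sigma>\<in>F. f t \<in> closed_simplex \<sigma> \<and> g t \<in> closed_simplex \<sigma>"
  shows "homotopic_with (\<lambda>h. h 0 = h 1) (top_of_set {0..1}) (realization K) f g"
  unfolding homotopic_with_def
proof (intro exI conjI allI ballI)
  let ?h = "\<lambda>p w. (1 - fst p) * f (snd p) w + fst p * g (snd p) w"
  let ?I = "top_of_set {0..1::real}"
  have coord: "continuous_map (prod_topology ?I ?I) euclideanreal (\<lambda>p. q (snd p) w)"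
    if "continuous_map ?I (realization K) q" for q :: "real \<Rightarrow> 'a \<Rightarrow> real" and w
    using continuous_map_compose[OF continuous_map_compose[OF continuous_map_snd that]
        continuous_map_realization_coordinate, of ?I w] by (simp add: o_def)
  have fst: "continuous_map (prod_topology ?I ?I) euclideanreal fst"
    by (rule continuous_map_into_fulltopology[OF continuous_map_fst])
  show "continuous_map (prod_topology ?I ?I) (realization K) ?h"
  proof (rule continuous_map_into_realization[OF K F])
    show "continuous_map (prod_topology ?I ?I) euclideanreal (\<lambda>p. ?h p w)" for w
      by (intro continuous_intros coord f g fst)
    fix p assume "p \<in> topspace (prod_topology ?I ?I)"
    then have "fst p \<in> {0..1}" "snd p \<in> {0..1}" by auto
    then show "\<exists>\<sigma>\<in>F. ?h p \<in> closed_simplex \<sigma>"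
      using near closed_simplex_convex by blast
  qed
qed (use f(2) g(2) in auto)

text \<open>By the Lebesgue number of the cover by stars, the loop stays in the open star of
  \<open>v i\<close> near the time \<open>i / N\<close>. All vertices of positive weight at time
  \<open>t\<close> then lie in the support of \<open>g t\<close>, so a straight line homotopy joins
  the loop to the polygon. Compactness makes the family of supports finite.\<close>

lemma pl_path_approximation:
  assumes K: "abs_complex K" and g: "pathin (realization K) g" "g 0 = g 1"
  obtains N v where "N > 0" "v 0 = v N" "\<And>k. k < N \<Longrightarrow> {v k, v (Suc k)} \<in> K"
    "homotopic_with (\<lambda>h. h 0 = h 1) (top_of_set {0..1}) (realization K) g (pl_path N v)"
proof -
  let ?I = "top_of_set {0..1::real}"
  have gc: "continuous_map ?I (realization K) g" using g by (simp add: pathin_def)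
  have gt: "g t \<in> topspace (realization K)" if "t \<in> {0..1}" for t
    using continuous_map_image_subset_topspace[OF gc] that by auto
  have op: "\<exists>U. open U \<and> (\<forall>t\<in>{0..1}. t \<in> U \<longleftrightarrow> g t \<in> open_star K v)" for v
  proof -
    have "openin ?I {t \<in> topspace ?I. g t \<in> open_star K v}"
      by (rule openin_continuous_map_preimage[OF gc openin_open_star])
    then obtain U where U: "open U" "{t \<in> topspace ?I. g t \<in> open_star K v} = {0..1} \<inter> U"
      unfolding openin_open by blast
    have "t \<in> U \<longleftrightarrow> g t \<in> open_star K v" if "t \<in> {0..1}" for t
      using arg_cong[OF U(2), of "\<lambda>A. t \<in> A"] that by simp
    with U(1) show ?thesis by blast
  qed
  then obtain U where U: "\<And>v. open (U v)" "\<And>v t. t \<in> {0..1} \<Longrightarrow> t \<in> U v \<longleftrightarrow> g t \<in> open_star K v"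
    by metis
  \<comment> \<open>The same vertex \<open>w\<close> serves at both ends, so that the polygon closes
    up.\<close>
  obtain w where w: "w \<in> vertices K" "g 0 \<in> open_star K w"
    using in_some_open_star[OF K gt[of 0]] by auto
  have "0 \<in> U w" "1 \<in> U w" using U(2)[of 0 w] U(2)[of 1 w] w(2) g(2) by simp_all
  then obtain e1 e2 where e12: "e1 > 0" "ball 0 e1 \<subseteq> U w" "e2 > 0" "ball 1 e2 \<subseteq> U w"
    using U(1)[of w] by (meson open_contains_ball)
  have "{0..1} \<subseteq> \<Union>(range U)" using in_some_open_star[OF K gt] U(2) by fastforce
  then obtain e3 where e3: "e3 > 0" "\<And>x. x \<in> {0..1} \<Longrightarrow> \<exists>G\<in>range U. ball x e3 \<subseteq> G"
    using U(1) by (auto intro: Heine_Borel_lemma[OF compact_Icc, of 0 1 "range U"])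
  then have "\<forall>x. \<exists>v. x \<in> {0..1} \<longrightarrow> ball x e3 \<subseteq> U v" by blast
  then obtain c where c: "\<And>x. x \<in> {0..1} \<Longrightarrow> ball x e3 \<subseteq> U (c x)" by metis
  define e where "e = min e1 (min e2 e3)"
  have "e > 0" using e12 e3 by (simp add: e_def)
  then obtain N where N: "N > 0" "1 / real N < e" by (metis nat_approx_posE zero_less_Suc)
  define v where "v i = (if i = 0 \<or> i = N then w else c (real i / real N))" for i
  have vU: "ball (real i / real N) e \<subseteq> U (v i)" if "i \<le> N" for i
  proof (cases "i = 0 \<or> i = N")
    case True
    then show ?thesis using e12 N(1) by (fastforce simp: v_def e_def)
  next
    case False
    have "ball (real i / real N) e3 \<subseteq> U (c (real i / real N))" using that N by (intro c) simp
    moreover have "ball (real i / real N) e \<subseteq> ball (real i / real N) e3" by (intro subset_ball) (simp add: e_def)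
    ultimately show ?thesis using False by (simp add: v_def)
  qed
  have star: "g t \<in> open_star K (v i)" if "i \<le> N" "t \<in> {0..1}" "tent (N * t - i) > 0" for i and t :: real
  proof -
    have "\<bar>N * t - i\<bar> < 1" using that(3) by (auto simp: tent_def)
    then have "\<bar>t - real i / real N\<bar> < 1 / real N" using N(1)
      by (simp add: abs_less_iff field_simps)
    then have "t \<in> ball (real i / real N) e" using N(2) by (simp add: dist_real_def abs_minus_commute)
    then show ?thesis using vU[OF that(1)] U(2)[OF that(2)] by blast
  qed
  have edge: "{v k, v (Suc k)} \<in> K" if "k < N" for k
  proof -
    \<comment> \<open>At the midpoint of the segment both end vertices have positive weight.\<close>
    let ?t = "(real k + 1/2) / real N"
    have t: "?t \<in> {0..1}" using that N(1) by (simp add: field_simps)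
    have "real N * ?t = real k + 1/2" using N(1) by simp
    then have "tent (N * ?t - k) > 0" "tent (N * ?t - Suc k) > 0" by (simp_all add: tent_def)
    then show ?thesis using star[OF _ t] that
      by (intro open_star_common_simplex[OF K gt[OF t]]) auto
  qed
  have v0N: "v 0 = v N" by (simp add: v_def)
  have F: "finite (supp ` g ` {0..1})"
    by (intro finite_supports_compactin[OF K] image_compactin[OF _ gc]) (simp add: compactin_subtopology)
  have "homotopic_with (\<lambda>h. h 0 = h 1) ?I (realization K) g (pl_path N v)"
  proof (rule homotopic_straight_line[OF K F])
    show "supp ` g ` {0..1} \<subseteq> K" using supp_in_complex(1)[OF K] gt by blast
    show "continuous_map ?I (realization K) (pl_path N v)" using edge by (intro continuous_pl_path[OF K N(1)])
    show "pl_path N v 0 = pl_path N v 1" using v0N by (simp add: pl_path_ends[OF N(1)])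
    fix t :: real assume t: "t \<in> {0..1}"
    have "pl_path N v t \<in> closed_simplex (supp (g t))"
    proof (rule pl_path_in_simplex[OF t N(1)])
      show "finite (supp (g t))" using abs_complexD(1)[OF K supp_in_complex(1)[OF K gt[OF t]]] .
      show "v i \<in> supp (g t)" if "i \<le> N" "tent (N * t - i) > 0" for i
        using star[OF that(1) t that(2)] by (auto simp: open_star_def supp_def)
    qed
    then show "\<exists>\<sigma>\<in>supp ` g ` {0..1}. g t \<in> closed_simplex \<sigma> \<and> pl_path N v t \<in> closed_simplex \<sigma>"
      using supp_in_complex(2)[OF K gt[OF t]] t by blast
  qed (use gc g in auto)
  then show ?thesis using that N(1) v0N edge by blast
qed

text \<open>The contiguity argument: on each segment the four vertices span one simplex, which
  contains both paths.\<close>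

lemma homotopic_contiguous_pl_paths:
  assumes K: "abs_complex K" and N: "N > 0" and ends: "v 0 = v N" "v' 0 = v' N"
    and cont: "\<And>k. k < N \<Longrightarrow> {v k, v (Suc k), v' k, v' (Suc k)} \<in> K"
  shows "homotopic_with (\<lambda>h. h 0 = h 1) (top_of_set {0..1}) (realization K) (pl_path N v) (pl_path N v')"
proof (rule homotopic_straight_line[OF K])
  let ?F = "(\<lambda>k. {v k, v (Suc k), v' k, v' (Suc k)}) ` {..<N}"
  show "finite ?F" "?F \<subseteq> K" using cont by auto
  have "{v k, v (Suc k)} \<in> K" "{v' k, v' (Suc k)} \<in> K" if "k < N" for k
    using cont[OF that] abs_complexD(3)[OF K cont[OF that]] by auto
  then show "continuous_map (top_of_set {0..1}) (realization K) (pl_path N v)"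
    "continuous_map (top_of_set {0..1}) (realization K) (pl_path N v')"
    by (auto intro!: continuous_pl_path[OF K N])
  show "pl_path N v 0 = pl_path N v 1" "pl_path N v' 0 = pl_path N v' 1"
    using ends by (simp_all add: pl_path_ends[OF N])
  fix t :: real assume t: "t \<in> {0..1}"
  then obtain k where k: "k < N" "real k \<le> N * t" "N * t \<le> real (Suc k)"
    using unit_interval_segment[OF t N] by blast
  then show "\<exists>\<sigma>\<in>?F. pl_path N v t \<in> closed_simplex \<sigma> \<and> pl_path N v' t \<in> closed_simplex \<sigma>"
    using pl_path_in_segment[OF t N k(2,3), of "{v k, v (Suc k), v' k, v' (Suc k)}"] by auto
qed

text \<open>An edge loop is contracted by pushing all visits to a vertex \<open>v\<close> of maximal rank to \<open>r v\<close>.\<close>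

theorem simply_connected_space_dismantlable:
  assumes K: "abs_complex K" and y: "y \<in> vertices K" "R y = (0::nat)"
    and r: "\<And>v. v \<in> vertices K \<Longrightarrow> v \<noteq> y \<Longrightarrow> {v, r v} \<in> K \<and> R (r v) < R v"
    and dom: "\<And>v w. v \<in> vertices K \<Longrightarrow> v \<noteq> y \<Longrightarrow> adjacent K v w \<Longrightarrow> R w \<le> R v \<Longrightarrow> {v, w, r v} \<in> K"
  shows "simply_connected_space (realization K)"
proof -
  let ?I = "top_of_set {0..1::real}"
  have rV: "r v \<in> vertices K" if "v \<in> vertices K" "v \<noteq> y" for v
    using abs_complexD(3)[OF K, of "{v, r v}" "{r v}"] r[OF that] by (auto simp: vertices_def)
  have null: "homotopic_with (\<lambda>h. h 0 = h 1) ?I (realization K) (pl_path N v) (\<lambda>_ w. of_bool (y = w))"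
    if N: "N > 0" and "v 0 = v N" "\<And>k. k < N \<Longrightarrow> {v k, v (Suc k)} \<in> K" for N v
    using that(2,3)
  \<comment> \<open>Each push strictly lowers the total rank of the visited vertices.\<close>
  proof (induction "\<Sum>k\<le>N. R (v k)" arbitrary: v rule: less_induct)
    case less
    have V: "v k \<in> vertices K" if "k \<le> N" for k
    proof (cases "k < N")
      case True
      then show ?thesis using abs_complexD(3)[OF K less(3)[OF True], of "{v k}"] by (simp add: vertices_def)
    next
      case False
      then have "k = Suc (N - 1)" "N - 1 < N" using that N by auto
      then show ?thesis using abs_complexD(3)[OF K less(3)[of "N - 1"], of "{v k}"] by (simp add: vertices_def)
    qed
    show ?case
    proof (cases "\<forall>k\<le>N. v k = y")
      case True
      have "pl_path N v t = (\<lambda>w. of_bool (y = w))" if t: "t \<in> {0..1}" for t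
      proof
        fix w
        have "pl_path N v t w = (\<Sum>i\<le>N. tent (N * t - i)) * of_bool (y = w)"
          unfolding pl_path_def using True by (auto simp: sum_distrib_right intro!: sum.cong)
        then show "pl_path N v t w = of_bool (y = w)" using sum_tent[OF t N] by simp
      qed
      then show ?thesis using less.prems pl_path_ends[OF N, of v]
        by (intro homotopic_with_equal continuous_pl_path[OF K N]) auto
    next
      case False
      define m where "m = Max ((\<lambda>k. R (v k)) ` {..N})"
      have max: "R (v k) \<le> m" if "k \<le> N" for k
        unfolding m_def using that by simp
      have "m \<in> (\<lambda>k. R (v k)) ` {..N}" unfolding m_def by (intro Max_in) auto
      then obtain i where i: "i \<le> N" "R (v i) = m" by auto
      define u where "u = v i"
      obtain j where "j \<le> N" "v j \<noteq> y" using False by blast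
      \<comment> \<open>Vertices other than \<open>y\<close> have positive rank because
        \<open>r\<close> lowers it, so the vertex of top rank is not \<open>y\<close>.\<close>
      then have "m > 0" using r[OF V[of j]] max[of j] by auto
      then have u: "u \<in> vertices K" "u \<noteq> y" using V i y by (auto simp: u_def)
      define v' where "v' k = (if v k = u then r u else v k)" for k
      \<comment> \<open>Where \<open>u\<close> occurs, the four vertices are \<open>u\<close>,
        \<open>r u\<close> and at most one neighbour of rank at most \<open>m\<close>, so that
        \<open>r\<close> or \<open>dom\<close> applies.\<close>
      have cont: "{v k, v (Suc k), v' k, v' (Suc k)} \<in> K" if k: "k < N" for k
      proof -
        have dom': "{u, w, r u} \<in> K" if "{u, w} \<in> K" "R w \<le> m" for w
          using dom[OF u, of w] r[OF u] that i by (cases "w = u") (auto simp: adjacent_def u_def)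
        consider "v k = u" | "v k \<noteq> u" "v (Suc k) = u" | "v k \<noteq> u" "v (Suc k) \<noteq> u" by blast
        then show ?thesis
        proof cases
          case 1
          show ?thesis
          proof (cases "v (Suc k) = u")
            case True then show ?thesis using 1 r[OF u] by (simp add: v'_def insert_commute)
          next
            case False then show ?thesis using 1 dom'[of "v (Suc k)"] less.prems(2)[OF k] max[of "Suc k"] k
              by (simp add: v'_def insert_commute)
          qed
        next
          case 2
          then show ?thesis using dom'[of "v k"] less.prems(2)[OF k] max[of k] k
            by (simp add: v'_def insert_commute)
        next
          case 3
          then show ?thesis using less.prems(2)[OF k] by (simp add: v'_def insert_commute)
        qed
      qed
      have ends': "v' 0 = v' N" using less.prems(1) by (simp add: v'_def)
      have "homotopic_with (\<lambda>h. h 0 = h 1) ?I (realization K) (pl_path N v) (pl_path N v')"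
        by (rule homotopic_contiguous_pl_paths[OF K N less.prems(1) ends' cont])
      moreover have "homotopic_with (\<lambda>h. h 0 = h 1) ?I (realization K) (pl_path N v') (\<lambda>_ w. of_bool (y = w))"
      proof (rule less.hyps)
        show "(\<Sum>k\<le>N. R (v' k)) < (\<Sum>k\<le>N. R (v k))"
          using r[OF u] i(1) by (intro sum_strict_mono_ex1) (auto simp: v'_def u_def intro: less_imp_le)
        show "{v' k, v' (Suc k)} \<in> K" if "k < N" for k
          using abs_complexD(3)[OF K cont[OF that]] by auto
      qed (rule ends')
      ultimately show ?thesis by (rule homotopic_with_trans)
    qed
  qed
  have join: "path_component_of (realization K) f g"
    if "\<sigma> \<in> K" "f \<in> closed_simplex \<sigma>" "g \<in> closed_simplex \<sigma>" for f g \<sigma>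
    unfolding path_component_of_def pathin_def
  proof (intro exI conjI)
    show "continuous_map ?I (realization K) (\<lambda>s w. (1 - s) * f w + s * g w)"
    proof (rule continuous_map_into_realization[OF K, of "{\<sigma>}"])
      show "continuous_map ?I euclideanreal (\<lambda>s. (1 - s) * f w + s * g w)" for w
        unfolding continuous_map_iff_continuous by (intro continuous_intros)
    qed (use that closed_simplex_convex in auto)
  qed auto
  have vert: "(\<lambda>w. of_bool (v = w)) \<in> closed_simplex \<sigma>" if "v \<in> \<sigma>" "finite \<sigma>" for v :: 'a and \<sigma>
  proof -
    have "(\<Sum>w\<in>\<sigma>. of_bool (v = w)) = (\<Sum>w\<in>\<sigma>. if v = w then 1 else (0::real))" by (rule sum.cong) auto
    also have "\<dots> = 1" using that by simp
    finally show ?thesis using that by (auto simp: closed_simplex_def)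
  qed
  have toy: "path_component_of (realization K) (\<lambda>w. of_bool (v = w)) (\<lambda>w. of_bool (y = w))"
    if "v \<in> vertices K" for v
    using that
  proof (induction "R v" arbitrary: v rule: less_induct)
    case less
    show ?case
    proof (cases "v = y")
      case True then show ?thesis using join[of "{y}"] y vert[of y "{y}"] by (simp add: vertices_def)
    next
      case False
      then have "path_component_of (realization K) (\<lambda>w. of_bool (v = w)) (\<lambda>w. of_bool (r v = w))"
        using r[OF less.prems False] by (intro join[of "{v, r v}"] vert) auto
      moreover have "path_component_of (realization K) (\<lambda>w. of_bool (r v = w)) (\<lambda>w. of_bool (y = w))"
        using less.hyps r[OF less.prems False] rV[OF less.prems False] by blast
      ultimately show ?thesis by (rule path_component_of_trans)
    qed
  qed
  have "path_component_of (realization K) f (\<lambda>w. of_bool (y = w))" if f: "f \<in> topspace (realization K)" for f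
  proof -
    obtain v where v: "v \<in> vertices K" "f \<in> open_star K v" using in_some_open_star[OF K f] by blast
    have s: "supp f \<in> K" "f \<in> closed_simplex (supp f)" using supp_in_complex[OF K f] by auto
    have "v \<in> supp f" using v by (auto simp: open_star_def supp_def)
    then have "path_component_of (realization K) f (\<lambda>w. of_bool (v = w))"
      using s abs_complexD(1)[OF K s(1)] by (intro join[of "supp f"] vert)
    from this toy[OF v(1)] show ?thesis by (rule path_component_of_trans)
  qed
  then have "path_connected_space (realization K)"
    unfolding path_connected_space_iff_path_component
    by (meson path_component_of_sym path_component_of_trans)
  moreover have "homotopic_with (\<lambda>h. h 0 = p 0 \<and> h 1 = p 0) ?I (realization K) p (\<lambda>_. p 0)"
    if p: "pathin (realization K) p" "p 1 = p 0" for p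
  proof -
    obtain N v where Nv: "N > 0" "v 0 = v N" "\<And>k. k < N \<Longrightarrow> {v k, v (Suc k)} \<in> K"
      "homotopic_with (\<lambda>h. h 0 = h 1) ?I (realization K) p (pl_path N v)"
      using pl_path_approximation[OF K p(1) p(2)[symmetric]] by blast
    have "homotopic_with (\<lambda>h. h 0 = h 1) ?I (realization K) p (\<lambda>_ w. of_bool (y = w))"
      using Nv(4) null[OF Nv(1-3)] by (rule homotopic_with_trans)
    then show ?thesis by (rule free_null_homotopic_imp_based)
  qed
  ultimately show ?thesis unfolding simply_connected_space_def by blast
qed

subsection \<open>Combinatorial coverings of simply connected complexes\<close>

lemma open_star_vertex:
  assumes "(\<lambda>w. of_bool (v = w)) \<in> open_star K c"
  shows "c = v"
  using assms by (auto simp: open_star_def split: if_splits)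

text \<open>A null homotopy of an edge loop is cut into small squares, each mapped into the open star of a
  vertex. Lifting these vertices row by row transports the lift of the loop to a constant one.\<close>

theorem covering_trivial_if_simply_connected:
  fixes E :: "'u \<Rightarrow> 'u \<Rightarrow> bool" and \<pi> :: "'u \<Rightarrow> 'v"
  assumes K: "abs_complex K" and sc: "simply_connected_space (realization K)"
    and E_refl: "\<And>u u'. E u u' \<Longrightarrow> E u u"
    and E_sym: "\<And>u u'. E u u' \<Longrightarrow> E u' u"
    and edge: "\<And>u u'. E u u' \<Longrightarrow> {\<pi> u, \<pi> u'} \<in> K"
    and lift: "\<And>u v. E u u \<Longrightarrow> {\<pi> u, v} \<in> K \<Longrightarrow> \<exists>u'. E u u' \<and> \<pi> u' = v"
    and uniq: "\<And>u u' u''. E u u' \<Longrightarrow> E u u'' \<Longrightarrow> \<pi> u' = \<pi> u'' \<Longrightarrow> u' = u''"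
    and tri: "\<And>u u' u''. E u u' \<Longrightarrow> E u' u'' \<Longrightarrow> {\<pi> u, \<pi> u', \<pi> u''} \<in> K \<Longrightarrow> E u u''"
    and chain: "E\<^sup>*\<^sup>* u u'" "\<pi> u = \<pi> u'"
  shows "u = u'"
proof -
  obtain n where "(E ^^ n) u u'" using chain(1) rtranclp_imp_relpowp by metis
  then obtain w where w: "w 0 = u" "w n = u'" "\<And>k. k < n \<Longrightarrow> E (w k) (w (Suc k))"
    unfolding relpowp_fun_conv by blast
  show ?thesis
  proof (cases "n = 0")
    case True then show ?thesis using w by simp
  next
    case False
    then have n: "n > 0" by simp
    define v where "v k = \<pi> (w k)" for k
    have v_ends: "v 0 = v n" using chain(2) w by (simp add: v_def)
    have vK: "{v k, v (Suc k)} \<in> K" if "k < n" for k using edge[OF w(3)[OF that]] by (simp add: v_def)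
    have Ew: "E (w k) (w k)" if "k \<le> n" for k
    proof (cases "k < n")
      case True
      show ?thesis by (rule E_refl[OF w(3)[OF True]])
    next
      case False
      then have "k = Suc (n - 1)" "n - 1 < n" using that n by simp_all
      then show ?thesis using E_refl[OF E_sym[OF w(3)[of "n - 1"]]] by simp
    qed
    define g where "g = pl_path n v"
    have g_vertex: "g (real j / real n) = (\<lambda>w. of_bool (v j = w))" if "j \<le> n" for j
      using pl_path_vertex[OF that n] by (simp add: g_def)
    have g0: "g 0 = (\<lambda>w. of_bool (v 0 = w))" and g1: "g 1 = g 0"
      by (simp_all add: g_def pl_path_ends[OF n] v_ends)
    have "pathin (realization K) g"
      unfolding pathin_def g_def using vK by (intro continuous_pl_path[OF K n])
    then have "homotopic_with (\<lambda>h. h 0 = g 0 \<and> h 1 = g 0) (top_of_set {0..1}) (realization K) g (\<lambda>_. g 0)"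
      using sc g1 by (simp add: simply_connected_space_def)
    then obtain h where h: "continuous_map (prod_topology (top_of_set {0..1}) (top_of_set {0..1})) (realization K) h"
      and h0: "\<And>t. h (0, t) = g t" and h1: "\<And>t. h (1, t) = g 0"
      and hs: "\<And>s. s \<in> {0..1::real} \<Longrightarrow> h (s, 0) = g 0 \<and> h (s, 1) = g 0"
      unfolding homotopic_with_def by blast
    let ?Q = "{0..1::real} \<times> {0..1::real}"
    have hc: "continuous_map (top_of_set ?Q) (realization K) h" using h by simp
    have ht: "h x \<in> topspace (realization K)" if "x \<in> ?Q" for x
      using continuous_map_image_subset_topspace[OF hc] that by auto
    have op: "\<exists>U. open U \<and> (\<forall>x\<in>?Q. x \<in> U \<longleftrightarrow> h x \<in> open_star K c)" for c
    proof -
      have "openin (top_of_set ?Q) {x \<in> topspace (top_of_set ?Q). h x \<in> open_star K c}"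
        by (rule openin_continuous_map_preimage[OF hc openin_open_star])
      then obtain U where U: "open U" "{x \<in> topspace (top_of_set ?Q). h x \<in> open_star K c} = ?Q \<inter> U"
        unfolding openin_open by blast
      have "x \<in> U \<longleftrightarrow> h x \<in> open_star K c" if "x \<in> ?Q" for x
        using arg_cong[OF U(2), of "\<lambda>A. x \<in> A"] that by simp
      with U(1) show ?thesis by blast
    qed
    then obtain U where U: "\<And>c. open (U c)" "\<And>c x. x \<in> ?Q \<Longrightarrow> x \<in> U c \<longleftrightarrow> h x \<in> open_star K c"
      by metis
    have cover: "?Q \<subseteq> \<Union>(range U)"
    proof
      fix x assume x: "x \<in> ?Q"
      obtain c where "h x \<in> open_star K c" using in_some_open_star[OF K ht[OF x]] by blast
      then show "x \<in> \<Union>(range U)" using U(2)[OF x] by blast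
    qed
    have "compact ?Q" by (intro compact_Times compact_Icc)
    then obtain e where e: "e > 0" "\<And>x. x \<in> ?Q \<Longrightarrow> \<exists>G\<in>range U. ball x e \<subseteq> G"
      by (rule Heine_Borel_lemma[OF _ cover]) (use U(1) in auto)
    then have "\<forall>x. \<exists>c. x \<in> ?Q \<longrightarrow> ball x e \<subseteq> U c" by blast
    then obtain c' where c': "\<And>x. x \<in> ?Q \<Longrightarrow> ball x e \<subseteq> U (c' x)" by metis
    \<comment> \<open>Half of the Lebesgue number, since the displacements in the two coordinates of
      the square add up.\<close>
    obtain M where M: "M > 0" "1 / real M < e / 2" using nat_approx_posE[of "e / 2"] e(1) by (metis half_gt_zero zero_less_Suc)
    \<comment> \<open>A multiple of \<open>n\<close>, so that the times \<open>k / n\<close> of the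
      vertices of the loop lie on the grid.\<close>
    define N where "N = M * n"
    have N: "N > 0" "1 / real N \<le> 1 / real M" using M n by (auto simp: N_def field_simps)
    \<comment> \<open>\<open>i\<close> counts positions along the loop and \<open>j\<close> stages
      of the homotopy, which is the first argument of \<open>h\<close>.\<close>
    define c where "c i j = c' (real j / real N, real i / real N)" for i j
    have sq: "h (s, t) \<in> open_star K (c i j)"
      if "i < N" "j < N" "real j / N \<le> s" "s \<le> real (Suc j) / N" "real i / N \<le> t" "t \<le> real (Suc i) / N" for i j s t
    proof -
      have q: "(real j / real N, real i / real N) \<in> ?Q" using that(1,2) by auto
      have "real (Suc j) / N \<le> 1" "real (Suc i) / N \<le> 1" "0 \<le> real i / N" "0 \<le> real j / N"
        using that(1,2) by auto
      then have "0 \<le> s" "s \<le> 1" "0 \<le> t" "t \<le> 1" using that(3-6) by (meson order_trans)+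
      then have st: "(s, t) \<in> ?Q" by simp
      have "\<bar>s - real j / N\<bar> \<le> 1 / N" "\<bar>t - real i / N\<bar> \<le> 1 / N"
        using that N by (auto simp: abs_le_iff add_divide_distrib)
      then have "\<bar>s - real j / N\<bar> + \<bar>t - real i / N\<bar> < e" using N M by linarith
      then have "dist (s, t) (real j / N, real i / N) < e"
        using sqrt_sum_squares_le_sum_abs[of "s - real j / N" "t - real i / N"]
        by (simp add: dist_Pair_Pair dist_real_def)
      then show ?thesis using c'[OF q] U(2)[OF st] by (auto simp: c_def dist_commute)
    qed
    have vert_c: "c i j = x"
      if "i < N" "j < N" "real j / N \<le> s" "s \<le> real (Suc j) / N" "real i / N \<le> t" "t \<le> real (Suc i) / N"
        "h (s, t) = (\<lambda>w. of_bool (x = w))" for i j s t x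
      using sq[OF that(1-6)] that(7) open_star_vertex by metis
    have corner: "{c i j, c (Suc i) j, c i (Suc j), c (Suc i) (Suc j)} \<in> K" if "Suc i < N" "Suc j < N" for i j
      using that sq[of _ _ "real (Suc j) / N" "real (Suc i) / N"]
      by (intro open_star_common_simplex[OF K ht[of "(real (Suc j) / N, real (Suc i) / N)"]])
        (auto simp: divide_right_mono)
    have below: "{c i j, c i (Suc j)} \<in> K" if "i < N" "Suc j < N" for i j
      using that sq[of i _ "real (Suc j) / N" "real i / N"]
      by (intro open_star_common_simplex[OF K ht[of "(real (Suc j) / N, real i / N)"]])
        (auto simp: divide_right_mono)
    have c_left: "c 0 j = v 0" if "j < N" for j
      using that N hs[of "real j / N"] g0 by (intro vert_c[of _ _ "real j / N" 0]) (auto simp: divide_right_mono)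
    have c_right: "c (N - 1) j = v 0" if "j < N" for j
      using that N hs[of "real j / N"] g0 by (intro vert_c[of _ _ "real j / N" 1]) (auto simp: divide_right_mono of_nat_diff)
    have c_top: "c i (N - 1) = v 0" if "i < N" for i
      using that N h1 g0 by (intro vert_c[of _ _ 1 "real i / N"]) (auto simp: divide_right_mono of_nat_diff)
    have rows: "\<exists>L. (\<forall>i<N. \<pi> (L i) = c i j \<and> E (L i) (L i)) \<and> (\<forall>i. Suc i < N \<longrightarrow> E (L i) (L (Suc i)))
        \<and> L 0 = u \<and> L (N - 1) = u'" if "j < N" for j
      using that
    proof (induction j)
      case 0
      \<comment> \<open>The point \<open>i / N\<close> lies on the edge of the loop with number
        \<open>i div M\<close>, so \<open>c i 0\<close> is one of its two ends, and
        \<open>L i\<close> is the given lift of that end.\<close>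
      define L where "L i = (if c i 0 = v (i div M) then w (i div M) else w (Suc (i div M)))" for i
      have divlt: "i div M < n" if "i < N" for i
        using that by (simp add: N_def less_mult_imp_div_less mult.commute)
      have c0: "c i 0 = v (i div M) \<or> c i 0 = v (Suc (i div M))" if "i < N" for i
      proof -
        let ?t = "real i / N"
        have t: "?t \<in> {0..1}" using that by simp
        have nt: "n * ?t = real i / M" using n M by (simp add: N_def)
        have "M * (i div M) \<le> i" "i \<le> M * Suc (i div M)"
          using M(1) by (auto simp: less_imp_le dividend_less_times_div)
        then have "real M * real (i div M) \<le> real i" "real i \<le> real M * real (Suc (i div M))"
          by (metis of_nat_le_iff of_nat_mult)+
        then have "real (i div M) \<le> n * ?t" "n * ?t \<le> real (Suc (i div M))"
          using M(1) unfolding nt by (auto simp: field_simps)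
        then have "g ?t \<in> closed_simplex {v (i div M), v (Suc (i div M))}"
          unfolding g_def by (intro pl_path_in_segment[OF t n]) auto
        moreover have "g ?t \<in> open_star K (c i 0)"
          using sq[of i 0 0 ?t] that h0 N by (auto simp: divide_right_mono)
        ultimately show ?thesis by (fastforce simp: closed_simplex_def open_star_def)
      qed
      \<comment> \<open>If the loop pauses, \<open>c i 0\<close> does not tell the two lifts apart,
        but uniqueness makes them equal.\<close>
      have Leq: "w a = w (Suc a)" if "a < n" "v a = v (Suc a)" for a
        using uniq[OF Ew[of a] w(3)[OF that(1)]] that by (simp add: v_def)
      have "E (L i) (L (Suc i))" if i: "Suc i < N" for i
      \<comment> \<open>Within an edge of the loop both squares choose between the same two lifts.
        At the passage to the next edge they share a corner that is mapped to a vertex, and both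
        stars are centred there.\<close>
      proof (cases "Suc i div M = i div M")
        case True
        have "i div M < n" using divlt i by simp
        then show ?thesis using w(3)[of "i div M"] Ew E_sym True by (auto simp: L_def)
      next
        case False
        then have dm: "Suc i mod M = 0" "Suc i div M = Suc (i div M)" by (auto simp: div_Suc mod_Suc split: if_splits)
        let ?a = "i div M"
        have a: "Suc ?a < n" using divlt[OF i] dm by simp
        have "Suc i = M * Suc ?a" using dm by (metis add.right_neutral mult_div_mod_eq)
        then have "real (Suc i) = real M * real (Suc ?a)" by (metis of_nat_mult)
        then have t: "real (Suc i) / N = real (Suc ?a) / n" using M n by (simp add: N_def)
        then have ht: "h (0, real (Suc i) / N) = (\<lambda>w. of_bool (v (Suc ?a) = w))"
          using g_vertex[of "Suc ?a"] a h0 by simp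
        have "c i 0 = v (Suc ?a)" using i N ht
          by (intro vert_c[of _ _ 0 "real (Suc i) / N"]) (auto simp: divide_right_mono)
        moreover have "c (Suc i) 0 = v (Suc ?a)" using i N ht
          by (intro vert_c[of _ _ 0 "real (Suc i) / N"]) (auto simp: divide_right_mono)
        ultimately have "L i = w (Suc ?a)" "L (Suc i) = w (Suc ?a)"
          using Leq[of ?a] a dm by (auto simp: L_def)
        then show ?thesis using Ew[of "Suc ?a"] a by simp
      qed
      moreover have "L 0 = u" using c_left[of 0] N w by (simp add: L_def)
      moreover have "L (N - 1) = u'"
      proof -
        have "(N - 1) div M < n" using divlt[of "N - 1"] N by simp
        moreover have "n - 1 \<le> (N - 1) div M"
        proof -
          have "(n - 1) * M = N - M" by (simp add: N_def diff_mult_distrib2 mult.commute)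
          then have "(n - 1) * M \<le> N - 1" using M(1) by simp
          then show ?thesis using M(1) by (simp add: less_eq_div_iff_mult_less_eq)
        qed
        ultimately have d: "(N - 1) div M = n - 1" by simp
        have "c (N - 1) 0 = v n" using c_right[of 0] N v_ends by simp
        then show ?thesis using Leq[of "n - 1"] n w d by (auto simp: L_def)
      qed
      moreover have "\<pi> (L i) = c i 0 \<and> E (L i) (L i)" if "i < N" for i
        using c0[OF that] Ew divlt[OF that] by (auto simp: L_def v_def Suc_leI)
      ultimately show ?case by blast
    next
      case (Suc j)
      then obtain L where L: "\<And>i. i < N \<Longrightarrow> \<pi> (L i) = c i j" "\<And>i. i < N \<Longrightarrow> E (L i) (L i)"
        "\<And>i. Suc i < N \<Longrightarrow> E (L i) (L (Suc i))" "L 0 = u" "L (N - 1) = u'" by auto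
      have "\<exists>x. i < N \<longrightarrow> E (L i) x \<and> \<pi> x = c i (Suc j)" for i
        using lift[OF L(2), of i "c i (Suc j)"] below[of i j] L(1)[of i] Suc.prems by auto
      then obtain L' where L': "\<And>i. i < N \<Longrightarrow> E (L i) (L' i)" "\<And>i. i < N \<Longrightarrow> \<pi> (L' i) = c i (Suc j)"
        by metis
      have "E (L' i) (L' (Suc i))" if i: "Suc i < N" for i
      proof -
        have co: "A \<in> K" if "A \<subseteq> {c i j, c (Suc i) j, c i (Suc j), c (Suc i) (Suc j)}" "A \<noteq> {}" for A
          using abs_complexD(3)[OF K corner[OF i Suc.prems] that] .
        \<comment> \<open>The diagonal of the square is lifted first; each of the two triangles is
          then filled by \<open>tri\<close>.\<close>
        have "E (L i) (L' (Suc i))"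
          using i L(1)[of i] L(1)[of "Suc i"] L'(2)[of "Suc i"]
          by (intro tri[OF L(3)[OF i] L'(1)[OF i]] co) auto
        then show ?thesis
          using i L(1)[of i] L'(2)[of "Suc i"] L'(2)[of i]
          by (intro tri[OF E_sym[OF L'(1)]] co) auto
      qed
      \<comment> \<open>The lateral sides of the homotopy are mapped to the base vertex, so the ends
        of the row do not move.\<close>
      moreover have "L' 0 = u" using uniq[OF L(2)[of 0] L'(1)[of 0]] L(1,4) L'(2) N c_left Suc.prems by auto
      moreover have "L' (N - 1) = u'"
        using uniq[OF L(2)[of "N - 1"] L'(1)[of "N - 1"]] L(1,5) L'(2) N c_right Suc.prems by auto
      moreover have "\<pi> (L' i) = c i (Suc j) \<and> E (L' i) (L' i)" if "i < N" for i
        using L'(2)[OF that] E_refl[OF E_sym[OF L'(1)[OF that]]] by blast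
      ultimately show ?case by blast
    qed
    obtain L where L: "\<And>i. i < N \<Longrightarrow> \<pi> (L i) = c i (N - 1)" "\<And>i. i < N \<Longrightarrow> E (L i) (L i)"
      "\<And>i. Suc i < N \<Longrightarrow> E (L i) (L (Suc i))" "L 0 = u" "L (N - 1) = u'"
      using rows[of "N - 1"] N by auto
    \<comment> \<open>The last row projects to the base vertex throughout, hence its lift is
      constant.\<close>
    have "L i = L 0" if "i < N" for i
      using that
    proof (induction i)
      case (Suc i)
      then have "L i = L (Suc i)"
        using uniq[OF L(2)[of i] L(3)[of i]] L(1)[of i] L(1)[of "Suc i"] c_top[of i] c_top[of "Suc i"] by simp
      then show ?case using Suc by simp
    qed simp
    then show ?thesis using L(4,5) N by (metis diff_less zero_less_one)
  qed
qed

subsection \<open>Normal forms in flag posets\<close>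

definition slt :: "('v \<Rightarrow> 'v \<Rightarrow> bool) \<Rightarrow> 'v \<Rightarrow> 'v \<Rightarrow> bool" where
  "slt le a b \<longleftrightarrow> le a b \<and> a \<noteq> b"

text \<open>With \<open>le\<close> or its converse this is the path \<open>a1, a2, a3, a4\<close> in the link of \<open>x1\<close> that is forbidden
  in a local normal form path \<open>\<dots> x x1 x2 \<dots>\<close>, where \<open>a1 = x\<close> and \<open>a4 = x2\<close>.\<close>

definition shortcut :: "('v \<Rightarrow> 'v \<Rightarrow> bool) \<Rightarrow> 'v \<Rightarrow> 'v \<Rightarrow> 'v \<Rightarrow> bool" where
  "shortcut le x x1 x2 \<longleftrightarrow> (\<exists>a b. slt le a x1 \<and> slt le b x1 \<and> le x a \<and> le b a \<and> le b x2)"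

text \<open>Zigzags from the head of the list to the base vertex \<open>y\<close>. The order is reversed at each step,
  so that the head of the list is always a local minimum; \<open>e\<close> tells whether \<open>y\<close> itself counts as a
  minimum.\<close>

fun normal_form :: "('v \<Rightarrow> 'v \<Rightarrow> bool) \<Rightarrow> 'v \<Rightarrow> bool \<Rightarrow> 'v list \<Rightarrow> bool" where
  "normal_form le y e [] \<longleftrightarrow> False"
| "normal_form le y e [x] \<longleftrightarrow> x = y \<and> e"
| "normal_form le y e [x, x1] \<longleftrightarrow> slt le x x1 \<and> normal_form le\<inverse>\<inverse> y (\<not> e) [x1]"
| "normal_form le y e (x # x1 # x2 # p) \<longleftrightarrow>
     slt le x x1 \<and> \<not> shortcut le x x1 x2 \<and> normal_form le\<inverse>\<inverse> y (\<not> e) (x1 # x2 # p)"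

text \<open>Entrywise related normal forms have equal length, and so by parity both begin at a
  minimum or both at a maximum.\<close>

lemma normal_form_parity: "normal_form le y e p \<Longrightarrow> odd (length p) = e"
  by (induction le y e p rule: normal_form.induct) auto

lemma normal_form_Cons:
  assumes "normal_form le y e (x # q)" "q \<noteq> []"
  shows "normal_form le\<inverse>\<inverse> y (\<not> e) q" "slt le x (hd q)"
  using assms by (cases "(le, y, e, x # q)" rule: normal_form.cases; simp)+

text \<open>The carrier of the poset is \<open>{x. le x x}\<close>.\<close>

locale flag_poset =
  fixes le :: "'v \<Rightarrow> 'v \<Rightarrow> bool" (infix "\<sqsubseteq>" 50)
  assumes refl1: "x \<sqsubseteq> y \<Longrightarrow> x \<sqsubseteq> x" and refl2: "x \<sqsubseteq> y \<Longrightarrow> y \<sqsubseteq> y"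
    and antisym: "x \<sqsubseteq> y \<Longrightarrow> y \<sqsubseteq> x \<Longrightarrow> x = y"
    and trans: "x \<sqsubseteq> y \<Longrightarrow> y \<sqsubseteq> z \<Longrightarrow> x \<sqsubseteq> z"
    and rank: "\<exists>(rk :: 'v \<Rightarrow> nat) n. \<forall>x y. x \<sqsubseteq> y \<and> x \<noteq> y \<longrightarrow> rk x < rk y \<and> rk y \<le> n"
    and join: "l \<sqsubseteq> a \<Longrightarrow> l \<sqsubseteq> b \<Longrightarrow> a \<sqsubseteq> u \<Longrightarrow> b \<sqsubseteq> u \<Longrightarrow>
      \<exists>j. a \<sqsubseteq> j \<and> b \<sqsubseteq> j \<and> (\<forall>w. a \<sqsubseteq> w \<and> b \<sqsubseteq> w \<longrightarrow> j \<sqsubseteq> w)"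
    and meet: "l \<sqsubseteq> a \<Longrightarrow> l \<sqsubseteq> b \<Longrightarrow> a \<sqsubseteq> u \<Longrightarrow> b \<sqsubseteq> u \<Longrightarrow>
      \<exists>j. j \<sqsubseteq> a \<and> j \<sqsubseteq> b \<and> (\<forall>w. w \<sqsubseteq> a \<and> w \<sqsubseteq> b \<longrightarrow> w \<sqsubseteq> j)"
    and upflag: "l \<sqsubseteq> a \<Longrightarrow> l \<sqsubseteq> b \<Longrightarrow> l \<sqsubseteq> c \<Longrightarrow> a \<sqsubseteq> u \<Longrightarrow> b \<sqsubseteq> u \<Longrightarrow> b \<sqsubseteq> v \<Longrightarrow> c \<sqsubseteq> v \<Longrightarrow>
      a \<sqsubseteq> w \<Longrightarrow> c \<sqsubseteq> w \<Longrightarrow> \<exists>t. a \<sqsubseteq> t \<and> b \<sqsubseteq> t \<and> c \<sqsubseteq> t"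
    and downflag: "a \<sqsubseteq> l \<Longrightarrow> b \<sqsubseteq> l \<Longrightarrow> c \<sqsubseteq> l \<Longrightarrow> u \<sqsubseteq> a \<Longrightarrow> u \<sqsubseteq> b \<Longrightarrow> v \<sqsubseteq> b \<Longrightarrow> v \<sqsubseteq> c \<Longrightarrow>
      w \<sqsubseteq> a \<Longrightarrow> w \<sqsubseteq> c \<Longrightarrow> \<exists>t. t \<sqsubseteq> a \<and> t \<sqsubseteq> b \<and> t \<sqsubseteq> c"
begin

text \<open>Duality: results on upward moves also yield those on downward moves. The bound
  \<open>n\<close> in \<open>rank\<close> allows the rank function to be reversed to
  \<open>n - rk x\<close>.\<close>

lemma converse: "flag_poset le\<inverse>\<inverse>"
proof (unfold_locales, unfold conversep_iff, goal_cases)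
  case 1 then show ?case by (rule refl2)
next
  case 2 then show ?case by (rule refl1)
next
  case 3 then show ?case by (intro antisym)
next
  case (4 x y z) from 4(2,1) show ?case by (rule trans)
next
  case 5
  obtain rk :: "'v \<Rightarrow> nat" and n where rk: "\<And>x y. x \<sqsubseteq> y \<Longrightarrow> x \<noteq> y \<Longrightarrow> rk x < rk y \<and> rk y \<le> n"
    using rank by blast
  have "n - rk x < n - rk y \<and> n - rk y \<le> n" if "y \<sqsubseteq> x" "x \<noteq> y" for x y using rk[OF that(1)] that(2) by auto
  then show ?case by (intro exI[of _ "\<lambda>x. n - rk x"] exI[of _ n]) blast
next
  case (6 l a b u) then show ?case by (intro meet)
next
  case (7 l a b u) then show ?case by (intro join)
next
  case (8 l a b c u v w) then show ?case by (intro downflag)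
next
  case (9 a l b c u v w) then show ?case by (intro upflag)
qed

text \<open>An element of maximal rank absorbs every other one, since a common upper bound inside
  \<open>M\<close> cannot have larger rank. This supplies extreme elements of possibly infinite
  sets, where binary joins do not suffice.\<close>

lemma directed_has_max:
  assumes "a \<in> M" "\<And>a. a \<in> M \<Longrightarrow> a \<sqsubseteq> z"
    and dir: "\<And>a b. a \<in> M \<Longrightarrow> b \<in> M \<Longrightarrow> \<exists>c\<in>M. a \<sqsubseteq> c \<and> b \<sqsubseteq> c"
  obtains m where "m \<in> M" "\<And>a. a \<in> M \<Longrightarrow> a \<sqsubseteq> m"
proof -
  obtain rk :: "'v \<Rightarrow> nat" and n where rk: "\<And>x y. x \<sqsubseteq> y \<Longrightarrow> x \<noteq> y \<Longrightarrow> rk x < rk y \<and> rk y \<le> n"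
    using rank by blast
  have "\<forall>x. x \<in> M \<longrightarrow> rk x \<le> max n (rk z)" using assms(2) rk by (metis max.coboundedI1 max.coboundedI2 order.refl order.strict_implies_order order_trans)
  then obtain m where m: "m \<in> M" "\<And>x. x \<in> M \<Longrightarrow> rk x \<le> rk m"
    using ex_has_greatest_nat[of "\<lambda>x. x \<in> M" a rk "Suc (max n (rk z))"] assms(1) by (auto simp: less_Suc_eq_le)
  have "a \<sqsubseteq> m" if a: "a \<in> M" for a
  proof -
    obtain c where "c \<in> M" "a \<sqsubseteq> c" "m \<sqsubseteq> c" using dir[OF a m(1)] by blast
    then show ?thesis using rk[of m c] m(2)[of c] by (cases "m = c") auto
  qed
  then show ?thesis using that m(1) by blast
qed

end

section \<open>Lifting zigzags that end at an extremal element\<close>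

locale based_flag_poset = flag_poset +
  fixes y :: 'v and e :: bool
  assumes y_refl: "y \<sqsubseteq> y"
    and y_min: "e \<Longrightarrow> x \<sqsubseteq> y \<Longrightarrow> x = y"
    and y_max: "\<not> e \<Longrightarrow> y \<sqsubseteq> x \<Longrightarrow> x = y"
begin

abbreviation low where "low \<equiv> normal_form le y e"
abbreviation high where "high \<equiv> normal_form le\<inverse>\<inverse> y (\<not> e)"

lemma converse_based: "based_flag_poset le\<inverse>\<inverse> y (\<not> e)"
  using converse y_refl y_min y_max
  by (auto simp: based_flag_poset_def based_flag_poset_axioms_def)

lemma low_tl: "low (x # q) \<Longrightarrow> q \<noteq> [] \<Longrightarrow> high q"
  and low_hd: "low (x # q) \<Longrightarrow> q \<noteq> [] \<Longrightarrow> x \<sqsubseteq> hd q \<and> x \<noteq> hd q"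
  using normal_form_Cons[of le y e x q] by (auto simp: slt_def)

lemma high_tl: "high (x # q) \<Longrightarrow> q \<noteq> [] \<Longrightarrow> low q"
  and high_hd: "high (x # q) \<Longrightarrow> q \<noteq> [] \<Longrightarrow> hd q \<sqsubseteq> x \<and> x \<noteq> hd q"
  using normal_form_Cons[of "le\<inverse>\<inverse>" y "\<not> e" x q] by (auto simp: slt_def)

lemma low_noshort:
  assumes "low (x # x1 # x2 # r)" "x \<sqsubseteq> a" "b \<sqsubseteq> a" "b \<sqsubseteq> x2" "a \<sqsubseteq> x1" "a \<noteq> x1" "b \<noteq> x1"
  shows False
proof -
  have "b \<sqsubseteq> x1" using assms trans by blast
  then have "shortcut le x x1 x2" unfolding shortcut_def slt_def using assms by blast
  then show False using assms(1) by simp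
qed

lemma high_noshort:
  assumes "high (x # x1 # x2 # r)" "a \<sqsubseteq> x" "a \<sqsubseteq> b" "x2 \<sqsubseteq> b" "x1 \<sqsubseteq> a" "a \<noteq> x1" "b \<noteq> x1"
  shows False
  using based_flag_poset.low_noshort[OF converse_based, of x x1 x2 r a b] assms by simp

lemma low_high_disjoint: "low p \<Longrightarrow> high p \<Longrightarrow> False"
  using normal_form_parity[of le y e p] normal_form_parity[of "le\<inverse>\<inverse>" y "\<not> e" p] by auto

text \<open>The meet of \<open>t\<close> and \<open>x1\<close> is \<open>x2\<close> itself: a larger
  one, together with the entry after \<open>t\<close>, would form a shortcut at
  \<open>x2\<close>.\<close>

lemma high_meet:
  assumes "high (x1 # x2 # r)" "high (w # t # r')" "list_all2 le (x1 # x2 # r) (w # t # r')"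
    and c: "c \<sqsubseteq> t" "c \<sqsubseteq> x1"
  shows "c \<sqsubseteq> x2"
proof -
  have x: "x2 \<sqsubseteq> x1" "t \<sqsubseteq> w" "x1 \<sqsubseteq> w" "x2 \<sqsubseteq> t" using high_hd[OF assms(1)] high_hd[OF assms(2)] assms(3) by auto
  obtain d where d: "d \<sqsubseteq> t" "d \<sqsubseteq> x1" "\<And>w. w \<sqsubseteq> t \<Longrightarrow> w \<sqsubseteq> x1 \<Longrightarrow> w \<sqsubseteq> d"
    using meet[of x2 t x1 w] x by blast
  have "d = x2"
  proof (cases r)
    case Nil
    then have "x2 = y" "t = y" using assms(1-3) by auto
    then show ?thesis using d x antisym by blast
  next
    case (Cons x3 r3)
    then obtain t3 r3' where r': "r' = t3 # r3'" "x3 \<sqsubseteq> t3" using assms(3) by (cases r') auto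
    have "t \<sqsubseteq> t3" using low_hd[OF high_tl[OF assms(2)]] r' by auto
    show ?thesis
    proof (rule ccontr)
      assume ne: "d \<noteq> x2"
      have "x2 \<sqsubseteq> d" using d(3) x by blast
      moreover have "d \<sqsubseteq> t3" using d(1) \<open>t \<sqsubseteq> t3\<close> trans by blast
      moreover have "t3 \<noteq> x2" using calculation ne antisym by blast
      ultimately show False using high_noshort[of x1 x2 x3 r3 d t3] assms(1) Cons d(2) r' ne by blast
    qed
  qed
  then show ?thesis using d(3) c by blast
qed

text \<open>When the initial vertex of \<open>p\<close> is a local minimum and moves up, the length of the normal form
  drops by one, stays or grows by one.\<close>

definition lifts_low :: "'v list \<Rightarrow> 'v list \<Rightarrow> bool" where
  "lifts_low p p' \<longleftrightarrow> high p' \<and> list_all2 le (tl p) p' \<or> low p' \<and> list_all2 le p p'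
     \<or> high p' \<and> list_all2 le p (tl p')"

text \<open>When a local maximum moves up, the length stays the same. The tail is lifted from its
  minimum \<open>x2\<close> to \<open>w\<close>; if this did not add a vertex, then either the tail
  would be trivial, with \<open>w = x2\<close>, or \<open>x1\<close> and \<open>x3\<close> would
  have a common upper bound giving a shortcut at \<open>x2\<close>. The lifting of the tail is a
  hypothesis so that it can come from an induction.\<close>

lemma lift_high_aux:
  assumes q: "high q" "hd q \<sqsubseteq> w"
    and IH: "\<And>z. tl q \<noteq> [] \<Longrightarrow> hd (tl q) \<sqsubseteq> z \<Longrightarrow> \<exists>p'. hd p' = z \<and> lifts_low (tl q) p'"
  shows "\<exists>p'. hd p' = w \<and> high p' \<and> list_all2 le q p'"
proof -
  obtain x1 r where qr: "q = x1 # r" using q(1) by (cases q) auto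
  show ?thesis
  proof (cases r)
    case Nil
    then have "w = y" "x1 = y" using q qr y_max by auto
    then show ?thesis using q qr Nil y_refl by (intro exI[of _ "[y]"]) auto
  next
    case (Cons x2 r2)
    have x: "x2 \<sqsubseteq> x1" "x1 \<noteq> x2" "x1 \<sqsubseteq> w" "low r" using high_hd[of x1 r] high_tl[of x1 r] q qr Cons by auto
    obtain p' where p': "hd p' = w" "lifts_low r p'" using IH[of w] trans[OF x(1,3)] qr Cons by auto
    have w: "w \<noteq> x2" using x antisym by blast
    have bound: False if "x3 \<sqsubseteq> b" "w \<sqsubseteq> b" "r2 = x3 # r3" for b x3 r3
    proof -
      have "x1 \<sqsubseteq> b" "b \<noteq> x2" using x that trans antisym by blast+
      then show False
        using high_noshort[of x1 x2 x3 r3 x1 b] q qr Cons that x refl2 by blast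
    qed
    obtain tp where p'0: "p' = w # tp" using p' by (cases p') (auto simp: lifts_low_def)
    consider "high p'" "list_all2 le (tl r) p'" | "low p'" "list_all2 le r p'" | "high p'" "list_all2 le r (tl p')"
      using p'(2) by (auto simp: lifts_low_def)
    then show ?thesis
    proof cases
      case 1
      then obtain x3 r3 where "r2 = x3 # r3" "x3 \<sqsubseteq> w" using Cons p'0 by (cases r2) auto
      then show ?thesis using bound[of x3 w r3] refl2[OF x(3)] by blast
    next
      case 2
      show ?thesis
      proof (cases r2)
        case Nil
        then have "w = y" "x2 = y" using 2 p'0 Cons x(4) by (auto simp: list_all2_Cons1)
        then show ?thesis using w by blast
      next
        case (Cons x3 r3)
        then obtain t p2 where t: "p' = w # t # p2" "x3 \<sqsubseteq> t"
          using 2(2) p'0 \<open>r = x2 # r2\<close> by (auto simp: list_all2_Cons1)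
        have "w \<sqsubseteq> t" using low_hd[of w "t # p2"] 2(1) t by auto
        then show ?thesis using bound[of x3 t r3] t Cons by blast
      qed
    next
      case 3
      then have "list_all2 le q p'" using p'0 qr x(3) by simp
      then show ?thesis using 3 p'(1) by blast
    qed
  qed
qed

text \<open>The turn at the join \<open>w\<close> inherits normality from the turn at
  \<open>x1\<close>: meets with \<open>x1\<close> and the flag condition carry a shortcut at
  \<open>w\<close> down to one at \<open>x1\<close>.\<close>

lemma lift_low_bounded:
  assumes p: "low (x # q)" "q = x1 # r" and z: "x \<sqsubseteq> z" "\<not> x1 \<sqsubseteq> z" "x1 \<sqsubseteq> u" "z \<sqsubseteq> u"
    and lift: "\<And>w. x1 \<sqsubseteq> w \<Longrightarrow> \<exists>p'. hd p' = w \<and> high p' \<and> list_all2 le q p'"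
  shows "\<exists>p'. hd p' = z \<and> low p' \<and> list_all2 le (x # q) p'"
proof -
  have xx1: "x \<sqsubseteq> x1" using low_hd[OF p(1)] p(2) by auto
  obtain w where w: "z \<sqsubseteq> w" "x1 \<sqsubseteq> w" "\<And>v. z \<sqsubseteq> v \<Longrightarrow> x1 \<sqsubseteq> v \<Longrightarrow> w \<sqsubseteq> v"
    using join[OF z(1) xx1 z(4,3)] by blast
  obtain p' where p': "hd p' = w" "high p'" "list_all2 le q p'" using lift[OF w(2)] by blast
  then obtain t' where t': "p' = w # t'" by (cases p') auto
  have zw: "slt le z w" using w z(2) by (auto simp: slt_def)
  have "low (z # p')"
  proof (cases t')
    case Nil then show ?thesis using t' p' zw by simp
  next
    case (Cons t t2)
    then obtain x2 r2 where r: "r = x2 # r2" using p'(3) t' p(2) by (cases r) auto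
    have x2: "x2 \<sqsubseteq> x1" "x2 \<sqsubseteq> t" using high_hd[OF low_tl[OF p(1)[unfolded p(2)]]] r p'(3) p(2) t' Cons by auto
    have tw: "t \<sqsubseteq> w" using high_hd[of w "t # t2"] p'(2) t' Cons by auto
    have "\<not> shortcut le z w t"
    proof
      assume "shortcut le z w t"
      then obtain a b where ab: "a \<sqsubseteq> w" "a \<noteq> w" "z \<sqsubseteq> a" "b \<sqsubseteq> a" "b \<sqsubseteq> t"
        by (auto simp: shortcut_def slt_def)
      have xa: "x \<sqsubseteq> a" using z(1) ab(3) trans by blast
      \<comment> \<open>Below \<open>w\<close>, the pairs among \<open>a\<close>, \<open>x1\<close>,
        \<open>t\<close> have the lower bounds \<open>x\<close>, \<open>x2\<close> and
        \<open>b\<close>. With \<open>d\<close>, the meet of \<open>a\<close> and \<open>x1\<close>,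
        the element \<open>c\<close> forms a shortcut at \<open>x1\<close>; \<open>d\<close> differs
        from \<open>x1\<close> because otherwise \<open>a\<close> would lie above the join
        \<open>w\<close>.\<close>
      obtain c where c: "c \<sqsubseteq> a" "c \<sqsubseteq> x1" "c \<sqsubseteq> t"
        using downflag[OF ab(1) w(2) tw xa xx1 x2 ab(4,5)] by blast
      obtain d where d: "d \<sqsubseteq> a" "d \<sqsubseteq> x1" "\<And>v. v \<sqsubseteq> a \<Longrightarrow> v \<sqsubseteq> x1 \<Longrightarrow> v \<sqsubseteq> d"
        using meet[OF xa xx1 ab(1) w(2)] by blast
      have "d \<noteq> x1" using d(1) w(3)[of a] ab antisym by blast
      moreover have "c \<sqsubseteq> d" using d(3) c by blast
      moreover have "c \<noteq> x1" using calculation d(2) antisym by blast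
      moreover have "c \<sqsubseteq> x2"
        using high_meet[of x1 x2 r2 w t t2 c] low_tl[OF p(1)] p(2) r p'(2,3) t' Cons c by simp
      ultimately show False using low_noshort[of x x1 x2 r2 d c] p r d xa xx1 by blast
    qed
    then show ?thesis using t' Cons p'(2) zw by simp
  qed
  moreover have "list_all2 le (x # q) (z # p')" using p'(3) z(1) by simp
  ultimately show ?thesis by (intro exI[of _ "z # p'"]) simp
qed

text \<open>Let \<open>p\<close> start with \<open>x, x1\<close>. If \<open>x1\<close> is below \<open>z\<close>, then \<open>x\<close> is dropped. If \<open>z\<close> and \<open>x1\<close> are merely
  bounded above, then the new path continues from \<open>z\<close> to their join. Otherwise it continues from \<open>z\<close> to
  the largest element between \<open>x\<close> and \<open>z\<close> that is bounded above together with \<open>x1\<close>.\<close>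

lemma lift_low:
  assumes "low p" "hd p \<sqsubseteq> z"
  shows "\<exists>p'. hd p' = z \<and> lifts_low p p'"
  using assms
proof (induction "length p" arbitrary: p z rule: less_induct)
  case less
  obtain x q where p: "p = x # q" using less.prems(1) by (cases p) auto
  show ?case
  proof (cases q)
    case Nil
    then have xy: "x = y" "e" using less.prems p by auto
    show ?thesis
    proof (cases "z = y")
      case True
      then show ?thesis using less.prems p Nil xy y_refl unfolding lifts_low_def by (intro exI[of _ "[y]"]) auto
    next
      case False
      then show ?thesis using less.prems p Nil xy y_refl
        unfolding lifts_low_def by (intro exI[of _ "[z, y]"]) (auto simp: slt_def)
    qed
  next
    case (Cons x1 r)
    have xx1: "x \<sqsubseteq> x1" "x \<noteq> x1" and q: "high q" using low_hd[of x q] low_tl[of x q] less.prems(1) p Cons by auto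
    have xz: "x \<sqsubseteq> z" using less.prems(2) p by simp
    have LQ: "\<exists>p'. hd p' = w \<and> high p' \<and> list_all2 le q p'" if w: "x1 \<sqsubseteq> w" for w
    proof (rule lift_high_aux[OF q])
      show "hd q \<sqsubseteq> w" using w Cons by simp
      fix z assume "tl q \<noteq> []" "hd (tl q) \<sqsubseteq> z"
      moreover have "low (tl q)" using high_tl[of x1 r] q Cons calculation by simp
      ultimately show "\<exists>p'. hd p' = z \<and> lifts_low (tl q) p'"
        using less.hyps[of "tl q"] p Cons by simp
    qed
    show ?thesis
    proof (cases "x1 \<sqsubseteq> z")
      case True
      then show ?thesis using LQ[OF True] p by (auto simp: lifts_low_def)
    next
      case not_above: False
      show ?thesis
      proof (cases "\<exists>u. x1 \<sqsubseteq> u \<and> z \<sqsubseteq> u")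
        case True
        then show ?thesis
          using lift_low_bounded[OF _ Cons xz not_above _ _ LQ] less.prems(1) p by (auto simp: lifts_low_def)
      next
        case unbounded: False
        define M where "M = {a. x \<sqsubseteq> a \<and> a \<sqsubseteq> z \<and> (\<exists>u. x1 \<sqsubseteq> u \<and> a \<sqsubseteq> u)}"
        have M: "x \<in> M" using xz xx1 refl1 refl2 unfolding M_def by blast
        have dir: "\<exists>c\<in>M. a \<sqsubseteq> c \<and> b \<sqsubseteq> c" if abM: "a \<in> M" "b \<in> M" for a b
        proof -
          obtain u v where uv: "x1 \<sqsubseteq> u" "a \<sqsubseteq> u" "x1 \<sqsubseteq> v" "b \<sqsubseteq> v" and ab: "x \<sqsubseteq> a" "a \<sqsubseteq> z" "x \<sqsubseteq> b" "b \<sqsubseteq> z"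
            using abM unfolding M_def by blast
          obtain j where j: "a \<sqsubseteq> j" "b \<sqsubseteq> j" "\<And>w. a \<sqsubseteq> w \<Longrightarrow> b \<sqsubseteq> w \<Longrightarrow> j \<sqsubseteq> w" using join[OF ab(1,3,2,4)] by blast
          \<comment> \<open>\<open>x1\<close> has a common upper bound with \<open>a\<close> and
            with \<open>b\<close>, and \<open>z\<close> bounds these two, so the flag condition
            applies; the join \<open>j\<close> lies below the result.\<close>
          obtain t where "a \<sqsubseteq> t" "b \<sqsubseteq> t" "x1 \<sqsubseteq> t" using upflag[OF ab(1,3) xx1(1) ab(2,4) uv(4,3) uv(2,1)] by blast
          then have "j \<in> M" using j trans[OF ab(1) j(1)] ab(2,4) unfolding M_def by blast
          then show ?thesis using j by blast
        qed
        have bound: "a \<sqsubseteq> z" if "a \<in> M" for a using that by (simp add: M_def)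
        obtain m where m: "m \<in> M" "\<And>a. a \<in> M \<Longrightarrow> a \<sqsubseteq> m"
          using directed_has_max[of x M z] M bound dir by metis
        then obtain u where u: "x \<sqsubseteq> m" "m \<sqsubseteq> z" "x1 \<sqsubseteq> u" "m \<sqsubseteq> u" unfolding M_def by blast
        have mz: "m \<noteq> z" using u unbounded by blast
        have "\<not> x1 \<sqsubseteq> m" using u(2) not_above trans by blast
        then obtain pm where pm: "hd pm = m" "low pm" "list_all2 le (x # q) pm"
          using lift_low_bounded[OF _ Cons u(1) _ u(3,4) LQ] less.prems(1) p by blast
        then obtain s s2 where s: "pm = m # s # s2" "x1 \<sqsubseteq> s" using Cons by (auto simp: list_all2_Cons1)
        have "\<not> shortcut le\<inverse>\<inverse> z m s"
        proof
          assume "shortcut le\<inverse>\<inverse> z m s"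
          then obtain a b where ab: "m \<sqsubseteq> a" "a \<noteq> m" "a \<sqsubseteq> z" "a \<sqsubseteq> b" "s \<sqsubseteq> b" by (auto simp: shortcut_def slt_def)
          \<comment> \<open>\<open>b\<close> bounds both \<open>a\<close> and \<open>x1\<close>, so
            \<open>a\<close> belongs to \<open>M\<close>, against the maximality of
            \<open>m\<close>.\<close>
          have "x \<sqsubseteq> a" "x1 \<sqsubseteq> b" using trans[OF u(1) ab(1)] trans[OF s(2) ab(5)] .
          then have "a \<in> M" using ab unfolding M_def by blast
          then show False using m(2) ab antisym by blast
        qed
        then have "high (z # pm)" using s pm u(2) mz by (simp add: slt_def)
        then show ?thesis using pm p by (intro exI[of _ "z # pm"]) (simp add: lifts_low_def)
      qed
    qed
  qed
qed

lemma lift_high: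
  assumes "high q" "hd q \<sqsubseteq> w"
  shows "\<exists>p'. hd p' = w \<and> high p' \<and> list_all2 le q p'"
proof (rule lift_high_aux[OF assms])
  fix z assume z: "tl q \<noteq> []" "hd (tl q) \<sqsubseteq> z"
  then have "low (tl q)" using high_tl[of "hd q" "tl q"] assms(1) by (cases q) auto
  then show "\<exists>p'. hd p' = z \<and> lifts_low (tl q) p'" using lift_low z(2) by blast
qed

text \<open>\<open>s\<close> is forced to be the join of \<open>x1\<close> and \<open>z\<close>: a
  smaller upper bound would give a shortcut at \<open>s\<close> together with the vertex after
  \<open>x1\<close>.\<close>

lemma low_same_level:
  assumes "low (x # x1 # r)" "low (z # s # r')" "list_all2 le (x # x1 # r) (z # s # r')"
    and w: "x1 \<sqsubseteq> w" "z \<sqsubseteq> w"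
  shows "s \<sqsubseteq> w"
proof -
  have x: "x \<sqsubseteq> x1" "x \<sqsubseteq> z" "x1 \<sqsubseteq> s" "z \<sqsubseteq> s" using assms low_hd[OF assms(1)] low_hd[OF assms(2)] by auto
  obtain v where v: "x1 \<sqsubseteq> v" "z \<sqsubseteq> v" "\<And>w. x1 \<sqsubseteq> w \<Longrightarrow> z \<sqsubseteq> w \<Longrightarrow> v \<sqsubseteq> w"
    using join[OF x] by blast
  have "v = s"
  proof (cases r)
    case Nil
    then have "x1 = y" "s = y" using assms(1-3) by auto
    then show ?thesis using v x antisym by blast
  next
    case (Cons x2 r2)
    then obtain s2 r2' where r': "r' = s2 # r2'" "x2 \<sqsubseteq> s2" using assms(3) by (cases r') auto
    have x2: "x2 \<sqsubseteq> x1" "x1 \<noteq> x2" using high_hd[OF low_tl[OF assms(1)]] Cons by auto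
    have "v \<sqsubseteq> s" using v x by blast
    moreover have "x2 \<sqsubseteq> v" using x2 v trans by blast
    moreover have "x2 \<noteq> s" using x2 x antisym by blast
    ultimately show ?thesis using low_noshort[of z s s2 r2' v x2] assms(2) r' v(2) by blast
  qed
  then show ?thesis using v(3) w by blast
qed

text \<open>The vertex \<open>m\<close> is forced to be the largest element between \<open>x\<close>
  and \<open>z\<close> that is bounded above together with \<open>x1\<close>. Otherwise the join of
  \<open>a\<close> and \<open>m\<close>, with a common upper bound supplied by the flag condition,
  would be a shortcut at \<open>m\<close>.\<close>

lemma low_next_level_unbounded:
  assumes "low (x # x1 # r)" "high (z # m # s # r')" "list_all2 le (x # x1 # r) (m # s # r')"
    and w: "x1 \<sqsubseteq> w" "a \<sqsubseteq> w" and a: "x \<sqsubseteq> a" "a \<sqsubseteq> z"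
  shows "a \<sqsubseteq> m"
proof -
  have lm: "low (m # s # r')" using high_tl[OF assms(2)] by simp
  have x: "x \<sqsubseteq> x1" "x \<sqsubseteq> m" "m \<sqsubseteq> z" "m \<noteq> z" "x1 \<sqsubseteq> s" "m \<sqsubseteq> s" "m \<noteq> s"
    using assms low_hd[OF assms(1)] high_hd[OF assms(2)] low_hd[OF lm] by auto
  obtain j where j: "a \<sqsubseteq> j" "m \<sqsubseteq> j" "\<And>w. a \<sqsubseteq> w \<Longrightarrow> m \<sqsubseteq> w \<Longrightarrow> j \<sqsubseteq> w"
    using join[OF a(1) x(2) a(2) x(3)] by blast
  obtain t where t: "a \<sqsubseteq> t" "m \<sqsubseteq> t" "x1 \<sqsubseteq> t"
    using upflag[OF a(1) x(2,1) a(2) x(3) x(6,5) w(2,1)] by blast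
  have "s \<sqsubseteq> t" using low_same_level[OF assms(1) lm assms(3) t(3,2)] .
  moreover have "j \<sqsubseteq> t" "j \<sqsubseteq> z" using j(3) t a(2) x(3) by blast+
  moreover have "t \<noteq> m" using \<open>s \<sqsubseteq> t\<close> x(6,7) antisym by blast
  ultimately have "j = m" using high_noshort[of z m s r' j t] assms(2) j(2) by blast
  then show ?thesis using j(1) by simp
qed

text \<open>Seen from the low tail of \<open>q\<close>, both \<open>p\<close> and \<open>p'\<close>
  are lifts that gain a vertex, so uniqueness for the tail suffices.\<close>

lemma unique_high_aux:
  assumes "high q" "high p" "high p'" "list_all2 le q p" "list_all2 le q p'" "hd p = hd p'"
    and IH: "tl q \<noteq> [] \<Longrightarrow> lifts_low (tl q) p \<Longrightarrow> lifts_low (tl q) p' \<Longrightarrow> p = p'"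
  shows "p = p'"
proof (cases "tl q")
  case Nil
  then obtain x where "q = [x]" using assms(1) by (cases q) auto
  then show ?thesis using assms by (auto simp: list_all2_Cons1)
next
  case (Cons x r)
  then have "list_all2 le (tl q) (tl p)" "list_all2 le (tl q) (tl p')" using assms(4,5) by (cases q; auto simp: list_all2_Cons1)+
  then show ?thesis using IH assms(2,3) Cons by (auto simp: lifts_low_def)
qed

text \<open>The position of \<open>hd p\<close> relative to \<open>x1\<close> decides the kind of
  lift: above \<open>x1\<close>, bounded together with it but not above, or not even bounded. Two
  lifts with the same head are hence of the same kind.\<close>

lemma lifts_low_cases:
  assumes "low (x # x1 # r)" "lifts_low (x # x1 # r) p"
  obtains (down) "high p" "list_all2 le (x1 # r) p" "x1 \<sqsubseteq> hd p"
  | (same) s r' where "p = hd p # s # r'" "low p" "list_all2 le (x # x1 # r) p" "\<not> x1 \<sqsubseteq> hd p" "x1 \<sqsubseteq> s" "hd p \<sqsubseteq> s"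
  | (up) m s r' where "p = hd p # m # s # r'" "high p" "list_all2 le (x # x1 # r) (m # s # r')"
      "\<And>u. x1 \<sqsubseteq> u \<Longrightarrow> \<not> hd p \<sqsubseteq> u" "x \<sqsubseteq> m" "m \<sqsubseteq> hd p" "x1 \<sqsubseteq> s" "m \<sqsubseteq> s"
proof -
  consider "high p" "list_all2 le (x1 # r) p" | "low p" "list_all2 le (x # x1 # r) p" | "high p" "list_all2 le (x # x1 # r) (tl p)"
    using assms(2) by (auto simp: lifts_low_def)
  then show thesis
  proof cases
    case 1
    then show ?thesis using down by (auto simp: list_all2_Cons1)
  next
    case 2
    then obtain z s r' where p: "p = z # s # r'" "x1 \<sqsubseteq> s" by (auto simp: list_all2_Cons1)
    have zs: "z \<sqsubseteq> s" "z \<noteq> s" using low_hd[of z "s # r'"] 2(1) p by auto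
    have "\<not> x1 \<sqsubseteq> z" using low_same_level[of x x1 r z s r' z] assms(1) 2 p zs refl1 antisym by blast
    then show ?thesis using same[of s r'] 2 p zs by simp
  next
    case 3
    then obtain z m s r' where p: "p = z # m # s # r'" "x \<sqsubseteq> m" "x1 \<sqsubseteq> s" by (cases p) (auto simp: list_all2_Cons1)
    have "low (m # s # r')" using high_tl[of z] 3(1) p by auto
    then have ms: "m \<sqsubseteq> z" "z \<noteq> m" "m \<sqsubseteq> s" using high_hd[of z "m # s # r'"] low_hd[of m "s # r'"] 3(1) p by auto
    have "\<not> z \<sqsubseteq> u" if "x1 \<sqsubseteq> u" for u
      using low_next_level_unbounded[of x x1 r z m s r' u z] assms(1) 3 p that ms trans[OF p(2) ms(1)] refl2 antisym
      by (metis list.sel(3))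
    then show ?thesis using up[of m s r'] 3 p ms by simp
  qed
qed

lemma unique_low:
  assumes "low p" "lifts_low p p'" "lifts_low p p''" "hd p' = hd p''"
  shows "p' = p''"
  using assms
proof (induction "length p" arbitrary: p p' p'' rule: less_induct)
  case less
  obtain x q where p: "p = x # q" using less.prems(1) by (cases p) auto
  show ?case
  proof (cases q)
    case Nil
    then have xy: "x = y" "e" using less.prems p by auto
    have "p1 = (if hd p1 = y then [y] else [hd p1, y])" if p1: "lifts_low [y] p1" for p1
    proof -
      consider "low p1" "list_all2 le [y] p1" | "high p1" "list_all2 le [y] (tl p1)"
        using p1 unfolding lifts_low_def list.sel by fastforce
      then show ?thesis
      proof cases
        case 1
        then show ?thesis by (auto simp: list_all2_Cons1)
      next
        case 2
        then obtain z w where "p1 = [z, w]" by (cases p1) (auto simp: list_all2_Cons1)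
        then show ?thesis using 2 by (auto simp: slt_def)
      qed
    qed
    then show ?thesis using less.prems p Nil xy by metis
  next
    case (Cons x1 r)
    have q: "high q" using low_tl[of x q] less.prems(1) p Cons by auto
    have UH: "p1 = p2" if "high p1" "high p2" "list_all2 le q p1" "list_all2 le q p2" "hd p1 = hd p2" for p1 p2
    proof (rule unique_high_aux[OF q that])
      assume "tl q \<noteq> []" "lifts_low (tl q) p1" "lifts_low (tl q) p2"
      moreover have "low (tl q)" using high_tl[of x1 r] q Cons calculation by simp
      ultimately show "p1 = p2" using less.hyps[of "tl q" p1 p2] that(5) p Cons by simp
    qed
    have low': "low (x # x1 # r)" using less.prems(1) p Cons by simp
    have UL: "p1 = p2" if lo: "low p1" "low p2" and rel: "list_all2 le p p1" "list_all2 le p p2" and h: "hd p1 = hd p2" for p1 p2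
    proof -
      obtain z s1 r1 where p1: "p1 = z # s1 # r1" using rel p Cons by (auto simp: list_all2_Cons1)
      obtain s2 r2 where p2: "p2 = z # s2 # r2" using rel p Cons h p1 by (auto simp: list_all2_Cons1)
      have "x1 \<sqsubseteq> s1" "x1 \<sqsubseteq> s2" using rel p Cons p1 p2 by auto
      moreover have "z \<sqsubseteq> s1" "z \<sqsubseteq> s2" using low_hd[of z "s1 # r1"] low_hd[of z "s2 # r2"] lo p1 p2 by auto
      ultimately have "s1 = s2"
        using low_same_level[OF low', of z s1 r1 s2] low_same_level[OF low', of z s2 r2 s1] lo rel p Cons p1 p2 antisym by blast
      then show ?thesis
        using UH[of "s1 # r1" "s2 # r2"] low_tl[of z] lo rel p p1 p2 by auto
    qed
    show ?thesis
      using low' less.prems(2)[unfolded p Cons]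
    proof (cases rule: lifts_low_cases)
      case down1: down
      show ?thesis using low' less.prems(3)[unfolded p Cons]
      proof (cases rule: lifts_low_cases)
        case down then show ?thesis using down1 UH[of p' p''] Cons less.prems(4) by blast
      next
        case same then show ?thesis using down1 less.prems(4) by simp
      next
        case up then show ?thesis using down1 less.prems(4) refl2 by metis
      qed
    next
      case same1: same
      show ?thesis using low' less.prems(3)[unfolded p Cons]
      proof (cases rule: lifts_low_cases)
        case down then show ?thesis using same1 less.prems(4) by simp
      next
        case same then show ?thesis using same1 UL[of p' p''] p Cons less.prems(4) by blast
      next
        case up then show ?thesis using same1 less.prems(4) by metis
      qed
    next
      case up1: (up m1 s1 r1)
      show ?thesis using low' less.prems(3)[unfolded p Cons]
      proof (cases rule: lifts_low_cases)
        case down then show ?thesis using up1 less.prems(4) refl2 by metis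
      next
        case same then show ?thesis using up1 less.prems(4) by metis
      next
        case (up m2 s2 r2)
        have h: "high (hd p' # m1 # s1 # r1)" "high (hd p' # m2 # s2 # r2)" using up up1 less.prems(4) by metis+
        have "m1 \<sqsubseteq> m2"
          using low_next_level_unbounded[OF low' h(2) up(3) up1(7) up1(8) up1(5) up1(6)] .
        moreover have "m2 \<sqsubseteq> m1"
          using low_next_level_unbounded[OF low' h(1) up1(3) up(7) up(8) up(5)] up(6) less.prems(4) by simp
        ultimately have "m1 = m2" by (rule antisym)
        then have "m1 # s1 # r1 = m2 # s2 # r2"
          using UL[of "m1 # s1 # r1" "m2 # s2 # r2"] high_tl[OF h(1)] high_tl[OF h(2)] up(3) up1(3) p Cons by simp
        then show ?thesis using up(1) up1(1) less.prems(4) by metis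
      qed
    qed
  qed
qed

lemma unique_high:
  assumes "high q" "high p" "high p'" "list_all2 le q p" "list_all2 le q p'" "hd p = hd p'"
  shows "p = p'"
proof (rule unique_high_aux[OF assms])
  assume a: "tl q \<noteq> []" "lifts_low (tl q) p" "lifts_low (tl q) p'"
  then have "low (tl q)" using high_tl[of "hd q" "tl q"] assms(1) by (cases q) auto
  then show "p = p'" using unique_low a assms(6) by blast
qed

end

section \<open>Normal forms as a covering of the poset\<close>

context based_flag_poset
begin

definition zigzag :: "'v list \<Rightarrow> bool" where
  "zigzag p \<longleftrightarrow> low p \<or> high p"

text \<open>Transport along \<open>hd p \<sqsubseteq> hd p'\<close>, in a form that is symmetric
  under duality. The length changes only when the lower head is a minimum and the upper one a
  maximum of its zigzag, and then by one in either direction.\<close>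

definition rel :: "'v list \<Rightarrow> 'v list \<Rightarrow> bool" where
  "rel p p' \<longleftrightarrow> zigzag p \<and> zigzag p' \<and> (list_all2 le p p' \<or>
     low p \<and> high p' \<and> (list_all2 le (tl p) p' \<or> list_all2 le p (tl p')))"

lemma converse_rel: "based_flag_poset.rel le\<inverse>\<inverse> y (\<not> e) p p' \<longleftrightarrow> rel p' p"
  unfolding rel_def zigzag_def based_flag_poset.rel_def[OF converse_based]
    based_flag_poset.zigzag_def[OF converse_based] list.rel_conversep
  by auto

lemma converse_zigzag: "based_flag_poset.zigzag le\<inverse>\<inverse> y (\<not> e) p \<longleftrightarrow> zigzag p"
  unfolding zigzag_def based_flag_poset.zigzag_def[OF converse_based] by auto

lemma rel_low:
  assumes "low p"
  shows "rel p p' \<longleftrightarrow> lifts_low p p'"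
proof -
  have "low p'" if "high p' \<or> low p'" "list_all2 le p p'"
    using that assms list_all2_lengthD[OF that(2)] normal_form_parity[of le y e p]
      normal_form_parity[of "le\<inverse>\<inverse>" y "\<not> e" p'] by auto
  then show ?thesis using assms unfolding rel_def lifts_low_def zigzag_def by blast
qed

lemma rel_high:
  assumes "high p"
  shows "rel p p' \<longleftrightarrow> high p' \<and> list_all2 le p p'"
proof -
  have "high p'" if "high p' \<or> low p'" "list_all2 le p p'"
    using that assms list_all2_lengthD[OF that(2)] normal_form_parity[of "le\<inverse>\<inverse>" y "\<not> e" p]
      normal_form_parity[of le y e p'] by auto
  then show ?thesis using assms low_high_disjoint unfolding rel_def zigzag_def by blast
qed

lemma zigzag_tl: "zigzag (x # q) \<Longrightarrow> q \<noteq> [] \<Longrightarrow> zigzag q"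
  unfolding zigzag_def using low_tl high_tl by blast

lemma zigzag_carrier: "zigzag p \<Longrightarrow> x \<in> set p \<Longrightarrow> x \<sqsubseteq> x"
proof (induction p)
  case (Cons z q)
  show ?case
  proof (cases q)
    case Nil
    then have "x = y" using Cons.prems by (auto simp: zigzag_def)
    then show ?thesis using y_refl by simp
  next
    case (Cons x1 r)
    then have "z \<sqsubseteq> z" using Cons.prems(1) low_hd[of z q] high_hd[of z q] refl1 refl2 by (auto simp: zigzag_def)
    then show ?thesis using Cons.prems Cons.IH zigzag_tl[OF Cons.prems(1)] Cons by auto
  qed
qed simp

lemma rel_refl:
  assumes "zigzag p"
  shows "rel p p"
proof -
  have "list_all2 le p p" using zigzag_carrier[OF assms] by (auto simp: list_all2_same)
  then show ?thesis using assms unfolding rel_def by blast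
qed

lemma rel_hd:
  assumes "rel p p'"
  shows "hd p \<sqsubseteq> hd p'"
proof -
  have hd_mono: "hd q \<sqsubseteq> hd q'" if "list_all2 le q q'" "q \<noteq> []" for q q'
    using that by (cases q; cases q') auto
  have ne: "p \<noteq> []" "p' \<noteq> []" using assms by (auto simp: rel_def zigzag_def)
  consider "list_all2 le p p'" | "low p" "list_all2 le (tl p) p'" | "high p'" "list_all2 le p (tl p')"
    using assms unfolding rel_def by blast
  then show ?thesis
  proof cases
    case 1 then show ?thesis using hd_mono ne by blast
  next
    case 2
    then have t: "tl p \<noteq> []" using ne by auto
    then have "hd p \<sqsubseteq> hd (tl p)" using low_hd[of "hd p" "tl p"] 2(1) ne by simp
    then show ?thesis using hd_mono[OF 2(2) t] trans by blast
  next
    case 3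
    then have t: "tl p' \<noteq> []" using ne by auto
    then have "hd (tl p') \<sqsubseteq> hd p'" using high_hd[of "hd p'" "tl p'"] 3(1) ne by simp
    then show ?thesis using hd_mono[OF 3(2) ne(1)] trans by blast
  qed
qed

text \<open>A high zigzag stays high and keeps its length when it moves up, so the length changes at
  most once along an ascending chain.\<close>

lemma rel_trans:
  assumes "rel p p'" "rel p' p''"
  shows "rel p p''"
proof -
  have tr: "list_all2 le a c" if "list_all2 le a b" "list_all2 le b c" for a b c
    using list_all2_trans[OF _ that, of le] trans by blast
  have tl: "list_all2 le (tl a) (tl b)" if "list_all2 le a b" for a b
    using that by (cases a; cases b) auto
  have U: "zigzag p" "zigzag p'" "zigzag p''" using assms by (auto simp: rel_def)
  show ?thesis
  proof (cases "high p")
    case True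
    have "high p'" "list_all2 le p p'" using assms(1) unfolding rel_high[OF True] by auto
    moreover have "high p''" "list_all2 le p' p''" using assms(2) unfolding rel_high[OF calculation(1)] by auto
    ultimately show ?thesis using tr unfolding rel_high[OF True] by blast
  next
    case False
    then have lp: "low p" using U by (simp add: zigzag_def)
    show ?thesis
    proof (cases "low p'")
      case True
      then have "\<not> high p'" using low_high_disjoint by blast
      then have pp': "list_all2 le p p'" using assms(1) unfolding rel_low[OF lp] lifts_low_def by simp
      consider "high p''" "list_all2 le (tl p') p''" | "low p''" "list_all2 le p' p''"
        | "high p''" "list_all2 le p' (tl p'')"
        using assms(2) unfolding rel_low[OF True] lifts_low_def by argo
      then show ?thesis
        unfolding rel_low[OF lp] lifts_low_def using tr[OF tl[OF pp']] tr[OF pp'] by cases simp_all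
    next
      case False
      then have hp: "high p'" using U by (simp add: zigzag_def)
      then show ?thesis using assms tr tl low_high_disjoint
        unfolding rel_low[OF lp] rel_high[OF hp] lifts_low_def by blast
    qed
  qed
qed

lemma lift_up:
  assumes "zigzag p" "hd p \<sqsubseteq> z"
  shows "\<exists>p'. rel p p' \<and> hd p' = z"
  using assms lift_low[of p z] lift_high[of p z] rel_low rel_high unfolding zigzag_def by metis

lemma unique_up:
  assumes "rel p p'" "rel p p''" "hd p' = hd p''"
  shows "p' = p''"
proof -
  have "low p \<or> high p" using assms(1) by (auto simp: rel_def zigzag_def)
  then show ?thesis
  proof
    assume p: "low p"
    show ?thesis using unique_low[OF p _ _ assms(3)] assms(1,2) unfolding rel_low[OF p] by blast
  next
    assume p: "high p"
    show ?thesis using unique_high[OF p _ _ _ _ assms(3)] assms(1,2) unfolding rel_high[OF p] by blast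
  qed
qed

lemma lift_down:
  assumes "zigzag p" "z \<sqsubseteq> hd p"
  shows "\<exists>p'. rel p' p \<and> hd p' = z"
  using based_flag_poset.lift_up[OF converse_based, of p z] assms
  by (simp add: converse_rel converse_zigzag)

lemma unique_down:
  assumes "rel p' p" "rel p'' p" "hd p' = hd p''"
  shows "p' = p''"
  using based_flag_poset.unique_up[OF converse_based, of p p' p''] assms by (simp add: converse_rel)

definition conn :: "'v list \<Rightarrow> 'v list \<Rightarrow> bool" where
  "conn p p' \<longleftrightarrow> rel p p' \<or> rel p' p"

lemma converse_conn: "based_flag_poset.conn le\<inverse>\<inverse> y (\<not> e) p p' \<longleftrightarrow> conn p p'"
  unfolding conn_def based_flag_poset.conn_def[OF converse_based] converse_rel by blast

lemma conn_zigzag: "conn p p' \<Longrightarrow> zigzag p \<and> zigzag p'"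
  by (auto simp: conn_def rel_def)

lemma conn_refl: "zigzag p \<Longrightarrow> conn p p"
  by (simp add: conn_def rel_refl)

lemma conn_sym: "conn p p' \<Longrightarrow> conn p' p"
  by (auto simp: conn_def)

lemma conn_hd: "conn p p' \<Longrightarrow> hd p \<sqsubseteq> hd p' \<or> hd p' \<sqsubseteq> hd p"
  using rel_hd by (auto simp: conn_def)

lemma conn_lift:
  assumes "zigzag p" "hd p \<sqsubseteq> z \<or> z \<sqsubseteq> hd p"
  shows "\<exists>p'. conn p p' \<and> hd p' = z"
  using assms lift_up lift_down unfolding conn_def by metis

lemma conn_unique:
  assumes "conn p p'" "conn p p''" "hd p' = hd p''"
  shows "p' = p''"
proof -
  \<comment> \<open>An upward and a downward lift with the same head have the head of
    \<open>p\<close>, by antisymmetry, and both are then \<open>p\<close>.\<close>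
  have *: "a = b" if "rel p a" "rel b p" "hd a = hd b" for a b
  proof -
    have "hd a = hd p" using rel_hd[OF that(1)] rel_hd[OF that(2)] that(3) antisym by metis
    moreover have "rel p p" using that(1) rel_refl by (simp add: rel_def)
    ultimately have "a = p" "b = p" using unique_up[OF that(1), of p] unique_down[OF that(2), of p] that(3) by metis+
    then show ?thesis by simp
  qed
  show ?thesis using assms unique_up unique_down *[of p' p''] *[of p'' p'] unfolding conn_def by metis
qed

text \<open>Lift \<open>p1\<close> to \<open>hd p3\<close> and from there to \<open>hd p2\<close>.
  Uniqueness upwards identifies the last list with \<open>p2\<close>, and uniqueness downwards the
  middle one with \<open>p3\<close>.\<close>

lemma rel_peak:
  assumes "rel p1 p2" "rel p3 p2" "hd p1 \<sqsubseteq> hd p3"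
  shows "rel p1 p3"
proof -
  obtain q where q: "rel p1 q" "hd q = hd p3" using lift_up[of p1 "hd p3"] assms by (auto simp: rel_def)
  obtain q' where q': "rel q q'" "hd q' = hd p2" using lift_up[of q "hd p2"] q rel_hd[OF assms(2)] by (auto simp: rel_def)
  have "q' = p2" using unique_up[OF rel_trans[OF q(1) q'(1)] assms(1) q'(2)] .
  then have "q = p3" using unique_down[of q p2 p3] q' q assms(2) by simp
  then show ?thesis using q(1) by simp
qed

lemma rel_valley:
  assumes "rel p2 p1" "rel p2 p3" "hd p3 \<sqsubseteq> hd p1"
  shows "rel p3 p1"
  using based_flag_poset.rel_peak[OF converse_based, of p1 p2 p3] assms by (simp add: converse_rel)

lemma conn_triangle:
  assumes "conn p1 p2" "conn p2 p3" "hd p1 \<sqsubseteq> hd p3 \<or> hd p3 \<sqsubseteq> hd p1"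
  shows "conn p1 p3"
proof -
  consider "rel p1 p2" "rel p2 p3" | "rel p2 p1" "rel p3 p2" | "rel p1 p2" "rel p3 p2" | "rel p2 p1" "rel p2 p3"
    using assms(1,2) unfolding conn_def by blast
  then show ?thesis
  proof cases
    case 1 then show ?thesis using rel_trans unfolding conn_def by blast
  next
    case 2 then show ?thesis using rel_trans unfolding conn_def by blast
  next
    case 3 then show ?thesis using rel_peak assms(3) unfolding conn_def by blast
  next
    case 4 then show ?thesis using rel_valley assms(3) unfolding conn_def by blast
  qed
qed

lemma zigzag_base: "zigzag [y]"
  unfolding zigzag_def by simp

text \<open>Dropping the head is the transport along the first edge of the path itself. Iterated, it
  connects every normal form to \<open>[y]\<close>, so the covering is connected.\<close>

lemma conn_tl:
  assumes "zigzag (x # q)" "q \<noteq> []"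
  shows "conn (x # q) q"
proof -
  have q: "list_all2 le q q" using zigzag_carrier[OF zigzag_tl[OF assms]] by (auto simp: list_all2_same)
  show ?thesis using assms q low_tl[of x q] high_tl[of x q]
    unfolding zigzag_def conn_def rel_def by auto
qed

lemma conn_rtrancl_base: "zigzag p \<Longrightarrow> conn\<^sup>*\<^sup>* p [y]"
proof (induction p)
  case Nil then show ?case by (simp add: zigzag_def)
next
  case (Cons x q)
  show ?case
  proof (cases "q = []")
    case True
    then have "x = y" using Cons.prems by (auto simp: zigzag_def)
    then show ?thesis using True by simp
  next
    case False
    then show ?thesis using conn_tl[OF Cons.prems False] Cons.IH[OF zigzag_tl[OF Cons.prems False]]
      by (meson converse_rtranclp_into_rtranclp)
  qed
qed

text \<open>The domination needed for dismantling, with \<open>x1\<close> as the target of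
  \<open>x\<close>. A neighbour below \<open>x\<close> lies below \<open>x1\<close>. One above
  \<open>x\<close> with a shorter normal form lies above \<open>x1\<close>, since its transport has
  dropped \<open>x\<close>.\<close>

lemma low_dominated:
  assumes "low (x # x1 # r)" "conn (x # x1 # r) p"
    and "length p < length (x # x1 # r) \<or> length p = length (x # x1 # r) \<and> hd p \<sqsubseteq> x"
  shows "hd p \<sqsubseteq> x1 \<or> x1 \<sqsubseteq> hd p"
proof -
  have x: "x \<sqsubseteq> x1" using low_hd[OF assms(1)] by simp
  show ?thesis
  proof (cases "rel (x # x1 # r) p")
    case True
    then have "lifts_low (x # x1 # r) p" using rel_low[OF assms(1)] by simp
    then consider "list_all2 le (x1 # r) p" | "list_all2 le (x # x1 # r) p" | "list_all2 le (x # x1 # r) (tl p)"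
      unfolding lifts_low_def by auto
    then show ?thesis
    proof cases
      case 1 then show ?thesis by (auto simp: list_all2_Cons1)
    next
      case 2
      then have "hd p \<sqsubseteq> x" using assms(3) list_all2_lengthD[OF 2] by auto
      then show ?thesis using x trans by blast
    next
      case 3
      then show ?thesis using assms(3) list_all2_lengthD[OF 3] by auto
    qed
  next
    case False
    then have "hd p \<sqsubseteq> x" using assms(2) rel_hd[of p "x # x1 # r"] by (simp add: conn_def)
    then show ?thesis using x trans by blast
  qed
qed

lemma high_dominated:
  assumes "high (x # x1 # r)" "conn (x # x1 # r) p"
    and "length p < length (x # x1 # r) \<or> length p = length (x # x1 # r) \<and> x \<sqsubseteq> hd p"
  shows "hd p \<sqsubseteq> x1 \<or> x1 \<sqsubseteq> hd p"
  using based_flag_poset.low_dominated[OF converse_based, of x x1 r p] assms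
  by (auto simp: converse_conn)

end

subsection \<open>Locally convex subposets\<close>

definition restrict_le :: "'v set \<Rightarrow> ('v \<Rightarrow> 'v \<Rightarrow> bool) \<Rightarrow> 'v \<Rightarrow> 'v \<Rightarrow> bool" where
  "restrict_le W le x y \<longleftrightarrow> x \<in> W \<and> y \<in> W \<and> le x y"

lemma restrict_le_converse: "(restrict_le W le)\<inverse>\<inverse> = restrict_le W le\<inverse>\<inverse>"
  by (auto simp: fun_eq_iff restrict_le_def)

text \<open>Local convexity in terms of the order alone. The extremality clauses range only over the
  elements strictly above or strictly below \<open>y\<close>, because tightness is measured in a
  link of \<open>y\<close>.\<close>

locale convex_subposet = flag_poset +
  fixes W :: "'v set"
  assumes W_carrier: "x \<in> W \<Longrightarrow> x \<sqsubseteq> x"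
    and join_up: "\<lbrakk>y \<in> W; a \<in> W; b \<in> W; slt le y a; slt le y b; a \<sqsubseteq> j; b \<sqsubseteq> j;
      \<And>w. slt le y w \<Longrightarrow> a \<sqsubseteq> w \<Longrightarrow> b \<sqsubseteq> w \<Longrightarrow> j \<sqsubseteq> w\<rbrakk> \<Longrightarrow> j \<in> W"
    and meet_up: "\<lbrakk>y \<in> W; a \<in> W; b \<in> W; slt le y a; slt le y b; slt le y j; j \<sqsubseteq> a; j \<sqsubseteq> b;
      \<And>w. slt le y w \<Longrightarrow> w \<sqsubseteq> a \<Longrightarrow> w \<sqsubseteq> b \<Longrightarrow> w \<sqsubseteq> j\<rbrakk> \<Longrightarrow> j \<in> W"
    and meet_down: "\<lbrakk>y \<in> W; a \<in> W; b \<in> W; slt le a y; slt le b y; j \<sqsubseteq> a; j \<sqsubseteq> b;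
      \<And>w. slt le w y \<Longrightarrow> w \<sqsubseteq> a \<Longrightarrow> w \<sqsubseteq> b \<Longrightarrow> w \<sqsubseteq> j\<rbrakk> \<Longrightarrow> j \<in> W"
    and join_down: "\<lbrakk>y \<in> W; a \<in> W; b \<in> W; slt le a y; slt le b y; slt le j y; a \<sqsubseteq> j; b \<sqsubseteq> j;
      \<And>w. slt le w y \<Longrightarrow> a \<sqsubseteq> w \<Longrightarrow> b \<sqsubseteq> w \<Longrightarrow> j \<sqsubseteq> w\<rbrakk> \<Longrightarrow> j \<in> W"
    and zig_down: "\<lbrakk>y \<in> W; a1 \<in> W; a4 \<in> W; slt le a1 y; slt le a2 y; slt le a3 y; slt le a4 y;
      slt le a1 a2; slt le a3 a2; slt le a3 a4;
      \<And>w. slt le w y \<Longrightarrow> a1 \<sqsubseteq> w \<Longrightarrow> a3 \<sqsubseteq> w \<Longrightarrow> a2 \<sqsubseteq> w;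
      \<And>w. slt le w y \<Longrightarrow> w \<sqsubseteq> a2 \<Longrightarrow> w \<sqsubseteq> a4 \<Longrightarrow> w \<sqsubseteq> a3\<rbrakk> \<Longrightarrow> a2 \<in> W \<and> a3 \<in> W"
    and zig_up: "\<lbrakk>y \<in> W; a1 \<in> W; a4 \<in> W; slt le y a1; slt le y a2; slt le y a3; slt le y a4;
      slt le a2 a1; slt le a2 a3; slt le a4 a3;
      \<And>w. slt le y w \<Longrightarrow> w \<sqsubseteq> a1 \<Longrightarrow> w \<sqsubseteq> a3 \<Longrightarrow> w \<sqsubseteq> a2;
      \<And>w. slt le y w \<Longrightarrow> a2 \<sqsubseteq> w \<Longrightarrow> a4 \<sqsubseteq> w \<Longrightarrow> a3 \<sqsubseteq> w\<rbrakk> \<Longrightarrow> a2 \<in> W \<and> a3 \<in> W"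
begin

lemma slt_converse: "slt le\<inverse>\<inverse> a b \<longleftrightarrow> slt le b a"
  by (auto simp: slt_def)

lemma converse_convex: "convex_subposet le\<inverse>\<inverse> W"
proof (intro convex_subposet.intro[OF converse] convex_subposet_axioms.intro, unfold conversep_iff slt_converse, goal_cases)
  case (1 x) then show ?case by (rule W_carrier)
next
  case (2 y a b j) then show ?case by (rule meet_down)
next
  case (3 y a b j) then show ?case by (rule join_down)
next
  case (4 y a b j) then show ?case by (rule join_up)
next
  case (5 y a b j) then show ?case by (rule meet_up)
next
  case (6 y a1 a4 a2 a3) then show ?case by (rule zig_up)
next
  case (7 y a1 a4 a2 a3) then show ?case by (rule zig_down)
qed

lemma join_in_W:
  assumes "l \<in> W" "a \<in> W" "b \<in> W" "l \<sqsubseteq> a" "l \<sqsubseteq> b" "a \<sqsubseteq> u" "b \<sqsubseteq> u"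
  shows "\<exists>j\<in>W. a \<sqsubseteq> j \<and> b \<sqsubseteq> j \<and> (\<forall>w. a \<sqsubseteq> w \<and> b \<sqsubseteq> w \<longrightarrow> j \<sqsubseteq> w)"
proof -
  consider "l = a" | "l = b" | "l \<noteq> a" "l \<noteq> b" by blast
  then show ?thesis
  proof cases
    case 1 then show ?thesis using assms W_carrier by blast
  next
    case 2 then show ?thesis using assms W_carrier by blast
  next
    case 3
    obtain j where j: "a \<sqsubseteq> j" "b \<sqsubseteq> j" "\<And>w. a \<sqsubseteq> w \<Longrightarrow> b \<sqsubseteq> w \<Longrightarrow> j \<sqsubseteq> w"
      using join[OF assms(4-7)] by blast
    have "j \<in> W" using assms 3 j by (intro join_up[of l a b j]) (auto simp: slt_def)
    then show ?thesis using j by blast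
  qed
qed

text \<open>The common bound \<open>t\<close> need not lie in \<open>W\<close>; it only guarantees
  the existence of two successive joins, which do.\<close>

lemma upflag_in_W:
  assumes "l \<in> W" "a \<in> W" "b \<in> W" "c \<in> W" "l \<sqsubseteq> a" "l \<sqsubseteq> b" "l \<sqsubseteq> c" "a \<sqsubseteq> u" "b \<sqsubseteq> u" "b \<sqsubseteq> v" "c \<sqsubseteq> v" "a \<sqsubseteq> w" "c \<sqsubseteq> w"
  shows "\<exists>t\<in>W. a \<sqsubseteq> t \<and> b \<sqsubseteq> t \<and> c \<sqsubseteq> t"
proof -
  obtain t where t: "a \<sqsubseteq> t" "b \<sqsubseteq> t" "c \<sqsubseteq> t" using upflag[OF assms(5-)] by blast
  obtain j where j: "j \<in> W" "a \<sqsubseteq> j" "b \<sqsubseteq> j" "j \<sqsubseteq> t" using join_in_W[OF assms(1-3,5,6) t(1,2)] t by blast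
  obtain k where "k \<in> W" "j \<sqsubseteq> k" "c \<sqsubseteq> k"
    using join_in_W[OF assms(1) j(1) assms(4) trans[OF assms(5) j(2)] assms(7) j(4) t(3)] by blast
  then show ?thesis using j trans by blast
qed

lemma meet_in_W:
  assumes "u \<in> W" "a \<in> W" "b \<in> W" "a \<sqsubseteq> u" "b \<sqsubseteq> u" "l \<sqsubseteq> a" "l \<sqsubseteq> b"
  shows "\<exists>j\<in>W. j \<sqsubseteq> a \<and> j \<sqsubseteq> b \<and> (\<forall>w. w \<sqsubseteq> a \<and> w \<sqsubseteq> b \<longrightarrow> w \<sqsubseteq> j)"
  using convex_subposet.join_in_W[OF converse_convex, of u a b l] assms by simp

lemma downflag_in_W:
  assumes "l \<in> W" "a \<in> W" "b \<in> W" "c \<in> W" "a \<sqsubseteq> l" "b \<sqsubseteq> l" "c \<sqsubseteq> l" "u \<sqsubseteq> a" "u \<sqsubseteq> b" "v \<sqsubseteq> b" "v \<sqsubseteq> c" "w \<sqsubseteq> a" "w \<sqsubseteq> c"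
  shows "\<exists>t\<in>W. t \<sqsubseteq> a \<and> t \<sqsubseteq> b \<and> t \<sqsubseteq> c"
  using convex_subposet.upflag_in_W[OF converse_convex, of l a b c u v w] assms by simp

lemma flag_poset_restrict: "flag_poset (restrict_le W le)"
proof (unfold_locales, unfold restrict_le_def, goal_cases)
  case 1 then show ?case using refl1 by blast
next
  case 2 then show ?case using refl2 by blast
next
  case 3 then show ?case using antisym by blast
next
  case 4 then show ?case using trans by blast
next
  case 5
  then show ?case using rank by blast
next
  case (6 l a b u) then show ?case using join_in_W[of l a b u] by blast
next
  case (7 l a b u) then show ?case using meet_in_W[of u a b l] by blast
next
  case (8 l a b c u v w) then show ?case using upflag_in_W[of l a b c u v w] by blast
next
  case (9 a l b c u v w) then show ?case using downflag_in_W[of l a b c u v w] by blast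
qed

text \<open>A shortcut in the ambient poset can be made tight without changing its ends.\<close>

lemma shortcut_restrict:
  assumes W: "x \<in> W" "x1 \<in> W" "x2 \<in> W" and x: "slt le x x1" "slt le x2 x1"
    and "shortcut le x x1 x2"
  shows "shortcut (restrict_le W le) x x1 x2"
proof -
  obtain a b where ab: "a \<sqsubseteq> x1" "a \<noteq> x1" "x \<sqsubseteq> a" "b \<sqsubseteq> a" "b \<sqsubseteq> x2"
    using assms(6) by (auto simp: shortcut_def slt_def)
  have x2: "x2 \<sqsubseteq> x1" "x2 \<noteq> x1" using x by (auto simp: slt_def)
  have lt: "slt le w x1" if "w \<sqsubseteq> v" "v \<sqsubseteq> x1" "v \<noteq> x1" for v w
    using that trans antisym unfolding slt_def by blast
  \<comment> \<open>First \<open>b\<close> is enlarged to the meet of \<open>a\<close> and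
    \<open>x2\<close>; then \<open>a\<close> is shrunk to the least bound of \<open>x\<close> and
    this meet below \<open>x1\<close>. Both turns become tight.\<close>
  obtain c where c: "c \<sqsubseteq> a" "c \<sqsubseteq> x2" "\<And>w. w \<sqsubseteq> a \<Longrightarrow> w \<sqsubseteq> x2 \<Longrightarrow> w \<sqsubseteq> c"
    using meet[OF ab(4,5,1) x2(1)] by blast
  \<comment> \<open>\<open>x\<close> and \<open>c\<close> may have no common lower bound, so their
    least upper bound below \<open>x1\<close> comes from the directedness of \<open>M\<close> and
    not from \<open>join\<close>.\<close>
  define M where "M = {w. w \<sqsubseteq> x1 \<and> x \<sqsubseteq> w \<and> c \<sqsubseteq> w}"
  have aM: "a \<in> M" using ab c by (simp add: M_def)
  have lower: "le\<inverse>\<inverse> v x" if "v \<in> M" for v using that by (simp add: M_def)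
  have dir: "\<exists>w\<in>M. le\<inverse>\<inverse> u w \<and> le\<inverse>\<inverse> v w" if uv: "u \<in> M" "v \<in> M" for u v
  proof -
    have m: "x \<sqsubseteq> u" "x \<sqsubseteq> v" "u \<sqsubseteq> x1" "v \<sqsubseteq> x1" "c \<sqsubseteq> u" "c \<sqsubseteq> v" using uv by (auto simp: M_def)
    obtain w where w: "w \<sqsubseteq> u" "w \<sqsubseteq> v" "\<And>t. t \<sqsubseteq> u \<Longrightarrow> t \<sqsubseteq> v \<Longrightarrow> t \<sqsubseteq> w" using meet[OF m(1-4)] by blast
    have "w \<in> M" using w m trans[OF w(1) m(3)] by (simp add: M_def)
    then show ?thesis using w by auto
  qed
  obtain d where d: "d \<in> M" "\<And>w. w \<in> M \<Longrightarrow> d \<sqsubseteq> w"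
    using flag_poset.directed_has_max[OF converse, of a M x] aM lower dir by (metis conversep_iff)
  have da: "d \<sqsubseteq> a" using d aM by blast
  have xd: "x \<sqsubseteq> d" "c \<sqsubseteq> d" using d by (auto simp: M_def)
  have dlt: "slt le d x1" using lt[OF da ab(1,2)] .
  have clt: "slt le c x1" using lt[OF c(1) ab(1,2)] .
  have dmin: "d \<sqsubseteq> w" if "slt le w x1" "x \<sqsubseteq> w" "c \<sqsubseteq> w" for w
    using that d by (auto simp: M_def slt_def)
  have cmax: "w \<sqsubseteq> c" if "w \<sqsubseteq> d" "w \<sqsubseteq> x2" for w
    using c(3) that trans[OF that(1) da] by blast
  have "\<exists>d c. d \<in> W \<and> c \<in> W \<and> slt le d x1 \<and> slt le c x1 \<and> x \<sqsubseteq> d \<and> c \<sqsubseteq> d \<and> c \<sqsubseteq> x2"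
  proof -
    \<comment> \<open>\<open>zig_down\<close> requires strict inequalities. If two neighbouring
      vertices coincide, the zigzag collapses to a tight path of length 2; for \<open>d = c\<close>
      it shows that \<open>x\<close> lies below \<open>x2\<close>, and then \<open>x\<close> serves
      as both inner vertices.\<close>
    consider "d = c" | "d = x" | "c = x2" | "d \<noteq> x" "c \<noteq> x2" "c \<noteq> d" by blast
    then show ?thesis
    proof cases
      case 1
      then have "x \<sqsubseteq> x2" using xd(1) c(2) trans by blast
      then show ?thesis using W x W_carrier by blast
    next
      case 2
      have "c \<in> W" using W x c xd cmax 2 by (intro meet_down[of x1 x x2 c]) auto
      then show ?thesis using 2 W clt xd c dlt by blast
    next
      case 3
      have "d \<in> W" using W x xd dmin dlt 3 by (intro join_down[of x1 x x2 d]) auto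
      then show ?thesis using 3 W clt xd c dlt by blast
    next
      case 4
      have "d \<in> W \<and> c \<in> W"
        by (rule zig_down[of x1 x x2 d c]) (use W x 4 xd c dlt clt dmin cmax in \<open>auto simp: slt_def\<close>)
      then show ?thesis using clt xd c dlt by blast
    qed
  qed
  then show ?thesis using W unfolding shortcut_def restrict_le_def slt_def by blast
qed

end

text \<open>The ambient poset offers more candidates for shortcuts, so normality there is the
  stronger property; \<open>shortcut_restrict\<close> closes the gap at each turn.\<close>

lemma normal_form_restrict:
  assumes "convex_subposet le W" "normal_form (restrict_le W le) y e p"
  shows "normal_form le y e p"
  using assms
proof (induction p arbitrary: le e)
  case (Cons x p)
  interpret convex_subposet le W by fact
  show ?case
  proof (cases p)
    case Nil then show ?thesis using Cons.prems by simp
  next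
    case (Cons x1 p1)
    have r: "normal_form (restrict_le W le\<inverse>\<inverse>) y (\<not> e) p" "slt (restrict_le W le) x x1"
      using normal_form_Cons[of "restrict_le W le" y e x p] Cons.prems Cons by (auto simp: restrict_le_converse)
    have IH: "normal_form le\<inverse>\<inverse> y (\<not> e) p" using Cons.IH[OF converse_convex r(1)] .
    have x: "slt le x x1" "x \<in> W" "x1 \<in> W" using r(2) by (auto simp: slt_def restrict_le_def)
    show ?thesis
    proof (cases p1)
      case Nil then show ?thesis using IH x Cons by simp
    next
      case (Cons x2 p2)
      have "slt (restrict_le W le\<inverse>\<inverse>) x1 x2"
        using normal_form_Cons[of "restrict_le W le\<inverse>\<inverse>" y "\<not> e" x1 p1] r(1) Cons \<open>p = x1 # p1\<close> by auto
      then have x2: "slt le x2 x1" "x2 \<in> W" by (auto simp: slt_def restrict_le_def)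
      have "\<not> shortcut (restrict_le W le) x x1 x2" using Cons.prems(2) Cons \<open>p = x1 # p1\<close> by simp
      then have "\<not> shortcut le x x1 x2" using shortcut_restrict x x2 by blast
      then show ?thesis using IH x Cons \<open>p = x1 # p1\<close> by simp
    qed
  qed
qed simp

subsection \<open>The vertex poset of a complex\<close>

text \<open>Unlike \<open>vle\<close>, it is reflexive only at vertices, which makes the vertex set
  the carrier.\<close>

definition cle :: "('v \<Rightarrow> 's::linorder) \<Rightarrow> 'v set set \<Rightarrow> 'v \<Rightarrow> 'v \<Rightarrow> bool" where
  "cle \<tau> K x y \<longleftrightarrow> x \<in> vertices K \<and> y \<in> vertices K \<and> vle \<tau> K x y"

lemma adjacent_vertices:
  assumes "abs_complex K" "adjacent K u v"
  shows "u \<in> vertices K" "v \<in> vertices K"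
  using abs_complexD(3)[OF assms(1), of "{u, v}"] assms(2) by (auto simp: adjacent_def vertices_def)

lemma slt_cle:
  assumes "abs_complex K"
  shows "slt (cle \<tau> K) x y \<longleftrightarrow> vless \<tau> K x y"
  using adjacent_vertices[OF assms, of x y]
  by (auto simp: slt_def cle_def vle_def vless_def adjacent_def)

lemma vless_asym: "vless \<tau> K x y \<Longrightarrow> \<not> vless \<tau> K y x"
  by (auto simp: vless_def)

lemma complex_of_typeD:
  assumes "complex_of_type S \<tau> K"
  shows "finite S" "abs_complex K" "v \<in> vertices K \<Longrightarrow> \<tau> v \<in> S" "adjacent K u v \<Longrightarrow> \<tau> u \<noteq> \<tau> v"
  using assms unfolding complex_of_type_def by (blast, blast, blast, blast)

lemma edge_iff_comparable:
  assumes "complex_of_type S \<tau> K"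
  shows "{x, y} \<in> K \<longleftrightarrow> cle \<tau> K x y \<or> cle \<tau> K y x"
proof (cases "x = y")
  case True
  then show ?thesis by (auto simp: cle_def vle_def vertices_def)
next
  case False
  then have "{x, y} \<in> K \<longleftrightarrow> adjacent K x y" by (simp add: adjacent_def)
  moreover have "adjacent K x y \<longleftrightarrow> vless \<tau> K x y \<or> vless \<tau> K y x"
    using complex_of_typeD(4)[OF assms, of x y]
    by (auto simp: vless_def adjacent_def insert_commute)
  moreover have "cle \<tau> K u v \<longleftrightarrow> vless \<tau> K u v" if "u \<noteq> v" for u v
    using slt_cle[OF complex_of_typeD(2)[OF assms], of \<tau> u v] that by (simp add: slt_def)
  ultimately show ?thesis using False by auto
qed

lemma type_less_if_cle: "cle \<tau> K x y \<Longrightarrow> x \<noteq> y \<Longrightarrow> \<tau> x < \<tau> y"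
  by (auto simp: cle_def vle_def vless_def)

lemma pairwise_comparable_simplex:
  assumes "complex_of_type S \<tau> K" "flag_complex K" "finite \<sigma>" "\<sigma> \<noteq> {}"
    and "\<And>u v. u \<in> \<sigma> \<Longrightarrow> v \<in> \<sigma> \<Longrightarrow> cle \<tau> K u v \<or> cle \<tau> K v u"
  shows "\<sigma> \<in> K"
proof -
  have "\<sigma> \<subseteq> vertices K" using assms(5) by (auto simp: cle_def)
  moreover have "adjacent K u v" if "u \<in> \<sigma>" "v \<in> \<sigma>" "u \<noteq> v" for u v
    using assms(5)[OF that(1,2)] that(3) edge_iff_comparable[OF assms(1), of u v] by (auto simp: adjacent_def)
  ultimately show ?thesis using assms(2-4) unfolding flag_complex_def by blast
qed

section \<open>Bowtie freeness, joins and the flag conditions\<close>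

lemma bowtie_free_cong:
  assumes "P = P'" "\<And>x y. x \<in> P \<Longrightarrow> y \<in> P \<Longrightarrow> le x y \<longleftrightarrow> le' x y"
  shows "bowtie_free P le \<longleftrightarrow> bowtie_free P' le'"
  unfolding bowtie_free_def assms(1)[symmetric] using assms(2) by (intro ball_cong refl) auto

lemma bowtie_freeD:
  assumes bf: "bowtie_free P le" and P: "x1 \<in> P" "x2 \<in> P" "y1 \<in> P" "y2 \<in> P"
    and le: "le x1 y1" "le x1 y2" "le x2 y1" "le x2 y2" "x1 \<noteq> y1" "x1 \<noteq> y2" "x2 \<noteq> y1" "x2 \<noteq> y2"
  shows "\<exists>z\<in>P. le x1 z \<and> le x2 z \<and> le z y1 \<and> le z y2"
proof -
  have "\<forall>x\<in>{x1, x2}. \<forall>y\<in>{y1, y2}. le x y \<and> x \<noteq> y" using le by simp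
  then have "\<exists>z\<in>P. \<forall>x\<in>{x1, x2}. \<forall>y\<in>{y1, y2}. le x z \<and> le z y"
    using bf[unfolded bowtie_free_def] P by blast
  then show ?thesis by auto
qed

lemma bowtie_freeI:
  assumes "\<And>x1 x2 y1 y2. \<lbrakk>x1 \<in> P; x2 \<in> P; y1 \<in> P; y2 \<in> P; le x1 y1; le x1 y2; le x2 y1; le x2 y2\<rbrakk> \<Longrightarrow>
    \<exists>z\<in>P. le x1 z \<and> le x2 z \<and> le z y1 \<and> le z y2"
  shows "bowtie_free P le"
  unfolding bowtie_free_def
proof (intro ballI impI)
  fix x1 x2 y1 y2 assume P: "x1 \<in> P" "x2 \<in> P" "y1 \<in> P" "y2 \<in> P"
    and "\<forall>x\<in>{x1, x2}. \<forall>y\<in>{y1, y2}. le x y \<and> x \<noteq> y"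
  then have "\<exists>z\<in>P. le x1 z \<and> le x2 z \<and> le z y1 \<and> le z y2" using assms[OF P] by simp
  then show "\<exists>z\<in>P. \<forall>x\<in>{x1, x2}. \<forall>y\<in>{y1, y2}. le x z \<and> le z y" by auto
qed

lemma bowtie_free_converse: "bowtie_free P le\<inverse>\<inverse> \<longleftrightarrow> bowtie_free P le"
proof -
  have "bowtie_free P le\<inverse>\<inverse>" if "bowtie_free P le" for le
    unfolding bowtie_free_def
  proof (intro ballI impI)
    fix x1 x2 y1 y2 assume P: "x1 \<in> P" "x2 \<in> P" "y1 \<in> P" "y2 \<in> P"
      and "\<forall>x\<in>{x1, x2}. \<forall>y\<in>{y1, y2}. le\<inverse>\<inverse> x y \<and> x \<noteq> y"
    then have "\<forall>x\<in>{y1, y2}. \<forall>y\<in>{x1, x2}. le x y \<and> x \<noteq> y" by auto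
    then have "\<exists>z\<in>P. \<forall>x\<in>{y1, y2}. \<forall>y\<in>{x1, x2}. le x z \<and> le z y"
      using \<open>bowtie_free P le\<close> P unfolding bowtie_free_def by blast
    then show "\<exists>z\<in>P. \<forall>x\<in>{x1, x2}. \<forall>y\<in>{y1, y2}. le\<inverse>\<inverse> x z \<and> le\<inverse>\<inverse> z y" by auto
  qed
  from this[of le] this[of "le\<inverse>\<inverse>"] show ?thesis by auto
qed

text \<open>An upper bound \<open>j\<close> of minimal rank is least: for any other bound
  \<open>w\<close>, bowtie freeness gives an upper bound below \<open>j\<close> and
  \<open>w\<close>, which equals \<open>j\<close> by minimality. Comparable \<open>a\<close> and
  \<open>b\<close> are treated apart because a bowtie needs strict inequalities.\<close>

lemma join_if_bowtie_free:
  fixes rk :: "'v \<Rightarrow> nat"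
  assumes refl2: "\<And>x y. le x y \<Longrightarrow> le y y" and antisym: "\<And>x y. le x y \<Longrightarrow> le y x \<Longrightarrow> x = y"
    and trans: "\<And>x y z. le x y \<Longrightarrow> le y z \<Longrightarrow> le x z"
    and rk: "\<And>x y. le x y \<Longrightarrow> x \<noteq> y \<Longrightarrow> rk x < rk y"
    and bf: "bowtie_free {w. le l w} le"
    and bounds: "le l a" "le l b" "le a u" "le b u"
  shows "\<exists>j. le a j \<and> le b j \<and> (\<forall>w. le a w \<and> le b w \<longrightarrow> le j w)"
proof -
  consider "le a b" | "le b a" | "\<not> le a b" "\<not> le b a" by blast
  then show ?thesis
  proof cases
    case 1 then show ?thesis using refl2 by blast
  next
    case 2 then show ?thesis using refl2 by blast
  next
    case 3
    obtain j where j: "le a j" "le b j" "\<And>w. le a w \<Longrightarrow> le b w \<Longrightarrow> rk j \<le> rk w"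
      using ex_has_least_nat[of "\<lambda>w. le a w \<and> le b w" u rk] bounds by blast
    have "le j w" if w: "le a w" "le b w" for w
    proof -
      have ne: "a \<noteq> j" "a \<noteq> w" "b \<noteq> j" "b \<noteq> w" using 3 j w by auto
      have P: "le l j" "le l w" using bounds j w trans by blast+
      then obtain z where z: "le a z" "le b z" "le z j" "le z w"
        using bowtie_freeD[OF bf, of a b j w] bounds(1,2) j(1,2) w ne by auto
      then show ?thesis using j(3)[OF z(1,2)] rk[OF z(3)] by (metis not_le)
    qed
    then show ?thesis using j by blast
  qed
qed

text \<open>The vertex whose upper or lower set carries the hypothesis reappears in
  \<open>flag_poset\<close> as a common bound of the elements involved. The rank counts the smaller
  types.\<close>

lemma flag_poset_if_C_tilde_like:
  assumes type: "complex_of_type S \<tau> K" and C: "C_tilde_like \<tau> K"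
  shows "flag_poset (cle \<tau> K)"
proof -
  let ?le = "cle \<tau> K"
  have po: "partial_order_on (vertices K) {(x, y). x \<in> vertices K \<and> y \<in> vertices K \<and> vle \<tau> K x y}"
    using C by (simp add: C_tilde_like_def)
  have rfl: "?le x x" if "x \<in> vertices K" for x using that by (simp add: cle_def vle_def)
  have refl2: "?le y y" if "?le x y" for x y using that rfl by (simp add: cle_def)
  have refl1: "?le x x" if "?le x y" for x y using that rfl by (simp add: cle_def)
  have antisym: "x = y" if "?le x y" "?le y x" for x y
    using po that unfolding partial_order_on_def antisym_def cle_def by blast
  have trans: "?le x z" if "?le x y" "?le y z" for x y z
    using po that unfolding partial_order_on_def preorder_on_def trans_def cle_def by blast
  define rk where "rk x = card {s \<in> S. s < \<tau> x}" for x
  have fin: "finite S" using complex_of_typeD(1)[OF type] .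
  have rk: "rk x < rk y \<and> rk y \<le> card S" if "?le x y" "x \<noteq> y" for x y
  proof -
    have "\<tau> x < \<tau> y" "\<tau> x \<in> S" using type_less_if_cle[OF that] complex_of_typeD(3)[OF type] that by (auto simp: cle_def)
    then have "{s \<in> S. s < \<tau> x} \<subset> {s \<in> S. s < \<tau> y}" by auto
    then show ?thesis unfolding rk_def using fin by (auto intro: psubset_card_mono card_mono)
  qed
  have rk': "card S - rk x < card S - rk y" if "?le\<inverse>\<inverse> x y" "x \<noteq> y" for x y
    using rk[of y x] that by auto
  have up: "{w \<in> vertices K. vle \<tau> K l w} = {w. ?le l w}"
    and down: "{w \<in> vertices K. vle \<tau> K w l} = {w. ?le w l}" if "l \<in> vertices K" for l
    using that by (auto simp: cle_def)
  have Cl: "bowtie_free {w. ?le l w} (vle \<tau> K)" "upward_flag {w. ?le l w} (vle \<tau> K)"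
    "bowtie_free {w. ?le w l} (vle \<tau> K)" "downward_flag {w. ?le w l} (vle \<tau> K)" if l: "l \<in> vertices K" for l
    using C l unfolding C_tilde_like_def up[OF l, symmetric] down[OF l, symmetric] by blast+
  have bf_up: "bowtie_free {w. ?le l w} ?le" if "l \<in> vertices K" for l
    using Cl(1)[OF that] by (rule bowtie_free_cong[THEN iffD1, rotated 2]) (auto simp: cle_def)
  have "bowtie_free {w. ?le w l} ?le" if "l \<in> vertices K" for l
    using Cl(3)[OF that] by (rule bowtie_free_cong[THEN iffD1, rotated 2]) (auto simp: cle_def)
  then have bf_down: "bowtie_free {w. ?le\<inverse>\<inverse> l w} ?le\<inverse>\<inverse>" if "l \<in> vertices K" for l
    unfolding bowtie_free_converse conversep_iff using that .
  show ?thesis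
  proof (unfold_locales, goal_cases)
    case 1 then show ?case by (rule refl1)
  next
    case 2 then show ?case by (rule refl2)
  next
    case 3 then show ?case by (rule antisym)
  next
    case 4 then show ?case by (rule trans)
  next
    case 5
    show ?case by (intro exI[of _ rk] exI[of _ "card S"]) (use rk in blast)
  next
    case (6 l a b u)
    have "l \<in> vertices K" using 6 by (simp add: cle_def)
    show ?case
    proof (rule join_if_bowtie_free[where rk = rk and l = l and u = u])
      show "bowtie_free {w. ?le l w} ?le" using bf_up \<open>l \<in> vertices K\<close> .
      show "?le x z" if "?le x y" "?le y z" for x y z using that by (rule trans)
    qed (use 6 rk refl2 antisym in auto)
  next
    case (7 l a b u)
    have "u \<in> vertices K" using 7 by (simp add: cle_def)
    have "\<exists>j. ?le\<inverse>\<inverse> a j \<and> ?le\<inverse>\<inverse> b j \<and> (\<forall>w. ?le\<inverse>\<inverse> a w \<and> ?le\<inverse>\<inverse> b w \<longrightarrow> ?le\<inverse>\<inverse> j w)"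
    proof (rule join_if_bowtie_free[where rk = "\<lambda>x. card S - rk x" and l = u and u = l])
      show "bowtie_free {w. ?le\<inverse>\<inverse> u w} ?le\<inverse>\<inverse>" using bf_down \<open>u \<in> vertices K\<close> .
      show "?le\<inverse>\<inverse> x z" if "?le\<inverse>\<inverse> x y" "?le\<inverse>\<inverse> y z" for x y z using that trans by blast
    qed (use 7 rk' refl1 antisym in auto)
    then show ?case by simp
  next
    case (8 l a b c u v w)
    then have l: "l \<in> vertices K" by (simp add: cle_def)
    have "bounded_above_in {w. ?le l w} (vle \<tau> K) {x, y}" if "?le x z" "?le y z" "?le l x" for x y z
      unfolding bounded_above_in_def
      using that trans[OF that(3,1)] by (intro bexI[of _ z]) (auto simp: cle_def)
    then have "bounded_above_in {w. ?le l w} (vle \<tau> K) {a, b}" "bounded_above_in {w. ?le l w} (vle \<tau> K) {b, c}"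
      "bounded_above_in {w. ?le l w} (vle \<tau> K) {a, c}"
      using 8 by blast+
    then have "bounded_above_in {w. ?le l w} (vle \<tau> K) {a, b, c}"
      using Cl(2)[OF l] 8(1-3) unfolding upward_flag_def by blast
    then show ?case using 8 unfolding bounded_above_in_def by (auto simp: cle_def)
  next
    case (9 a l b c u v w)
    then have l: "l \<in> vertices K" by (simp add: cle_def)
    have "bounded_below_in {w. ?le w l} (vle \<tau> K) {x, y}" if "?le z x" "?le z y" "?le x l" for x y z
      unfolding bounded_below_in_def
      using that trans[OF that(1,3)] by (intro bexI[of _ z]) (auto simp: cle_def)
    then have "bounded_below_in {w. ?le w l} (vle \<tau> K) {a, b}" "bounded_below_in {w. ?le w l} (vle \<tau> K) {b, c}"
      "bounded_below_in {w. ?le w l} (vle \<tau> K) {a, c}"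
      using 9 by blast+
    then have "bounded_below_in {w. ?le w l} (vle \<tau> K) {a, b, c}"
      using Cl(4)[OF l] 9(1-3) unfolding downward_flag_def by blast
    then show ?case using 9 unfolding bounded_below_in_def by (auto simp: cle_def)
  qed
qed

lemma C_tilde_like_if_flag_poset:
  assumes "flag_poset (cle \<tau> K)" "simply_connected_space (realization K)"
  shows "C_tilde_like \<tau> K"
proof -
  interpret flag_poset "cle \<tau> K" by fact
  let ?le = "cle \<tau> K"
  have rfl: "?le x x" if "x \<in> vertices K" for x using that by (simp add: cle_def vle_def)
  have "partial_order_on (vertices K) {(x, y). x \<in> vertices K \<and> y \<in> vertices K \<and> vle \<tau> K x y}"
  proof -
    have "{(x, y). x \<in> vertices K \<and> y \<in> vertices K \<and> vle \<tau> K x y} = {(x, y). ?le x y}"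
      by (simp add: cle_def)
    moreover have "Relation.trans {(x, y). ?le x y}" using trans by (auto intro!: transI)
    moreover have "Relation.antisym {(x, y). ?le x y}" using antisym by (auto intro!: antisymI)
    moreover have "refl_on (vertices K) {(x, y). ?le x y}" using rfl by (auto simp: refl_on_def cle_def)
    ultimately show ?thesis by (auto simp: partial_order_on_def preorder_on_def cle_def)
  qed
  moreover have "bowtie_free {w \<in> vertices K. vle \<tau> K x w} (vle \<tau> K)"
    "upward_flag {w \<in> vertices K. vle \<tau> K x w} (vle \<tau> K)" if x: "x \<in> vertices K" for x
  proof -
    have P: "{w \<in> vertices K. vle \<tau> K x w} = {w. ?le x w}" using x by (auto simp: cle_def)
    have "bowtie_free {w. ?le x w} ?le"
    proof (rule bowtie_freeI)
      fix x1 x2 y1 y2 assume h: "x1 \<in> {w. ?le x w}" "x2 \<in> {w. ?le x w}" "?le x1 y1" "?le x1 y2" "?le x2 y1" "?le x2 y2"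
      then obtain j where j: "?le x1 j" "?le x2 j" "\<And>w. ?le x1 w \<Longrightarrow> ?le x2 w \<Longrightarrow> ?le j w"
        using join[of x x1 x2 y1] by blast
      have "?le x j" using h(1) j(1) trans by blast
      then show "\<exists>z\<in>{w. ?le x w}. ?le x1 z \<and> ?le x2 z \<and> ?le z y1 \<and> ?le z y2"
        using h j by (intro bexI[of _ j]) auto
    qed
    then show "bowtie_free {w \<in> vertices K. vle \<tau> K x w} (vle \<tau> K)"
      using bowtie_free_cong[OF P, of "vle \<tau> K" ?le] by (auto simp: cle_def)
    show "upward_flag {w \<in> vertices K. vle \<tau> K x w} (vle \<tau> K)"
      unfolding P upward_flag_def
    proof (intro ballI impI, elim conjE)
      fix a b c assume abc: "a \<in> {w. ?le x w}" "b \<in> {w. ?le x w}" "c \<in> {w. ?le x w}"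
        and "bounded_above_in {w. ?le x w} (vle \<tau> K) {a, b}" "bounded_above_in {w. ?le x w} (vle \<tau> K) {b, c}"
          "bounded_above_in {w. ?le x w} (vle \<tau> K) {a, c}"
      then obtain u v w where "?le a u" "?le b u" "?le b v" "?le c v" "?le a w" "?le c w"
        unfolding bounded_above_in_def by (auto simp: cle_def)
      then obtain t where "?le a t" "?le b t" "?le c t" using upflag[of x a b c u v w] abc by auto
      moreover from this have "?le x t" using trans abc by blast
      ultimately show "bounded_above_in {w. ?le x w} (vle \<tau> K) {a, b, c}"
        unfolding bounded_above_in_def by (auto simp: cle_def)
    qed
  qed
  moreover have "bowtie_free {w \<in> vertices K. vle \<tau> K w x} (vle \<tau> K)"
    "downward_flag {w \<in> vertices K. vle \<tau> K w x} (vle \<tau> K)" if x: "x \<in> vertices K" for x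
  proof -
    have P: "{w \<in> vertices K. vle \<tau> K w x} = {w. ?le w x}" using x by (auto simp: cle_def)
    have "bowtie_free {w. ?le w x} ?le"
    proof (rule bowtie_freeI)
      fix x1 x2 y1 y2 assume h: "y1 \<in> {w. ?le w x}" "y2 \<in> {w. ?le w x}" "?le x1 y1" "?le x1 y2" "?le x2 y1" "?le x2 y2"
      then obtain j where j: "?le j y1" "?le j y2" "\<And>w. ?le w y1 \<Longrightarrow> ?le w y2 \<Longrightarrow> ?le w j"
        using meet[of x1 y1 y2 x] by blast
      have "?le j x" using h(1) j(1) trans by blast
      then show "\<exists>z\<in>{w. ?le w x}. ?le x1 z \<and> ?le x2 z \<and> ?le z y1 \<and> ?le z y2"
        using h j by (intro bexI[of _ j]) auto
    qed
    then show "bowtie_free {w \<in> vertices K. vle \<tau> K w x} (vle \<tau> K)"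
      using bowtie_free_cong[OF P, of "vle \<tau> K" ?le] by (auto simp: cle_def)
    show "downward_flag {w \<in> vertices K. vle \<tau> K w x} (vle \<tau> K)"
      unfolding P downward_flag_def
    proof (intro ballI impI, elim conjE)
      fix a b c assume abc: "a \<in> {w. ?le w x}" "b \<in> {w. ?le w x}" "c \<in> {w. ?le w x}"
        and "bounded_below_in {w. ?le w x} (vle \<tau> K) {a, b}" "bounded_below_in {w. ?le w x} (vle \<tau> K) {b, c}"
          "bounded_below_in {w. ?le w x} (vle \<tau> K) {a, c}"
      then obtain u v w where "?le u a" "?le u b" "?le v b" "?le v c" "?le w a" "?le w c"
        unfolding bounded_below_in_def by (auto simp: cle_def)
      then obtain t where "?le t a" "?le t b" "?le t c" using downflag[of a x b c u v w] abc by auto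
      moreover from this have "?le t x" using trans abc by blast
      ultimately show "bounded_below_in {w. ?le w x} (vle \<tau> K) {a, b, c}"
        unfolding bounded_below_in_def by (auto simp: cle_def)
    qed
  qed
  ultimately show ?thesis using assms(2) unfolding C_tilde_like_def by blast
qed

section \<open>Full subcomplexes, links and tight paths\<close>

lemma full_subcomplex_vless:
  assumes "Y = full_subcomplex X (vertices Y)"
  shows "vless \<tau> Y a b \<longleftrightarrow> a \<in> vertices Y \<and> b \<in> vertices Y \<and> vless \<tau> X a b"
  using arg_cong[OF assms, of "\<lambda>K. {a, b} \<in> K"]
  by (auto simp: vless_def adjacent_def full_subcomplex_def)

lemma full_subcomplex_vertices:
  assumes "Y = full_subcomplex X (vertices Y)"
  shows "vertices Y \<subseteq> vertices X"
proof
  fix v assume "v \<in> vertices Y"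
  then have "{v} \<in> Y" by (simp add: vertices_def)
  then have "{v} \<in> full_subcomplex X (vertices Y)" using assms by (rule subst[rotated])
  then show "v \<in> vertices X" by (simp add: full_subcomplex_def vertices_def)
qed

lemma cle_full_subcomplex:
  assumes "abs_complex Y" "Y = full_subcomplex X (vertices Y)"
  shows "cle \<tau> Y = restrict_le (vertices Y) (cle \<tau> X)"
proof (intro ext)
  fix a b
  show "cle \<tau> Y a b = restrict_le (vertices Y) (cle \<tau> X) a b"
    unfolding cle_def vle_def restrict_le_def full_subcomplex_vless[OF assms(2), of \<tau> a b]
    using full_subcomplex_vertices[OF assms(2)] by blast
qed

lemma vertices_lk:
  assumes "abs_complex K"
  shows "vertices (lk_minus \<tau> K x) = {v. vless \<tau> K v x}" "vertices (lk_plus \<tau> K x) = {v. vless \<tau> K x v}"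
proof -
  have "{v} \<in> K" if "{v, x} \<in> K" for v x using abs_complexD(3)[OF assms that, of "{v}"] by simp
  then show "vertices (lk_minus \<tau> K x) = {v. vless \<tau> K v x}" "vertices (lk_plus \<tau> K x) = {v. vless \<tau> K x v}"
    by (auto simp: vertices_def lk_minus_def lk_plus_def full_subcomplex_def link_def vless_def adjacent_def insert_commute)
qed

lemma tight_updown_path_3:
  "tight_updown_path \<tau> X L [a1, a2, a3] \<longleftrightarrow> edge_path L [a1, a2, a3] \<and>
     (vless \<tau> X a1 a2 \<longrightarrow> vless \<tau> X a3 a2) \<and> (vless \<tau> X a2 a1 \<longrightarrow> vless \<tau> X a2 a3) \<and>
     (vless \<tau> X a1 a2 \<and> vless \<tau> X a3 a2 \<longrightarrow> is_join (vertices L) (vle \<tau> X) a2 a1 a3) \<and>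
     (vless \<tau> X a2 a1 \<and> vless \<tau> X a2 a3 \<longrightarrow> is_meet (vertices L) (vle \<tau> X) a2 a1 a3)"
proof -
  have i: "0 < i \<and> i + 1 < length [a1, a2, a3] \<longleftrightarrow> i = 1" for i by auto
  show ?thesis unfolding tight_updown_path_def updown_path_def i by simp
qed

lemma tight_updown_path_4:
  "tight_updown_path \<tau> X L [a1, a2, a3, a4] \<longleftrightarrow>
     tight_updown_path \<tau> X L [a1, a2, a3] \<and> tight_updown_path \<tau> X L [a2, a3, a4]"
proof -
  have i: "0 < i \<and> i + 1 < length [a1, a2, a3, a4] \<longleftrightarrow> i = 1 \<or> i = 2" for i by auto
  have "edge_path L [a1, a2, a3, a4] \<longleftrightarrow> edge_path L [a1, a2, a3] \<and> edge_path L [a2, a3, a4]"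
    by (auto simp: edge_path_def)
  then show ?thesis
    unfolding tight_updown_path_3
    unfolding tight_updown_path_def updown_path_def i imp_disjL all_conj_distrib by simp blast
qed

lemma tight_peak:
  assumes P: "a \<in> vertices L" "j \<in> vertices L" "b \<in> vertices L"
    and adj: "\<And>u v. u \<in> vertices L \<Longrightarrow> v \<in> vertices L \<Longrightarrow> vless \<tau> X u v \<Longrightarrow> adjacent L u v \<and> adjacent L v u"
    and less: "vless \<tau> X a j" "vless \<tau> X b j"
    and min: "\<And>w. w \<in> vertices L \<Longrightarrow> vle \<tau> X a w \<Longrightarrow> vle \<tau> X b w \<Longrightarrow> vle \<tau> X j w"
  shows "tight_updown_path \<tau> X L [a, j, b]"
  unfolding tight_updown_path_3 is_join_def edge_path_def
  using P adj[OF P(1,2) less(1)] adj[OF P(3,2) less(2)] less min vless_asym[OF less(1)]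
  by (auto simp: vle_def)

lemma tight_valley:
  assumes P: "a \<in> vertices L" "j \<in> vertices L" "b \<in> vertices L"
    and adj: "\<And>u v. u \<in> vertices L \<Longrightarrow> v \<in> vertices L \<Longrightarrow> vless \<tau> X u v \<Longrightarrow> adjacent L u v \<and> adjacent L v u"
    and less: "vless \<tau> X j a" "vless \<tau> X j b"
    and max: "\<And>w. w \<in> vertices L \<Longrightarrow> vle \<tau> X w a \<Longrightarrow> vle \<tau> X w b \<Longrightarrow> vle \<tau> X w j"
  shows "tight_updown_path \<tau> X L [a, j, b]"
  unfolding tight_updown_path_3 is_meet_def edge_path_def
  using P adj[OF P(2,1) less(1)] adj[OF P(2,3) less(2)] less max vless_asym[OF less(1)]
  by (auto simp: vle_def)

text \<open>Tightness in a link of \<open>z\<close> is extremality among the vertices strictly above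
  or below \<open>z\<close>. Each rule thus builds a tight path, whose containment in the link in
  \<open>Y\<close> shows that its middle vertices belong to \<open>Y\<close>.\<close>

lemma convex_subposet_if_locally_convex:
  assumes type: "complex_of_type S \<tau> X" and flag: "flag_complex X" and poset: "flag_poset (cle \<tau> X)"
    and LC: "locally_convex S \<tau> X Y"
  shows "convex_subposet (cle \<tau> X) (vertices Y)"
proof -
  interpret flag_poset "cle \<tau> X" by fact
  let ?le = "cle \<tau> X" and ?W = "vertices Y"
  have aX: "abs_complex X" using complex_of_typeD(2)[OF type] .
  have Y: "Y = full_subcomplex X ?W" and typeY: "complex_of_type S \<tau> Y"
    using LC unfolding locally_convex_def by blast+
  have aY: "abs_complex Y" using complex_of_typeD(2)[OF typeY] .
  note slt = slt_cle[OF aX, of \<tau>]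
  note lkX = vertices_lk[OF aX, of \<tau>] and lkY = vertices_lk[OF aY, of \<tau>]
  note vY = full_subcomplex_vless[OF Y, of \<tau>]
  have less_cle: "?le a b" if "vless \<tau> X a b" for a b using that slt[of a b] by (simp add: slt_def)
  have vle_cle: "?le a b" if "vle \<tau> X a b" "?le a a" for a b
    using that less_cle by (auto simp: vle_def)
  have cle_vle: "vle \<tau> X a b" if "?le a b" for a b using that by (simp add: cle_def)
  have rfl: "?le a a" "?le b b" if "vless \<tau> X a b" for a b using less_cle[OF that] refl1 refl2 by blast+
  have less: "vless \<tau> X a b" if "?le a b" "a \<noteq> b" for a b using that slt[of a b] by (simp add: slt_def)
  \<comment> \<open>Flagness turns a chain of three vertices into a simplex, so comparable vertices
    of a link are adjacent in the link.\<close>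
  have simplex: "{z, u, v} \<in> X" if "?le z u \<or> ?le u z" "?le z v \<or> ?le v z" "?le u v" for z u v
    using that refl1 refl2 by (intro pairwise_comparable_simplex[OF type flag]) auto
  have adj_up: "adjacent (lk_plus \<tau> X z) u v \<and> adjacent (lk_plus \<tau> X z) v u"
    if "u \<in> vertices (lk_plus \<tau> X z)" "v \<in> vertices (lk_plus \<tau> X z)" "vless \<tau> X u v" for u v z
    using that simplex[of z u v] less_cle unfolding lkX
    by (auto simp: lk_plus_def full_subcomplex_def link_def vless_def adjacent_def insert_commute)
  have adj_down: "adjacent (lk_minus \<tau> X z) u v \<and> adjacent (lk_minus \<tau> X z) v u"
    if "u \<in> vertices (lk_minus \<tau> X z)" "v \<in> vertices (lk_minus \<tau> X z)" "vless \<tau> X u v" for u v z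
    using that simplex[of z u v] less_cle unfolding lkX
    by (auto simp: lk_minus_def full_subcomplex_def link_def vless_def adjacent_def insert_commute)
  have up3: "j \<in> ?W" if "z \<in> ?W" "a \<in> ?W" "b \<in> ?W" "vless \<tau> X z a" "vless \<tau> X z b"
    "tight_updown_path \<tau> X (lk_plus \<tau> X z) [a, j, b]" for z a b j
  proof -
    have "\<forall>a1 a2 a3. tight_updown_path \<tau> X (lk_plus \<tau> X z) [a1, a2, a3] \<and> a1 \<in> vertices (lk_plus \<tau> Y z)
        \<and> a3 \<in> vertices (lk_plus \<tau> Y z) \<longrightarrow> edge_path (lk_plus \<tau> Y z) [a1, a2, a3]"
      using LC that(1) unfolding locally_convex_def by blast
    then have "edge_path (lk_plus \<tau> Y z) [a, j, b]" using that lkY vY by blast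
    then have "vless \<tau> Y z j" using lkY by (simp add: edge_path_def)
    then show ?thesis using vY by simp
  qed
  have down3: "j \<in> ?W" if "z \<in> ?W" "a \<in> ?W" "b \<in> ?W" "vless \<tau> X a z" "vless \<tau> X b z"
    "tight_updown_path \<tau> X (lk_minus \<tau> X z) [a, j, b]" for z a b j
  proof -
    have "\<forall>a1 a2 a3. tight_updown_path \<tau> X (lk_minus \<tau> X z) [a1, a2, a3] \<and> a1 \<in> vertices (lk_minus \<tau> Y z)
        \<and> a3 \<in> vertices (lk_minus \<tau> Y z) \<longrightarrow> edge_path (lk_minus \<tau> Y z) [a1, a2, a3]"
      using LC that(1) unfolding locally_convex_def by blast
    then have "edge_path (lk_minus \<tau> Y z) [a, j, b]" using that lkY vY by blast
    then have "vless \<tau> Y j z" using lkY by (simp add: edge_path_def)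
    then show ?thesis using vY by simp
  qed
  have peak_up: "tight_updown_path \<tau> X (lk_plus \<tau> X z) [a, j, b]"
    if h: "vless \<tau> X z a" "vless \<tau> X z j" "vless \<tau> X z b" "vless \<tau> X a j" "vless \<tau> X b j"
      "\<And>w. vless \<tau> X z w \<Longrightarrow> ?le a w \<Longrightarrow> ?le b w \<Longrightarrow> ?le j w" for z a j b
  proof (rule tight_peak[OF _ _ _ adj_up h(4,5)])
    fix w assume w: "w \<in> vertices (lk_plus \<tau> X z)" "vle \<tau> X a w" "vle \<tau> X b w"
    then have zw: "vless \<tau> X z w" by (simp add: lkX)
    show "vle \<tau> X j w"
      using h(6)[OF zw] vle_cle[OF w(2) rfl(2)[OF h(1)]] vle_cle[OF w(3) rfl(2)[OF h(3)]] cle_vle by blast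
  qed (use h lkX in simp_all)
  have peak_down: "tight_updown_path \<tau> X (lk_minus \<tau> X z) [a, j, b]"
    if h: "vless \<tau> X a z" "vless \<tau> X j z" "vless \<tau> X b z" "vless \<tau> X a j" "vless \<tau> X b j"
      "\<And>w. vless \<tau> X w z \<Longrightarrow> ?le a w \<Longrightarrow> ?le b w \<Longrightarrow> ?le j w" for z a j b
  proof (rule tight_peak[OF _ _ _ adj_down h(4,5)])
    fix w assume w: "w \<in> vertices (lk_minus \<tau> X z)" "vle \<tau> X a w" "vle \<tau> X b w"
    then have zw: "vless \<tau> X w z" by (simp add: lkX)
    show "vle \<tau> X j w"
      using h(6)[OF zw] vle_cle[OF w(2) rfl(1)[OF h(1)]] vle_cle[OF w(3) rfl(1)[OF h(3)]] cle_vle by blast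
  qed (use h lkX in simp_all)
  have valley_up: "tight_updown_path \<tau> X (lk_plus \<tau> X z) [a, j, b]"
    if h: "vless \<tau> X z a" "vless \<tau> X z j" "vless \<tau> X z b" "vless \<tau> X j a" "vless \<tau> X j b"
      "\<And>w. vless \<tau> X z w \<Longrightarrow> ?le w a \<Longrightarrow> ?le w b \<Longrightarrow> ?le w j" for z a j b
  proof (rule tight_valley[OF _ _ _ adj_up h(4,5)])
    fix w assume w: "w \<in> vertices (lk_plus \<tau> X z)" "vle \<tau> X w a" "vle \<tau> X w b"
    then have zw: "vless \<tau> X z w" by (simp add: lkX)
    show "vle \<tau> X w j"
      using h(6)[OF zw] vle_cle[OF w(2) rfl(2)[OF zw]] vle_cle[OF w(3) rfl(2)[OF zw]] cle_vle by blast
  qed (use h lkX in simp_all)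
  have valley_down: "tight_updown_path \<tau> X (lk_minus \<tau> X z) [a, j, b]"
    if h: "vless \<tau> X a z" "vless \<tau> X j z" "vless \<tau> X b z" "vless \<tau> X j a" "vless \<tau> X j b"
      "\<And>w. vless \<tau> X w z \<Longrightarrow> ?le w a \<Longrightarrow> ?le w b \<Longrightarrow> ?le w j" for z a j b
  proof (rule tight_valley[OF _ _ _ adj_down h(4,5)])
    fix w assume w: "w \<in> vertices (lk_minus \<tau> X z)" "vle \<tau> X w a" "vle \<tau> X w b"
    then have zw: "vless \<tau> X w z" by (simp add: lkX)
    show "vle \<tau> X w j"
      using h(6)[OF zw] vle_cle[OF w(2) rfl(1)[OF zw]] vle_cle[OF w(3) rfl(1)[OF zw]] cle_vle by blast
  qed (use h lkX in simp_all)
  show ?thesis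
  proof (intro convex_subposet.intro[OF poset] convex_subposet_axioms.intro, unfold slt, goal_cases)
    case (1 x)
    then show ?case using full_subcomplex_vertices[OF Y] by (auto simp: cle_def vle_def)
  next
    case (2 z a b j)
    show ?case
    \<comment> \<open>If the join is one of its arguments there is no path of length 2, but it lies
      in \<open>Y\<close> already.\<close>
    proof (cases "j = a \<or> j = b")
      case True then show ?thesis using 2 by blast
    next
      case False
      then have "vless \<tau> X a j" "vless \<tau> X b j" "vless \<tau> X z j"
        using 2(6,7) less trans[OF less_cle[OF 2(4)] 2(6)] 2(4) antisym[OF less_cle[OF 2(4)]] by blast+
      then have "tight_updown_path \<tau> X (lk_plus \<tau> X z) [a, j, b]"
        using 2 by (intro peak_up)
      then show ?thesis using up3 2 by blast
    qed
  next
    case (3 z a b j)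
    show ?case
    proof (cases "j = a \<or> j = b")
      case True then show ?thesis using 3 by blast
    next
      case False
      then have "vless \<tau> X j a" "vless \<tau> X j b" using 3(7,8) less by blast+
      then have "tight_updown_path \<tau> X (lk_plus \<tau> X z) [a, j, b]"
        using 3 by (intro valley_up)
      then show ?thesis using up3 3 by blast
    qed
  next
    case (4 z a b j)
    show ?case
    proof (cases "j = a \<or> j = b")
      case True then show ?thesis using 4 by blast
    next
      case False
      then have "vless \<tau> X j a" "vless \<tau> X j b" "vless \<tau> X j z"
        using 4(6,7) less trans[OF 4(6) less_cle[OF 4(4)]] 4(4) antisym[OF 4(6)] less_cle[OF 4(4)] by blast+
      then have "tight_updown_path \<tau> X (lk_minus \<tau> X z) [a, j, b]"
        using 4 by (intro valley_down)
      then show ?thesis using down3 4 by blast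
    qed
  next
    case (5 z a b j)
    show ?case
    proof (cases "j = a \<or> j = b")
      case True then show ?thesis using 5 by blast
    next
      case False
      then have "vless \<tau> X a j" "vless \<tau> X b j" using 5(7,8) less by blast+
      then have "tight_updown_path \<tau> X (lk_minus \<tau> X z) [a, j, b]"
        using 5 by (intro peak_down)
      then show ?thesis using down3 5 by blast
    qed
  next
    case (6 z a1 a4 a2 a3)
    have "tight_updown_path \<tau> X (lk_minus \<tau> X z) [a1, a2, a3]"
      using 6 by (intro peak_down)
    moreover have "tight_updown_path \<tau> X (lk_minus \<tau> X z) [a2, a3, a4]"
      using 6 by (intro valley_down)
    ultimately have "tight_updown_path \<tau> X (lk_minus \<tau> X z) [a1, a2, a3, a4]"
      by (simp add: tight_updown_path_4)
    moreover have "a1 \<in> vertices (lk_minus \<tau> Y z)" "a4 \<in> vertices (lk_minus \<tau> Y z)"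
      using 6 lkY vY by auto
    ultimately have "edge_path (lk_minus \<tau> Y z) [a1, a2, a3, a4]"
      using LC 6 unfolding locally_convex_def by blast
    then have "vless \<tau> Y a2 z" "vless \<tau> Y a3 z" using lkY by (simp_all add: edge_path_def)
    then show ?case using vY by simp
  next
    case (7 z a1 a4 a2 a3)
    have "tight_updown_path \<tau> X (lk_plus \<tau> X z) [a1, a2, a3]"
      using 7 by (intro valley_up)
    moreover have "tight_updown_path \<tau> X (lk_plus \<tau> X z) [a2, a3, a4]"
      using 7 by (intro peak_up)
    ultimately have "tight_updown_path \<tau> X (lk_plus \<tau> X z) [a1, a2, a3, a4]"
      by (simp add: tight_updown_path_4)
    moreover have "a1 \<in> vertices (lk_plus \<tau> Y z)" "a4 \<in> vertices (lk_plus \<tau> Y z)"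
      using 7 lkY vY by auto
    ultimately have "edge_path (lk_plus \<tau> Y z) [a1, a2, a3, a4]"
      using LC 7 unfolding locally_convex_def by blast
    then have "vless \<tau> Y z a2" "vless \<tau> Y z a3" using lkY by (simp_all add: edge_path_def)
    then show ?case using vY by simp
  qed
qed

text \<open>The open stars of the vertices inside and outside \<open>W\<close> form two open sets
  that cover the realization. They are disjoint, since a common point would yield an edge leaving
  \<open>W\<close>.\<close>

lemma edge_closed_connected:
  assumes K: "abs_complex K" and conn: "connected_space (realization K)"
    and W: "w \<in> W" "w \<in> vertices K"
    and closed: "\<And>u v. u \<in> W \<Longrightarrow> {u, v} \<in> K \<Longrightarrow> v \<in> W"
  shows "vertices K \<subseteq> W"
proof (rule ccontr)
  assume "\<not> vertices K \<subseteq> W"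
  then obtain v where v: "v \<in> vertices K" "v \<notin> W" by blast
  let ?A = "\<Union>u\<in>vertices K \<inter> W. open_star K u" and ?B = "\<Union>u\<in>vertices K - W. open_star K u"
  have "openin (realization K) (\<Union>u\<in>A. open_star K u)" for A
    by (intro openin_Union) (auto intro: openin_open_star)
  then have "openin (realization K) ?A" "openin (realization K) ?B" by blast+
  moreover have "topspace (realization K) \<subseteq> ?A \<union> ?B"
    using in_some_open_star[OF K] by blast
  moreover have "?A \<inter> ?B = {}"
  proof (rule ccontr)
    assume "?A \<inter> ?B \<noteq> {}"
    then obtain f a b where f: "f \<in> open_star K a" "f \<in> open_star K b" "a \<in> W" "b \<notin> W" by blast
    then have "f \<in> topspace (realization K)" by (simp add: open_star_def)
    then have "{a, b} \<in> K" using f by (intro open_star_common_simplex[OF K, of f]) auto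
    then show False using closed f by blast
  qed
  moreover have ne: "open_star K u \<noteq> {}" if "u \<in> vertices K" for u
  proof -
    have "(\<lambda>x. of_bool (u = x)) \<in> closed_simplex {u}" by (auto simp: closed_simplex_def)
    then have "(\<lambda>x. of_bool (u = x)) \<in> open_star K u"
      using that by (auto simp: open_star_def topspace_realization vertices_def)
    then show ?thesis by blast
  qed
  moreover have "?A \<noteq> {}" "?B \<noteq> {}" using ne W v by blast+
  ultimately show False using conn unfolding connected_space_def by meson
qed

text \<open>A simplex of largest cardinality is maximal under inclusion and so has
  \<open>card S\<close> vertices. Their types are distinct, hence every type occurs, in particular
  \<open>Min S\<close>.\<close>

lemma exists_extremal_vertex:
  assumes type: "complex_of_type S \<tau> K" and v: "v \<in> vertices K"
  obtains y where "y \<in> vertices K" "extremal S \<tau> y"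
proof -
  note K = complex_of_typeD(2)[OF type]
  have inj: "inj_on \<tau> \<sigma> \<and> \<tau> ` \<sigma> \<subseteq> S \<and> \<sigma> \<subseteq> vertices K" if \<sigma>: "\<sigma> \<in> K" for \<sigma>
  proof -
    have "\<tau> a \<noteq> \<tau> b" if "a \<in> \<sigma>" "b \<in> \<sigma>" "a \<noteq> b" for a b
      using complex_of_typeD(4)[OF type, of a b] abs_complexD(3)[OF K \<sigma>, of "{a, b}"] that by (simp add: adjacent_def)
    moreover have "\<sigma> \<subseteq> vertices K" using abs_complexD(3)[OF K \<sigma>] by (auto simp: vertices_def)
    ultimately show ?thesis using complex_of_typeD(3)[OF type] by (auto simp: inj_on_def)
  qed
  have fin: "finite S" using complex_of_typeD(1)[OF type] .
  have bound: "card \<sigma> \<le> card S" if "\<sigma> \<in> K" for \<sigma>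
    using inj[OF that] fin card_inj_on_le by blast
  obtain \<sigma> where \<sigma>: "\<sigma> \<in> K" "\<And>\<rho>. \<rho> \<in> K \<Longrightarrow> card \<rho> \<le> card \<sigma>"
    using ex_has_greatest_nat[of "\<lambda>\<sigma>. \<sigma> \<in> K" "{v}" card "Suc (card S)"] v bound
    by (auto simp: vertices_def less_Suc_eq_le)
  have "\<rho> = \<sigma>" if "\<rho> \<in> K" "\<sigma> \<subseteq> \<rho>" for \<rho>
    using card_seteq[OF abs_complexD(1)[OF K that(1)] that(2) \<sigma>(2)[OF that(1)]] by simp
  then have "card \<sigma> = card S" using \<sigma>(1) type unfolding complex_of_type_def by blast
  then have "\<tau> ` \<sigma> = S" using inj[OF \<sigma>(1)] fin card_image[of \<tau> \<sigma>] by (metis card_subset_eq)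
  moreover have "S \<noteq> {}" using complex_of_typeD(3)[OF type v] by blast
  then have "Min S \<in> S" using fin by (rule Min_in[rotated])
  ultimately obtain y where "y \<in> \<sigma>" "\<tau> y = Min S" by (metis imageE)
  then show ?thesis using that inj[OF \<sigma>(1)] by (auto simp: extremal_def)
qed

subsection \<open>Normal form paths in complexes\<close>

text \<open>All conditions at one inner vertex of a local normal form path, kept in their literal
  form; as one predicate they pass to the tail of the path by an index shift.\<close>

definition normal_turn :: "('v \<Rightarrow> 's::linorder) \<Rightarrow> 'v set set \<Rightarrow> 'v \<Rightarrow> 'v \<Rightarrow> 'v \<Rightarrow> bool" where
  "normal_turn \<tau> K u v w \<longleftrightarrow>
     (vless \<tau> K u v \<longrightarrow> vless \<tau> K w v) \<and> (vless \<tau> K v u \<longrightarrow> vless \<tau> K v w) \<and>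
     (vless \<tau> K u v \<and> vless \<tau> K w v \<longrightarrow>
        \<not> (\<exists>a1 a2 a3 a4. {a1, a2, a3, a4} \<subseteq> vertices (lk_minus \<tau> K v) \<and> a1 = u \<and> a4 = w \<and>
             vle \<tau> K a1 a2 \<and> vle \<tau> K a3 a2 \<and> vle \<tau> K a3 a4)) \<and>
     (vless \<tau> K v u \<and> vless \<tau> K v w \<longrightarrow>
        \<not> (\<exists>a1 a2 a3 a4. {a1, a2, a3, a4} \<subseteq> vertices (lk_plus \<tau> K v) \<and> a1 = u \<and> a4 = w \<and>
             vle \<tau> K a2 a1 \<and> vle \<tau> K a2 a3 \<and> vle \<tau> K a4 a3))"

lemma local_normal_form_path_iff:
  "local_normal_form_path \<tau> K x y p \<longleftrightarrow> edge_path K p \<and> hd p = x \<and> last p = y \<and>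
     (\<forall>i. 0 < i \<and> i + 1 < length p \<longrightarrow> normal_turn \<tau> K (p ! (i - 1)) (p ! i) (p ! (i + 1)))"
proof -
  have *: "((E \<and> (\<forall>i. A i \<longrightarrow> B i \<and> C i)) \<and> F \<and> G \<and> (\<forall>i. A i \<longrightarrow> D i \<and> H i)) \<longleftrightarrow>
      (E \<and> F \<and> G \<and> (\<forall>i. A i \<longrightarrow> B i \<and> C i \<and> D i \<and> H i))"
    for E F G and A B C D H :: "nat \<Rightarrow> bool"
    by blast
  show ?thesis
    unfolding local_normal_form_path_def updown_path_def normal_turn_def by (rule *)
qed

lemma normal_turn_down:
  assumes K: "abs_complex K" and turn: "normal_turn \<tau> K u v w" and u: "vless \<tau> K u v"
  shows "\<not> shortcut (cle \<tau> K) u v w"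
proof
  assume "shortcut (cle \<tau> K) u v w"
  then obtain b c where bc: "vless \<tau> K b v" "vless \<tau> K c v" "vle \<tau> K u b" "vle \<tau> K c b" "vle \<tau> K c w"
    unfolding shortcut_def slt_cle[OF K] by (auto simp: cle_def)
  have w: "vless \<tau> K w v" using turn u by (simp add: normal_turn_def)
  have "{u, b, c, w} \<subseteq> vertices (lk_minus \<tau> K v)" using bc u w by (simp add: vertices_lk[OF K])
  then show False using turn u w bc unfolding normal_turn_def by blast
qed

lemma normal_turn_up:
  assumes K: "abs_complex K" and turn: "normal_turn \<tau> K u v w" and u: "vless \<tau> K v u"
  shows "\<not> shortcut (cle \<tau> K)\<inverse>\<inverse> u v w"
proof
  assume "shortcut (cle \<tau> K)\<inverse>\<inverse> u v w"
  then obtain b c where "slt (cle \<tau> K) v b" "slt (cle \<tau> K) v c" "vle \<tau> K b u" "vle \<tau> K b c" "vle \<tau> K w c"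
    unfolding shortcut_def by (auto simp: cle_def slt_def)
  then have bc: "vless \<tau> K v b" "vless \<tau> K v c" "vle \<tau> K b u" "vle \<tau> K b c" "vle \<tau> K w c"
    by (simp_all add: slt_cle[OF K])
  have w: "vless \<tau> K v w" using turn u by (simp add: normal_turn_def)
  have "{u, b, c, w} \<subseteq> vertices (lk_plus \<tau> K v)" using bc u w by (simp add: vertices_lk[OF K])
  then show False using turn u w bc unfolding normal_turn_def by blast
qed

section \<open>Normal forms towards an extremal vertex\<close>

locale based_complex =
  fixes S :: "'s::linorder set" and \<tau> :: "'v \<Rightarrow> 's" and K :: "'v set set" and y :: 'v
  assumes type: "complex_of_type S \<tau> K" and flag: "flag_complex K" and poset: "flag_poset (cle \<tau> K)"
    and y_vertex: "y \<in> vertices K" and y_extremal: "extremal S \<tau> y"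
begin

lemma Min_Max_types: "v \<in> vertices K \<Longrightarrow> Min S \<le> \<tau> v \<and> \<tau> v \<le> Max S"
  using complex_of_typeD(1,3)[OF type] by (simp add: Min_le Max_ge)

text \<open>Types strictly increase along the order, so a vertex of extremal type is minimal or
  maximal in it.\<close>

sublocale based_flag_poset "cle \<tau> K" y "\<tau> y = Min S"
proof (intro based_flag_poset.intro[OF poset] based_flag_poset_axioms.intro)
  show "cle \<tau> K y y" using y_vertex by (simp add: cle_def vle_def)
  show "x = y" if "\<tau> y = Min S" "cle \<tau> K x y" for x
    using type_less_if_cle[OF that(2)] Min_Max_types[of x] that by (fastforce simp: cle_def)
  show "x = y" if "\<tau> y \<noteq> Min S" "cle \<tau> K y x" for x
    using type_less_if_cle[OF that(2)] Min_Max_types[of x] that y_extremal by (fastforce simp: cle_def extremal_def)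
qed

lemma complex: "abs_complex K"
  using complex_of_typeD(2)[OF type] .

lemmas edge_iff = edge_iff_comparable[OF type]

lemma zigzag_unique:
  assumes "simply_connected_space (realization K)" "zigzag p" "zigzag p'" "hd p = hd p'"
  shows "p = p'"
proof (rule covering_trivial_if_simply_connected[OF complex assms(1), where E = conn and \<pi> = hd])
  show "conn u u" if "conn u u'" for u u' using conn_zigzag[OF that] conn_refl by blast
  show "conn u' u" if "conn u u'" for u u' using conn_sym[OF that] .
  show "{hd u, hd u'} \<in> K" if "conn u u'" for u u' using conn_hd[OF that] edge_iff by blast
  show "\<exists>u'. conn u u' \<and> hd u' = v" if "conn u u" "{hd u, v} \<in> K" for u v
    using conn_lift conn_zigzag[OF that(1)] that(2) edge_iff by blast
  show "u' = u''" if "conn u u'" "conn u u''" "hd u' = hd u''" for u u' u''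
    using conn_unique[OF that] .
  show "conn u u''" if "conn u u'" "conn u' u''" "{hd u, hd u', hd u''} \<in> K" for u u' u''
  proof -
    have "{hd u, hd u''} \<in> K" using abs_complexD(3)[OF complex that(3), of "{hd u, hd u''}"] by auto
    then show ?thesis using conn_triangle[OF that(1,2)] edge_iff by blast
  qed
  \<comment> \<open>The two zigzags are connected through \<open>[y]\<close>.\<close>
  have "symp conn\<^sup>*\<^sup>*" by (rule symp_rtranclp, rule sympI, rule conn_sym)
  then have "conn\<^sup>*\<^sup>* [y] p'" using conn_rtrancl_base[OF assms(3)] by (rule sympD)
  then show "conn\<^sup>*\<^sup>* p p'" using conn_rtrancl_base[OF assms(2)] by (rule rtranclp_trans[rotated])
qed (rule assms(4))

lemma zigzag_exists:
  assumes "connected_space (realization K)" "v \<in> vertices K"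
  shows "\<exists>p. zigzag p \<and> hd p = v"
proof -
  have "vertices K \<subseteq> {v. \<exists>p. zigzag p \<and> hd p = v}"
  proof (rule edge_closed_connected[OF complex assms(1)])
    show "y \<in> {v. \<exists>p. zigzag p \<and> hd p = v}" using zigzag_base by (intro CollectI exI[of _ "[y]"]) simp
    fix u v assume "u \<in> {v. \<exists>p. zigzag p \<and> hd p = v}" "{u, v} \<in> K"
    then obtain p where "zigzag p" "cle \<tau> K (hd p) v \<or> cle \<tau> K v (hd p)" using edge_iff by blast
    then show "v \<in> {v. \<exists>p. zigzag p \<and> hd p = v}" using conn_lift conn_zigzag by blast
  qed (rule y_vertex)
  then show ?thesis using assms(2) by blast
qed

lemma zigzag_edge_path: "zigzag p \<Longrightarrow> edge_path K p"
proof (induction p)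
  case Nil then show ?case by (simp add: zigzag_def)
next
  case (Cons x q)
  have xV: "x \<in> vertices K" using zigzag_carrier[OF Cons.prems, of x] by (simp add: cle_def)
  show ?case
  proof (cases q)
    case Nil then show ?thesis using xV by (simp add: edge_path_def)
  next
    case (Cons x1 r)
    have "edge_path K q" using Cons.IH zigzag_tl[OF Cons.prems] Cons by simp
    moreover have "x \<noteq> x1" "{x, x1} \<in> K"
      using low_hd[of x q] high_hd[of x q] Cons.prems Cons edge_iff by (auto simp: zigzag_def)
    ultimately show ?thesis using xV Cons by (simp add: edge_path_def adjacent_def)
  qed
qed

lemma local_normal_form_path_zigzag:
  assumes "local_normal_form_path \<tau> K x y p"
  shows "zigzag p"
  using assms
proof (induction p arbitrary: x)
  case Nil
  then show ?case by (simp add: local_normal_form_path_iff edge_path_def)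
next
  case (Cons a q)
  note slt = slt_cle[OF complex, of \<tau>]
  have path: "edge_path K (a # q)" and last: "last (a # q) = y"
    and turns: "\<And>i. 0 < i \<Longrightarrow> i + 1 < length (a # q) \<Longrightarrow> normal_turn \<tau> K ((a # q) ! (i - 1)) ((a # q) ! i) ((a # q) ! (i + 1))"
    using Cons.prems unfolding local_normal_form_path_iff by blast+
  show ?case
  proof (cases q)
    case Nil
    then show ?thesis using last zigzag_base by simp
  next
    case (Cons x1 r)
    have adj: "adjacent K a x1" using path Cons by (simp add: edge_path_def)
    then have cmp: "vless \<tau> K a x1 \<or> vless \<tau> K x1 a"
      using complex_of_typeD(4)[OF type adj] by (auto simp: vless_def adjacent_def insert_commute)
    have "normal_turn \<tau> K (q ! (i - 1)) (q ! i) (q ! (i + 1))" if "0 < i" "i + 1 < length q" for i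
      using turns[of "Suc i"] that by (cases i) simp_all
    moreover have "edge_path K q" "last q = y" using path last Cons by (simp_all add: edge_path_def)
    ultimately have "local_normal_form_path \<tau> K x1 y q"
      using Cons unfolding local_normal_form_path_iff by simp
    then have IH: "zigzag q" by (rule Cons.IH)
    show ?thesis
    proof (cases r)
      case Nil
      then have x1: "x1 = y" using last Cons by simp
      \<comment> \<open>The direction of the last edge is forced: nothing lies strictly below
        \<open>y\<close> if its type is \<open>Min S\<close>, and nothing strictly above it
        otherwise.\<close>
      have "\<tau> y \<noteq> Min S" if "vless \<tau> K a y" using y_min[of a] that slt[of a y] by (auto simp: slt_def)
      moreover have "\<tau> y = Min S" if "vless \<tau> K y a" using y_max[of a] that slt[of y a] by (auto simp: slt_def)
      ultimately show ?thesis using cmp slt[of a y] slt[of y a] x1 Cons Nil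
        unfolding zigzag_def by (auto simp: slt_def)
    next
      case (Cons x2 s)
      have q: "q = x1 # x2 # s" using Cons \<open>q = x1 # r\<close> by simp
      have turn: "normal_turn \<tau> K a x1 x2" using turns[of 1] q by simp
      have slt_conv: "slt (cle \<tau> K)\<inverse>\<inverse> u v \<longleftrightarrow> vless \<tau> K v u" for u v
        using slt[of v u] by (auto simp: slt_def)
      consider "low q" | "high q" using IH by (auto simp: zigzag_def)
      then show ?thesis
      proof cases
        case 1
        then have "vless \<tau> K x1 x2" using low_hd[of x1 "x2 # s"] q slt[of x1 x2] by (simp add: slt_def)
        \<comment> \<open>The path turns at \<open>x1\<close>, so the direction of the second edge
          fixes that of the first.\<close>
        then have "vless \<tau> K x1 a" using cmp turn vless_asym[of \<tau> K x1 x2] by (auto simp: normal_turn_def)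
        then have "high (a # q)" using normal_turn_up[OF complex turn] 1 q slt_conv by simp
        then show ?thesis by (simp add: zigzag_def)
      next
        case 2
        then have "slt (cle \<tau> K) x2 x1" using high_hd[of x1 "x2 # s"] q by (auto simp: slt_def)
        then have "vless \<tau> K x2 x1" by (simp add: slt)
        then have "vless \<tau> K a x1" using cmp turn vless_asym[of \<tau> K x2 x1] by (auto simp: normal_turn_def)
        then have "low (a # q)" using normal_turn_down[OF complex turn] 2 q slt by simp
        then show ?thesis by (simp add: zigzag_def)
      qed
    qed
  qed
qed

text \<open>Vertices are removed level by level, where the level of a vertex is the length of its normal
  form. Within a level of local minima, vertices of larger type go first, and dually.\<close>

lemma simply_connected_if_unique_zigzags:
  assumes ex: "\<And>v. v \<in> vertices K \<Longrightarrow> \<exists>p. zigzag p \<and> hd p = v"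
    and uniq: "\<And>p p'. zigzag p \<Longrightarrow> zigzag p' \<Longrightarrow> hd p = hd p' \<Longrightarrow> p = p'"
  shows "simply_connected_space (realization K)"
proof -
  obtain P where P: "\<And>v. v \<in> vertices K \<Longrightarrow> zigzag (P v) \<and> hd (P v) = v" using ex by metis
  have Pconn: "conn (P v) (P w)" if cmp: "cle \<tau> K v w \<or> cle \<tau> K w v" for v w
  proof -
    have vw: "v \<in> vertices K" "w \<in> vertices K" using cmp by (auto simp: cle_def)
    then obtain p where "conn (P v) p" "hd p = w" using conn_lift[of "P v" w] P[of v] cmp by auto
    then show ?thesis using uniq[of p "P w"] P[of w] vw conn_zigzag by auto
  qed
  have Py: "P y = [y]" using uniq[of "P y" "[y]"] P[OF y_vertex] zigzag_base by simp
  define rk where "rk v = (if low (P v) then card {s \<in> S. s < \<tau> v} else card {s \<in> S. \<tau> v < s})" for v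
  \<comment> \<open>A lexicographic rank: \<open>rk v\<close> is less than \<open>card S\<close>, so
    the level dominates. Subtracting 1 from the length gives \<open>y\<close> the rank 0.\<close>
  define R where "R v = (length (P v) - 1) * card S + rk v" for v
  have fin: "finite S" using complex_of_typeD(1)[OF type] .
  have rk_less: "rk v < card S" if "v \<in> vertices K" for v
  proof -
    have "\<tau> v \<in> S" using complex_of_typeD(3)[OF type that] .
    then have "{s \<in> S. s < \<tau> v} \<subset> S" "{s \<in> S. \<tau> v < s} \<subset> S" by auto
    then show ?thesis unfolding rk_def using fin by (auto intro: psubset_card_mono)
  qed
  have form: "\<exists>x1 q. P v = v # x1 # q \<and> P x1 = x1 # q" if v: "v \<in> vertices K" "v \<noteq> y" for v
  proof -
    obtain q where q: "P v = v # q" using P[OF v(1)] by (cases "P v") (auto simp: zigzag_def)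
    have "q \<noteq> []" using P[OF v(1)] q v(2) by (auto simp: zigzag_def)
    then obtain x1 r where r: "q = x1 # r" by (cases q) auto
    have z: "zigzag q" using zigzag_tl[of v q] P[OF v(1)] q r by simp
    then have "x1 \<in> vertices K" using zigzag_carrier[of q x1] r by (simp add: cle_def)
    \<comment> \<open>The tail of a normal form is again one, so by uniqueness it is the chosen form
      of the next vertex. Hence \<open>r\<close> lowers the level by one.\<close>
    then have "P x1 = q" using uniq[of "P x1" q] P z r by simp
    then have "P v = v # x1 # r" "P x1 = x1 # r" using q r by simp_all
    then show ?thesis by blast
  qed
  define r where "r v = hd (tl (P v))" for v
  show ?thesis
  proof (rule simply_connected_space_dismantlable[OF complex y_vertex, where R = R and r = r])
    have "rk y = 0"
    proof (cases "\<tau> y = Min S")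
      case True
      then have "{s \<in> S. s < \<tau> y} = {}" using fin by (auto simp: not_less)
      moreover have "low (P y)" using True by (simp add: Py)
      ultimately show ?thesis unfolding rk_def by (simp only: if_True card.empty)
    next
      case False
      then have "{s \<in> S. \<tau> y < s} = {}" using y_extremal fin by (auto simp: not_less extremal_def)
      moreover have "\<not> low (P y)" using False by (simp add: Py)
      ultimately show ?thesis unfolding rk_def by (simp only: if_False card.empty)
    qed
    then show "R y = 0" by (simp add: R_def Py)
  next
    fix v assume v: "v \<in> vertices K" "v \<noteq> y"
    then obtain x1 q where q: "P v = v # x1 # q" "P x1 = x1 # q" using form by blast
    have rv: "r v = x1" using q by (simp add: r_def)
    have cmp: "cle \<tau> K v x1 \<or> cle \<tau> K x1 v"
      using conn_hd[OF conn_tl[of v "x1 # q"]] P[OF v(1)] q by simp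
    then have "x1 \<in> vertices K" by (auto simp: cle_def)
    then have "rk x1 < card S" by (rule rk_less)
    then have "R x1 < R v" using q by (simp add: R_def)
    then show "{v, r v} \<in> K \<and> R (r v) < R v" using cmp rv edge_iff by blast
    fix w assume w: "adjacent K v w" "R w \<le> R v"
    have vw: "cle \<tau> K v w \<or> cle \<tau> K w v" "v \<noteq> w" using w(1) edge_iff by (auto simp: adjacent_def)
    then have wV: "w \<in> vertices K" by (auto simp: cle_def)
    have cn: "conn (v # x1 # q) (P w)" using Pconn[OF vw(1)] q by simp
    have hw: "hd (P w) = w" "P w \<noteq> []" using P[OF wV] by (auto simp: zigzag_def)
    \<comment> \<open>One more level outweighs any difference of \<open>rk\<close>.\<close>
    have len: "length (P w) \<le> length (P v)"
    proof (rule ccontr)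
      assume "\<not> length (P w) \<le> length (P v)"
      then have "length (P v) - 1 + 1 \<le> length (P w) - 1" using q by simp
      then have "(length (P v) - 1 + 1) * card S \<le> (length (P w) - 1) * card S" by (rule mult_le_mono1)
      then show False using w(2) rk_less[OF v(1)] by (simp add: R_def)
    qed
    have "cle \<tau> K w x1 \<or> cle \<tau> K x1 w"
    proof (cases "length (P w) = length (P v)")
      case False
      then have "length (P w) < length (v # x1 # q)" using len q by simp
      then show ?thesis using low_dominated[OF _ cn] high_dominated[OF _ cn] P[OF v(1)] hw q
        unfolding zigzag_def by auto
    next
      case True
      then have rk: "rk w \<le> rk v" using w(2) by (simp add: R_def)
      have types: "\<tau> v \<in> S" "\<tau> w \<in> S" using complex_of_typeD(3)[OF type] v(1) wV by auto
      have lowvw: "low (P v) \<longleftrightarrow> low (P w)"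
        using True P[OF v(1)] P[OF wV] normal_form_parity[of "cle \<tau> K" y "\<tau> y = Min S"]
          normal_form_parity[of "(cle \<tau> K)\<inverse>\<inverse>" y "\<tau> y \<noteq> Min S"]
        unfolding zigzag_def by metis
      show ?thesis
      proof (cases "low (P v)")
        case lo: True
        have "\<not> cle \<tau> K v w"
        proof
          assume "cle \<tau> K v w"
          then have "\<tau> v < \<tau> w" using vw(2) by (rule type_less_if_cle)
          then have "{s \<in> S. s < \<tau> v} \<subset> {s \<in> S. s < \<tau> w}" using types by auto
          then have "card {s \<in> S. s < \<tau> v} < card {s \<in> S. s < \<tau> w}" using fin by (auto intro: psubset_card_mono)
          then show False using rk lo lowvw by (simp add: rk_def)
        qed
        then show ?thesis using low_dominated[OF _ cn] lo q True hw vw(1) by auto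
      next
        case hi: False
        have "\<not> cle \<tau> K w v"
        proof
          assume "cle \<tau> K w v"
          then have "\<tau> w < \<tau> v" using vw(2)[symmetric] by (rule type_less_if_cle)
          then have "{s \<in> S. \<tau> v < s} \<subset> {s \<in> S. \<tau> w < s}" using types by auto
          then have "card {s \<in> S. \<tau> v < s} < card {s \<in> S. \<tau> w < s}" using fin by (auto intro: psubset_card_mono)
          then show False using rk hi lowvw by (simp add: rk_def)
        qed
        moreover have "high (P v)" using hi P[OF v(1)] by (simp add: zigzag_def)
        ultimately show ?thesis using high_dominated[OF _ cn] q True hw vw(1) by auto
      qed
    qed
    then show "{v, w, r v} \<in> K"
      using vw cmp rv refl1 refl2 by (intro pairwise_comparable_simplex[OF type flag]) auto
  qed
qed

end

theorem proposition3p17: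
  fixes S :: "'s::linorder set" and \<tau> :: "'v \<Rightarrow> 's" and X Y :: "'v set set"
  assumes "complex_of_type S \<tau> X"
    and "flag_complex X"
    and "C_tilde_like \<tau> X"
    and "locally_determined S \<tau> X"
    and "connected_space (realization Y)"
    and "locally_determined S \<tau> Y"
    and "locally_convex S \<tau> X Y"
  shows "C_tilde_like \<tau> Y \<and>
    (\<forall>y1\<in>vertices Y. \<forall>y2\<in>vertices Y. \<forall>\<omega>.
       extremal S \<tau> y2 \<and> local_normal_form_path \<tau> X y1 y2 \<omega> \<longrightarrow> edge_path Y \<omega>)"
proof -
  have posetX: "flag_poset (cle \<tau> X)" using flag_poset_if_C_tilde_like[OF assms(1,3)] .
  have scX: "simply_connected_space (realization X)" using assms(3) by (simp add: C_tilde_like_def)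
  have conv: "convex_subposet (cle \<tau> X) (vertices Y)"
    using convex_subposet_if_locally_convex[OF assms(1,2) posetX assms(7)] .
  have Y: "Y = full_subcomplex X (vertices Y)" and typeY: "complex_of_type S \<tau> Y"
    using assms(7) unfolding locally_convex_def by blast+
  have aY: "abs_complex Y" using complex_of_typeD(2)[OF typeY] .
  have leY: "cle \<tau> Y = restrict_le (vertices Y) (cle \<tau> X)" using cle_full_subcomplex[OF aY Y] .
  have posetY: "flag_poset (cle \<tau> Y)"
    unfolding leY using convex_subposet.flag_poset_restrict[OF conv] .
  have flagY: "flag_complex Y"
    unfolding flag_complex_def
  proof (intro allI impI, elim conjE)
    fix \<sigma> assume \<sigma>: "finite \<sigma>" "\<sigma> \<noteq> {}" "\<sigma> \<subseteq> vertices Y" "\<forall>u\<in>\<sigma>. \<forall>v\<in>\<sigma>. u \<noteq> v \<longrightarrow> adjacent Y u v"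
    have "Y \<subseteq> X" using Y unfolding full_subcomplex_def by blast
    then have "\<forall>u\<in>\<sigma>. \<forall>v\<in>\<sigma>. u \<noteq> v \<longrightarrow> adjacent X u v" using \<sigma>(4) by (auto simp: adjacent_def)
    moreover have "\<sigma> \<subseteq> vertices X" using \<sigma>(3) full_subcomplex_vertices[OF Y] by blast
    ultimately have "\<sigma> \<in> X" using assms(2)[unfolded flag_complex_def, THEN spec, of \<sigma>] \<sigma>(1,2) by blast
    then have "\<sigma> \<in> full_subcomplex X (vertices Y)" using \<sigma>(3) by (simp add: full_subcomplex_def)
    then show "\<sigma> \<in> Y" using Y by (rule ssubst[rotated])
  qed
  have baseX: "based_complex S \<tau> X y" and baseY: "based_complex S \<tau> Y y"
    if "y \<in> vertices Y" "extremal S \<tau> y" for y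
    using that assms(1,2) posetX typeY flagY posetY full_subcomplex_vertices[OF Y]
    by (auto intro!: based_complex.intro)
  let ?zz = "\<lambda>K y. based_flag_poset.zigzag (cle \<tau> K) y (\<tau> y = Min S)"
  have YX: "?zz X y p" if "y \<in> vertices Y" "extremal S \<tau> y" "?zz Y y p" for y p
  proof -
    interpret X: based_complex S \<tau> X y using baseX that by blast
    interpret Y: based_complex S \<tau> Y y using baseY that by blast
    have "Y.low p \<or> Y.high p" using that(3) unfolding Y.zigzag_def .
    then show ?thesis
      using normal_form_restrict[OF conv] normal_form_restrict[OF convex_subposet.converse_convex[OF conv]]
      unfolding X.zigzag_def leY restrict_le_converse by blast
  qed
  have uniqX: "p = p'" if "y \<in> vertices Y" "extremal S \<tau> y" "?zz X y p" "?zz X y p'" "hd p = hd p'" for y p p'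
    using based_complex.zigzag_unique[OF baseX[OF that(1,2)] scX that(3-5)] .
  have scY: "simply_connected_space (realization Y)"
  \<comment> \<open>Connectedness of the realization allows \<open>Y\<close> to be empty, and then
    there is no base vertex to choose.\<close>
  proof (cases "vertices Y = {}")
    case True
    then have "Y = {}" using abs_complexD(2,3)[OF aY] unfolding vertices_def by blast
    then have "topspace (realization Y) = {}" by (simp add: topspace_realization)
    then show ?thesis
      by (auto simp: simply_connected_space_def path_connected_space_def pathin_def continuous_map_def Pi_iff)
  next
    case False
    then obtain y where y: "y \<in> vertices Y" "extremal S \<tau> y" using exists_extremal_vertex[OF typeY] by blast
    show ?thesis
      by (rule based_complex.simply_connected_if_unique_zigzags[OF baseY[OF y]])
        (use based_complex.zigzag_exists[OF baseY[OF y] assms(5)] YX[OF y] uniqX[OF y] in blast)+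
  qed
  have "edge_path Y \<omega>" if y: "y1 \<in> vertices Y" "y2 \<in> vertices Y" "extremal S \<tau> y2"
    and \<omega>: "local_normal_form_path \<tau> X y1 y2 \<omega>" for y1 y2 \<omega>
  proof -
    obtain p where p: "?zz Y y2 p" "hd p = y1"
      using based_complex.zigzag_exists[OF baseY[OF y(2,3)] assms(5) y(1)] by blast
    have "?zz X y2 \<omega>" using based_complex.local_normal_form_path_zigzag[OF baseX[OF y(2,3)] \<omega>] .
    moreover have "hd \<omega> = y1" using \<omega> by (simp add: local_normal_form_path_def)
    ultimately have "\<omega> = p" using uniqX[OF y(2,3)] YX[OF y(2,3) p(1)] p(2) by blast
    then show ?thesis using based_complex.zigzag_edge_path[OF baseY[OF y(2,3)]] p(1) by blast
  qed
  then show ?thesis using C_tilde_like_if_flag_poset[OF posetY scY] by blast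
qed

end
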